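(* Let $X_\Sigma$ be a projective toric manifold with mirror Landau-Ginzburg model $(Y,W)$ and torus fibration $\mu_Y:Y\to N_{\mathbb{R}}$. The image of the SYZ mirror transformation $\mathcal{F}$ is $\mathbb{L}(Y,W)$; i.e. for a Lagrangian section $L$ of $\mu_Y:Y\to N_{\mathbb{R}}$, there exists a $T_N$-invariant hermitian metric $h$ (of class $C^2$) on a holomorphic line bundle over $X_\Sigma$ such that $L=L_h=\mathcal{F}(h)$ if and only if $L$ satisfies the growth condition $(\ast_{[a]})$ for some $[a]\in A(W)$.
   Context: Toric setting. $N\cong\mathbb{Z}^n$ is a lattice, $M=\mathrm{Hom}(N,\mathbb{Z})$, $\langle\cdot,\cdot\rangle$ the dual pairing, $N_{\mathbb{R}}=N\otimes\mathbb{R}$, $M_{\mathbb{R}}=M\otimes\mathbb{R}$, $T_N=N_{\mathbb{R}}/N$ (compact torus). $\Sigma$ is a smooth complete fan in $N_{\mathbb{R}}$ such that the toric $n$-fold $X_\Sigma$ is projective; $v_1,\dots,v_d\in N$ are the primitive generators of its 1-dimensional cones and $D_1,\dots,D_d\subset X_\Sigma$ the corresponding toric prime divisors. The open dense orbit is $U=X_\Sigma\setminus\bigcup_i D_i=N\otimes\mathbb{C}^*\cong(\mathbb{C}^* )^n$, with coordinates $w_j=e^{\xi_j+\sqrt{-1}u_j}$, where $\xi=(\xi_1,\dots,\xi_n)$ are linear coordinates on $N_{\mathbb{R}}$ (from a $\mathbb{Z}$-basis of $N$) and $u_j\in\mathbb{R}/2\pi\mathbb{Z}$; $T_N$ acts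 by rotating the $u_j$. Let $\iota:M\hookrightarrow\mathbb{Z}^d$, $\iota(u)=(\langle u,v_1\rangle,\dots,\langle u,v_d\rangle)$. The quotient $A(W)=\mathbb{Z}^d/\iota(M)$ is canonically identified with $H^2(X_\Sigma,\mathbb{Z})$; the class $[a]$ of $a=(a_1,\dots,a_d)\in\mathbb{Z}^d$ corresponds to the line bundle $\mathcal{L}_{[a]}\cong\mathcal{O}(\sum_i a_iD_i)$. Mirror. $Y=T^*N_{\mathbb{R}}/M=N_{\mathbb{R}}\times\sqrt{-1}(M_{\mathbb{R}}/M)$ with symplectic form $\omega_Y=\sum_j d\xi_j\wedge dy_j$ ($y_j$ the dual coordinates on the fibre), and $\mu_Y:Y\to N_{\mathbb{R}}$ is the projection; the superpotential $W$ is a Laurent polynomial with monomial exponents $v_1,\dots,v_d$. A section $L$ of $\mu_Y$ lifts to a section $\tilde L=\{(\xi,y(\xi)):\xi\in N_{\mathbb{R}}\}$ of $T^*N_{\mathbb{R}}$, and two lifts differ by a constant $u\in M$. $L$ is Lagrangian iff some lift is the graph $y=dg$ of an exact 1-form; $g$ (unique up to an additive constant) is called a potential of $\tilde L$. Potentials are always assumed to be of class $C^2$. Growth conditions. For $a\in\mathbb{Z}^d$, a Lagrangian section $\tilde L$ of $T^*N_{\mathbb{R}}\to N_{\mathbb{R}}$ with potential $g\in C^2(N_{\mathbb{R}})$ satisfies $(\ast_a)$ if for every $n$-dimensional cone $\sigma\in\Sigma$, with generators (after relabelling) $v_1,\dots,v_n$, writing $\xi(t)=t_1v_1+\dots+t_nv_n$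 for $t\in\mathbb{R}^n$: (1) for $j=1,\dots,n$, the functions $2e^{-2t_j}(\langle dg(\xi(t)),v_j\rangle+a_j)$ and $e^{-2t_j}(v_j^T\mathrm{Hess}(g)v_j)(\xi(t))$ have the same limit as $t_j\to-\infty$; (2) for any $j,k,l\in\{1,\dots,n\}$, the function $(v_j^T\mathrm{Hess}(g)v_k)(\xi(t))$ has a limit as $t_l\to-\infty$; (3) for any distinct $j,k\in\{1,\dots,n\}$, the function $e^{-t_j-t_k}(v_j^T\mathrm{Hess}(g)v_k)(\xi(t))$ goes to zero when $t_j\to-\infty$ or $t_k\to-\infty$. (Here $a_j$ is the component of $a$ corresponding to $v_j$.) For $[a]\in A(W)$, a Lagrangian section $L$ of $\mu_Y$ satisfies $(\ast_{[a]})$ if some lift of $L$ to $T^*N_{\mathbb{R}}$ satisfies $(\ast_a)$ for some representative $a\in\mathbb{Z}^d$ of $[a]$. $\mathbb{L}(Y,W)$ is the set of Lagrangian sections of $\mu_Y$ satisfying $(\ast_{[a]})$ for some $[a]\in A(W)$. SYZ mirror transformation. Let $h$ be a $T_N$-invariant hermitian metric of class $C^2$ on $\mathcal{L}_{[a]}$. Choose a $T_N$-equivariant meromorphic section $s$ of $\mathcal{L}_{[a]}$ (so $\mathrm{div}(s)=\sum_i a_iD_i$ for some representative $a$ of $[a]$, and $s$ is a holomorphic frame over $U$), and set $g_h(\xi)=-\frac12\log h(s,s)$ evaluated at the point $(e^{\xi_j+\sqrt{-1}u_j})_j\in U$ (independent of $u$). Let $\tilde L_h=\{(\xi,dg_h(\xi)):\xi\in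 N_{\mathbb{R}}\}\subset T^*N_{\mathbb{R}}$ and let $L_h$ be the induced Lagrangian section of $\mu_Y:Y\to N_{\mathbb{R}}$; it does not depend on the choice of $s$. The SYZ mirror transformation is the map $\mathcal{F}:h\mapsto L_h$ from $T_N$-invariant $C^2$ hermitian metrics on holomorphic line bundles over $X_\Sigma$ to Lagrangian sections of $\mu_Y$.
   Formalization: The limits as t_j → -∞ in the growth conditions are taken to be uniform as long as the other coordinates t_k stay bounded above; with limits along each line separately the claim is false for n ≥ 2 (bumps accumulating at a point of a toric divisor). *)

theory Defs
  imports "HOL-Analysis.Analysis"
begin

section \<open>Calculus\<close>

definition C1_fun :: "('a::real_normed_vector \<Rightarrow> 'b::real_normed_vector) \<Rightarrow> bool" where
  "C1_fun f \<longleftrightarrow>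
     (\<exists>f' :: 'a \<Rightarrow> 'a \<Rightarrow>\<^sub>L 'b. (\<forall>x. (f has_derivative blinfun_apply (f' x)) (at x))
        \<and> continuous_on UNIV f')"

definition C2_fun :: "('a::real_normed_vector \<Rightarrow> 'b::real_normed_vector) \<Rightarrow> bool" where
  "C2_fun f \<longleftrightarrow>
     (\<exists>f' :: 'a \<Rightarrow> 'a \<Rightarrow>\<^sub>L 'b. (\<forall>x. (f has_derivative blinfun_apply (f' x)) (at x))
        \<and> C1_fun f')"

definition dir_deriv :: "(real^'n \<Rightarrow> real) \<Rightarrow> real^'n \<Rightarrow> real^'n \<Rightarrow> real" where
  "dir_deriv g \<xi> v = frechet_derivative g (at \<xi>) v"

definition hess :: "(real^'n \<Rightarrow> real) \<Rightarrow> real^'n \<Rightarrow> real^'n \<Rightarrow> real^'n \<Rightarrow> real" where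
  "hess g \<xi> v w = dir_deriv (\<lambda>x. dir_deriv g x w) \<xi> v"

definition grad :: "(real^'n \<Rightarrow> real) \<Rightarrow> real^'n \<Rightarrow> real^'n" where
  "grad g \<xi> = (\<chi> i. dir_deriv g \<xi> (axis i 1))"

text \<open>Holomorphic functions of several variables: complex differentiable at every point.\<close>

definition holo_fun :: "(complex^'n \<Rightarrow> complex) \<Rightarrow> (complex^'n) set \<Rightarrow> bool" where
  "holo_fun f W \<longleftrightarrow>
     (\<forall>z\<in>W. \<exists>D. (f has_derivative D) (at z) \<and> (\<forall>c v. D (c *s v) = c * D v))"


section \<open>Lattices and fans\<close>

text \<open>A \<open>\<int>\<close>-basis identifies \<open>N\<close> with the integer vectors in \<open>N\<^sub>\<real> = real^'n\<close>, and the dual basis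
  identifies \<open>M\<close> with the same lattice; the pairing of \<open>M\<^sub>\<real>\<close> with \<open>N\<^sub>\<real>\<close> is the inner product.\<close>

definition int_lattice :: "(real^'n) set" where
  "int_lattice = {x. \<forall>i. x $ i \<in> \<int>}"

definition zbasis :: "('n::finite \<Rightarrow> real^'n) \<Rightarrow> bool" where
  "zbasis b \<longleftrightarrow> (\<forall>i. b i \<in> int_lattice) \<and>
     (\<forall>x\<in>int_lattice. \<exists>!c :: 'n \<Rightarrow> int. x = (\<Sum>i\<in>UNIV. of_int (c i) *\<^sub>R b i))"

definition fan :: "(real^'n) set set \<Rightarrow> bool" where
  "fan \<Sigma> \<longleftrightarrow> finite \<Sigma> \<and> \<Sigma> \<noteq> {} \<and>
     (\<forall>\<sigma>\<in>\<Sigma>. (\<exists>G. finite G \<and> G \<subseteq> int_lattice \<and> \<sigma> = convex_cone hull G)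
        \<and> (\<forall>x. x \<in> \<sigma> \<and> - x \<in> \<sigma> \<longrightarrow> x = 0)) \<and>
     (\<forall>\<sigma>\<in>\<Sigma>. \<forall>\<tau>. \<tau> face_of \<sigma> \<and> \<tau> \<noteq> {} \<longrightarrow> \<tau> \<in> \<Sigma>) \<and>
     (\<forall>\<sigma>\<in>\<Sigma>. \<forall>\<sigma>'\<in>\<Sigma>. \<sigma> \<inter> \<sigma>' face_of \<sigma> \<and> \<sigma> \<inter> \<sigma>' face_of \<sigma>')"

definition smooth_fan :: "(real^'n) set set \<Rightarrow> bool" where
  "smooth_fan \<Sigma> \<longleftrightarrow> fan \<Sigma> \<and> (\<forall>\<sigma>\<in>\<Sigma>. \<exists>b J. zbasis b \<and> \<sigma> = convex_cone hull (b ` J))"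

definition complete_fan :: "(real^'n) set set \<Rightarrow> bool" where
  "complete_fan \<Sigma> \<longleftrightarrow> fan \<Sigma> \<and> \<Union>\<Sigma> = UNIV"

definition primitive :: "real^'n \<Rightarrow> bool" where
  "primitive v \<longleftrightarrow> v \<in> int_lattice \<and> v \<noteq> 0 \<and>
     (\<forall>u\<in>int_lattice. \<forall>k::nat. v = real k *\<^sub>R u \<longrightarrow> k = 1)"

text \<open>The generators \<open>v\<^sub>1, \<dots>, v\<^sub>d\<close>. The index set of \<open>\<int>\<^sup>d\<close> is \<open>rays \<Sigma>\<close> itself.\<close>

definition rays :: "(real^'n) set set \<Rightarrow> (real^'n) set" where
  "rays \<Sigma> = {v. primitive v \<and> convex_cone hull {v} \<in> \<Sigma>}"

text \<open>The \<open>n\<close>-dimensional cones of a smooth fan, with their generators labelled by \<open>'n\<close>.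
  All labellings occur.\<close>

definition frames :: "(real^'n) set set \<Rightarrow> ('n \<Rightarrow> real^'n) set" where
  "frames \<Sigma> = {b. zbasis b \<and> convex_cone hull (range b) \<in> \<Sigma>}"

definition fcone :: "('n \<Rightarrow> real^'n) \<Rightarrow> (real^'n) set" where
  "fcone b = convex_cone hull (range b)"

definition Zd :: "(real^'n) set set \<Rightarrow> (real^'n \<Rightarrow> int) set" where
  "Zd \<Sigma> = (rays \<Sigma> \<rightarrow>\<^sub>E UNIV)"

text \<open>\<open>A(W) = \<int>\<^sup>d / \<iota>(M)\<close> as a set of cosets.\<close>

definition iota_rel :: "(real^'n) set set \<Rightarrow> ((real^'n \<Rightarrow> int) \<times> (real^'n \<Rightarrow> int)) set" where
  "iota_rel \<Sigma> = {(a, a'). a \<in> Zd \<Sigma> \<and> a' \<in> Zd \<Sigma> \<and>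
     (\<exists>u\<in>int_lattice. \<forall>v\<in>rays \<Sigma>. of_int (a' v) = of_int (a v) + u \<bullet> v)}"

definition AW :: "(real^'n) set set \<Rightarrow> (real^'n \<Rightarrow> int) set set" where
  "AW \<Sigma> = Zd \<Sigma> // iota_rel \<Sigma>"


section \<open>The toric variety\<close>

definition dual_monoid :: "(real^'n) set \<Rightarrow> (real^'n) set" where
  "dual_monoid \<sigma> = {m \<in> int_lattice. \<forall>x\<in>\<sigma>. 0 \<le> m \<bullet> x}"

text \<open>The complex points of \<open>U\<^sub>\<sigma> = Spec \<complex>[\<sigma>\<^sup>\<or> \<inter> M]\<close> are the monoid homomorphisms from
  \<open>\<sigma>\<^sup>\<or> \<inter> M\<close> to \<open>(\<complex>, \<cdot>)\<close>; the value of the character \<open>\<chi>\<^sup>m\<close> at \<open>\<gamma>\<close> is \<open>\<gamma> m\<close>.\<close>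

definition affine_pts :: "(real^'n) set \<Rightarrow> (real^'n \<Rightarrow> complex) set" where
  "affine_pts \<sigma> = {\<gamma>. \<gamma> \<in> extensional (dual_monoid \<sigma>) \<and> \<gamma> 0 = 1 \<and>
     (\<forall>m\<in>dual_monoid \<sigma>. \<forall>m'\<in>dual_monoid \<sigma>. \<gamma> (m + m') = \<gamma> m * \<gamma> m')}"

text \<open>\<open>X\<^sub>\<Sigma>\<close> is obtained by gluing \<open>U\<^sub>\<sigma>\<close> and \<open>U\<^sub>\<sigma>\<^sub>'\<close> along \<open>U\<^sub>\<sigma>\<^sub>\<inter>\<^sub>\<sigma>\<^sub>'\<close>, whose inclusions are given by
  restriction of homomorphisms.\<close>

definition glue_rel ::
  "(real^'n) set set \<Rightarrow>
     (((real^'n) set \<times> (real^'n \<Rightarrow> complex)) \<times> ((real^'n) set \<times> (real^'n \<Rightarrow> complex))) set" where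
  "glue_rel \<Sigma> = {((\<sigma>, \<gamma>), (\<sigma>', \<gamma>')). \<sigma> \<in> \<Sigma> \<and> \<sigma>' \<in> \<Sigma> \<and>
     (\<exists>\<delta>\<in>affine_pts (\<sigma> \<inter> \<sigma>').
        \<gamma> = restrict \<delta> (dual_monoid \<sigma>) \<and> \<gamma>' = restrict \<delta> (dual_monoid \<sigma>'))}"

type_synonym 'n toric_pt = "((real^'n) set \<times> (real^'n \<Rightarrow> complex)) set"

definition xpt :: "(real^'n) set set \<Rightarrow> (real^'n) set \<Rightarrow> (real^'n \<Rightarrow> complex) \<Rightarrow> 'n toric_pt" where
  "xpt \<Sigma> \<sigma> \<gamma> = glue_rel \<Sigma> `` {(\<sigma>, \<gamma>)}"

definition toric_variety :: "(real^'n) set set \<Rightarrow> 'n toric_pt set" where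
  "toric_variety \<Sigma> = (SIGMA \<sigma>:\<Sigma>. affine_pts \<sigma>) // glue_rel \<Sigma>"

text \<open>For an \<open>n\<close>-dimensional cone with generators \<open>b\<close>, the isomorphism \<open>\<complex>\<^sup>n \<cong> U\<^sub>\<sigma>\<close>: the coordinate
  \<open>z\<^sub>j\<close> is the character of the \<open>j\<close>-th element of the dual basis, so \<open>\<chi>\<^sup>m = \<Prod>\<^sub>j z\<^sub>j\<^bsup>\<langle>m,b\<^sub>j\<rangle>\<^esup>\<close>.
  These are the charts of the complex manifold \<open>X\<^sub>\<Sigma>\<close> (they cover it when \<open>\<Sigma>\<close> is complete).\<close>

definition chart :: "('n \<Rightarrow> real^'n) \<Rightarrow> complex^'n \<Rightarrow> real^'n \<Rightarrow> complex" where
  "chart b z = restrict (\<lambda>m. \<Prod>j\<in>UNIV. (z $ j) ^ nat \<lfloor>m \<bullet> b j\<rfloor>) (dual_monoid (fcone b))"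

text \<open>The point of the open orbit \<open>U = N \<otimes> \<complex>\<^sup>* = U\<^bsub>{0}\<^esub>\<close> with coordinates \<open>w\<close>.\<close>

definition orbit_hom :: "complex^'n \<Rightarrow> real^'n \<Rightarrow> complex" where
  "orbit_hom w = restrict (\<lambda>m. \<Prod>j\<in>UNIV. (w $ j) powi \<lfloor>m $ j\<rfloor>) (dual_monoid {0})"

definition orbit_pt :: "(real^'n) set set \<Rightarrow> complex^'n \<Rightarrow> 'n toric_pt" where
  "orbit_pt \<Sigma> w = xpt \<Sigma> {0} (orbit_hom w)"

definition open_orbit :: "(real^'n) set set \<Rightarrow> 'n toric_pt set" where
  "open_orbit \<Sigma> = {orbit_pt \<Sigma> w | w. \<forall>j. w $ j \<noteq> 0}"

text \<open>The element \<open>\<theta>\<close> of \<open>(\<real>/2\<pi>\<int>)\<^sup>n\<close> acts by \<open>w\<^sub>j \<mapsto> e\<^bsup>i\<theta>\<^sub>j\<^esup> w\<^sub>j\<close>.\<close>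

definition rot :: "real^'n \<Rightarrow> (real^'n) set \<Rightarrow> (real^'n \<Rightarrow> complex) \<Rightarrow> real^'n \<Rightarrow> complex" where
  "rot \<theta> \<sigma> \<gamma> = restrict (\<lambda>m. cis (m \<bullet> \<theta>) * \<gamma> m) (dual_monoid \<sigma>)"

definition xact :: "real^'n \<Rightarrow> 'n toric_pt \<Rightarrow> 'n toric_pt" where
  "xact \<theta> x = (\<lambda>(\<sigma>, \<gamma>). (\<sigma>, rot \<theta> \<sigma> \<gamma>)) ` x"

text \<open>Projectivity: \<open>X\<^sub>\<Sigma>\<close> has a holomorphic embedding into some \<open>\<complex>P\<^sup>k\<close>. A point of \<open>\<complex>P\<^sup>k\<close> is the
  class of a homogeneous coordinate vector \<open>f 0, \<dots>, f k\<close>. As \<open>X\<^sub>\<Sigma>\<close> is compact, an embedding is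
  an injective immersion; in homogeneous coordinates, the immersion property says that no nonzero
  tangent vector is mapped into the line spanned by \<open>f\<close>.\<close>

definition cp_pt :: "nat \<Rightarrow> (nat \<Rightarrow> complex) \<Rightarrow> (nat \<Rightarrow> complex) set" where
  "cp_pt k f = {g. \<exists>c. c \<noteq> 0 \<and> (\<forall>i\<le>k. g i = c * f i)}"

definition projective_toric :: "(real^'n) set set \<Rightarrow> bool" where
  "projective_toric \<Sigma> \<longleftrightarrow>
     (\<exists>k. \<exists>\<Phi> :: 'n toric_pt \<Rightarrow> (nat \<Rightarrow> complex) set.
        inj_on \<Phi> (toric_variety \<Sigma>) \<and>
        (\<forall>b\<in>frames \<Sigma>. \<forall>z0. \<exists>W f. open W \<and> z0 \<in> W \<and> (\<forall>i\<le>k. holo_fun (f i) W) \<and>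
           (\<forall>z\<in>W. (\<exists>i\<le>k. f i z \<noteq> 0) \<and>
              \<Phi> (xpt \<Sigma> (fcone b) (chart b z)) = cp_pt k (\<lambda>i. f i z) \<and>
              (\<forall>v c. (\<forall>i\<le>k. frechet_derivative (f i) (at z) v = c * f i z) \<longrightarrow> v = 0))))"


section \<open>The line bundles\<close>

text \<open>The bundle \<open>O(\<Sum>\<^sub>v a\<^sub>v D\<^sub>v)\<close> has over \<open>U\<^sub>\<sigma>\<close> the frame \<open>e\<^sub>m = \<chi>\<^bsup>-m\<^esup>\<close> (a rational function) for
  every \<open>m\<close> with \<open>\<langle>m,v\<rangle> = a\<^sub>v\<close> for all generators \<open>v\<close> of \<open>\<sigma>\<close>. The quadruple \<open>(\<sigma>, m, \<gamma>, c)\<close> stands for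
  the vector \<open>c e\<^sub>m\<close> over the point \<open>\<gamma>\<close> of \<open>U\<^sub>\<sigma>\<close>. On overlaps \<open>e\<^sub>m = \<chi>\<^bsup>m'-m\<^esup> e\<^sub>m\<^sub>'\<close>.\<close>

definition local_data :: "(real^'n) set set \<Rightarrow> (real^'n \<Rightarrow> int) \<Rightarrow> (real^'n) set \<Rightarrow> (real^'n) set" where
  "local_data \<Sigma> a \<sigma> = {m \<in> int_lattice. \<forall>v \<in> rays \<Sigma> \<inter> \<sigma>. m \<bullet> v = of_int (a v)}"

type_synonym 'n lvect = "((real^'n) set \<times> (real^'n) \<times> (real^'n \<Rightarrow> complex) \<times> complex) set"

definition lglue_rel ::
  "(real^'n) set set \<Rightarrow> (real^'n \<Rightarrow> int) \<Rightarrow>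
     (((real^'n) set \<times> (real^'n) \<times> (real^'n \<Rightarrow> complex) \<times> complex) \<times>
      ((real^'n) set \<times> (real^'n) \<times> (real^'n \<Rightarrow> complex) \<times> complex)) set" where
  "lglue_rel \<Sigma> a = {((\<sigma>, m, \<gamma>, c), (\<sigma>', m', \<gamma>', c')). \<sigma> \<in> \<Sigma> \<and> \<sigma>' \<in> \<Sigma> \<and>
     m \<in> local_data \<Sigma> a \<sigma> \<and> m' \<in> local_data \<Sigma> a \<sigma>' \<and>
     (\<exists>\<delta>\<in>affine_pts (\<sigma> \<inter> \<sigma>').
        \<gamma> = restrict \<delta> (dual_monoid \<sigma>) \<and> \<gamma>' = restrict \<delta> (dual_monoid \<sigma>') \<and>
        c' = \<delta> (m' - m) * c)}"

definition lvec ::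
  "(real^'n) set set \<Rightarrow> (real^'n \<Rightarrow> int) \<Rightarrow> (real^'n) set \<Rightarrow> real^'n \<Rightarrow> (real^'n \<Rightarrow> complex) \<Rightarrow>
     complex \<Rightarrow> 'n lvect" where
  "lvec \<Sigma> a \<sigma> m \<gamma> c = lglue_rel \<Sigma> a `` {(\<sigma>, m, \<gamma>, c)}"

definition lfibre ::
  "(real^'n) set set \<Rightarrow> (real^'n \<Rightarrow> int) \<Rightarrow> 'n toric_pt \<Rightarrow> 'n lvect set" where
  "lfibre \<Sigma> a x = {lvec \<Sigma> a \<sigma> m \<gamma> c | \<sigma> m \<gamma> c.
     \<sigma> \<in> \<Sigma> \<and> m \<in> local_data \<Sigma> a \<sigma> \<and> \<gamma> \<in> affine_pts \<sigma> \<and> x = xpt \<Sigma> \<sigma> \<gamma>}"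

definition lscale :: "complex \<Rightarrow> 'n::finite lvect \<Rightarrow> 'n lvect" where
  "lscale k p = (\<lambda>(\<sigma>, m, \<gamma>, c). (\<sigma>, m, \<gamma>, k * c)) ` p"

text \<open>The \<open>T\<^sub>N\<close>-action on \<open>O(\<Sum>\<^sub>v a\<^sub>v D\<^sub>v)\<close> induced by that on rational functions, under which
  \<open>e\<^sub>m = \<chi>\<^bsup>-m\<^esup>\<close> is multiplied by \<open>\<chi>\<^sup>m\<close>.\<close>

definition lact :: "real^'n \<Rightarrow> 'n lvect \<Rightarrow> 'n lvect" where
  "lact \<theta> p = (\<lambda>(\<sigma>, m, \<gamma>, c). (\<sigma>, m, rot \<theta> \<sigma> \<gamma>, cis (m \<bullet> \<theta>) * c)) ` p"

text \<open>Hermitian metrics: a positive definite hermitian form on every fibre. As the fibres are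
  one-dimensional, such a form is determined by the positive number \<open>H = h(e\<^sub>m, e\<^sub>m)\<close>.\<close>

definition hermitian_metric ::
  "(real^'n) set set \<Rightarrow> (real^'n \<Rightarrow> int) \<Rightarrow> ('n lvect \<Rightarrow> 'n lvect \<Rightarrow> complex) \<Rightarrow> bool" where
  "hermitian_metric \<Sigma> a h \<longleftrightarrow>
     (\<forall>\<sigma>\<in>\<Sigma>. \<forall>m\<in>local_data \<Sigma> a \<sigma>. \<forall>\<gamma>\<in>affine_pts \<sigma>. \<exists>H::real. H > 0 \<and>
        (\<forall>c d. h (lvec \<Sigma> a \<sigma> m \<gamma> c) (lvec \<Sigma> a \<sigma> m \<gamma> d) = c * cnj d * of_real H))"

definition C2_metric ::
  "(real^'n) set set \<Rightarrow> (real^'n \<Rightarrow> int) \<Rightarrow> ('n lvect \<Rightarrow> 'n lvect \<Rightarrow> complex) \<Rightarrow> bool" where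
  "C2_metric \<Sigma> a h \<longleftrightarrow>
     (\<forall>b\<in>frames \<Sigma>. \<forall>m\<in>local_data \<Sigma> a (fcone b).
        C2_fun (\<lambda>z. h (lvec \<Sigma> a (fcone b) m (chart b z) 1) (lvec \<Sigma> a (fcone b) m (chart b z) 1)))"

definition TN_invariant ::
  "(real^'n) set set \<Rightarrow> (real^'n \<Rightarrow> int) \<Rightarrow> ('n lvect \<Rightarrow> 'n lvect \<Rightarrow> complex) \<Rightarrow> bool" where
  "TN_invariant \<Sigma> a h \<longleftrightarrow>
     (\<forall>\<theta>. \<forall>x\<in>toric_variety \<Sigma>. \<forall>p\<in>lfibre \<Sigma> a x. \<forall>q\<in>lfibre \<Sigma> a x.
        h (lact \<theta> p) (lact \<theta> q) = h p q)"

definition metrics ::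
  "(real^'n) set set \<Rightarrow> (real^'n \<Rightarrow> int) \<Rightarrow> ('n lvect \<Rightarrow> 'n lvect \<Rightarrow> complex) set" where
  "metrics \<Sigma> a = {h. hermitian_metric \<Sigma> a h \<and> C2_metric \<Sigma> a h \<and> TN_invariant \<Sigma> a h}"

text \<open>Nonzero \<open>T\<^sub>N\<close>-equivariant meromorphic sections. Equivariance is up to a character of \<open>T\<^sub>N\<close>, i.e.
  with respect to some lift of the \<open>T\<^sub>N\<close>-action to the bundle; this is what allows \<open>div s\<close> to be
  any toric divisor in the given class. Since the polar divisor of such a section is
  \<open>T\<^sub>N\<close>-invariant, poles only occur along the toric divisors, i.e. along the coordinate hyperplanes
  \<open>z\<^sub>j = 0\<close> of the charts.\<close>

definition equivariant_section ::
  "(real^'n) set set \<Rightarrow> (real^'n \<Rightarrow> int) \<Rightarrow> ('n toric_pt \<Rightarrow> 'n lvect) \<Rightarrow> bool" where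
  "equivariant_section \<Sigma> a s \<longleftrightarrow>
     (\<forall>x\<in>open_orbit \<Sigma>. s x \<in> lfibre \<Sigma> a x) \<and>
     (\<exists>x\<in>open_orbit \<Sigma>. s x \<noteq> lscale 0 (s x)) \<and>
     (\<forall>b\<in>frames \<Sigma>. \<forall>m\<in>local_data \<Sigma> a (fcone b). \<exists>k::nat. \<exists>F. holo_fun F UNIV \<and>
        (\<forall>z. (\<forall>j. z $ j \<noteq> 0) \<longrightarrow>
           s (xpt \<Sigma> (fcone b) (chart b z))
             = lvec \<Sigma> a (fcone b) m (chart b z) (F z / (\<Prod>j\<in>UNIV. z $ j) ^ k))) \<and>
     (\<exists>u\<in>int_lattice. \<forall>\<theta>. \<forall>x\<in>open_orbit \<Sigma>.
        s (xact \<theta> x) = lscale (cis (u \<bullet> \<theta>)) (lact \<theta> (s x)))"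


section \<open>The mirror side\<close>

text \<open>Points of \<open>Y = N\<^sub>\<real> \<times> (M\<^sub>\<real>/M)\<close>; the fibre coordinate is a coset of \<open>M\<close>.\<close>

definition mcoset :: "real^'n \<Rightarrow> (real^'n) set" where
  "mcoset y = {y + u | u. u \<in> int_lattice}"

type_synonym 'n section_Y = "real^'n \<Rightarrow> (real^'n) \<times> (real^'n) set"

text \<open>\<open>y\<close> describes the lift \<open>{(\<xi>, y(\<xi>))}\<close> of the (continuously differentiable) section \<open>L\<close> of
  \<open>\<mu>\<^sub>Y\<close> to \<open>T\<^sup>*N\<^sub>\<real>\<close>.\<close>

definition is_lift :: "(real^'n \<Rightarrow> real^'n) \<Rightarrow> 'n::finite section_Y \<Rightarrow> bool" where
  "is_lift y L \<longleftrightarrow> C1_fun y \<and> (\<forall>\<xi>. L \<xi> = (\<xi>, mcoset (y \<xi>)))"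

definition omega_Y :: "(real^'n) \<times> (real^'n) \<Rightarrow> (real^'n) \<times> (real^'n) \<Rightarrow> real" where
  "omega_Y p q = fst p \<bullet> snd q - snd p \<bullet> fst q"

definition lagrangian_section :: "'n::finite section_Y \<Rightarrow> bool" where
  "lagrangian_section L \<longleftrightarrow>
     (\<exists>y. is_lift y L \<and>
        (\<forall>\<xi> p q. omega_Y (p, frechet_derivative y (at \<xi>) p) (q, frechet_derivative y (at \<xi>) q) = 0))"

text \<open>\<open>f\<close> has the limit \<open>\<Lambda>\<close> as \<open>t\<^sub>l \<rightarrow> -\<infinity>\<close>. The limit is a function of the remaining coordinates,
  and convergence is uniform as long as these stay bounded above. In the chart coordinates
  \<open>\<bar>z\<^sub>j\<bar> = exp t\<^sub>j\<close> this is convergence up to the divisor \<open>z\<^sub>l = 0\<close> of \<open>\<complex>\<^sup>n\<close>, uniform on bounded sets (thus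
  also near the deeper strata); convergence on each single line parallel to the \<open>t\<^sub>l\<close>-axis would not
  control continuity along the divisor.\<close>

definition lim_minf ::
  "'n \<Rightarrow> (real^'n \<Rightarrow> real) \<Rightarrow> (real^'n \<Rightarrow> real) \<Rightarrow> bool" where
  "lim_minf l f \<Lambda> \<longleftrightarrow>
     (\<forall>c. uniform_limit {t. \<forall>k. k \<noteq> l \<longrightarrow> t $ k \<le> c}
        (\<lambda>r t. f (\<chi> k. if k = l then r else t $ k)) \<Lambda> at_bot)"

text \<open>\<open>growth \<Sigma> a y\<close> is the condition \<open>(\<ast>\<^sub>a)\<close> for the Lagrangian section \<open>{(\<xi>, y(\<xi>))}\<close> of
  \<open>T\<^sup>*N\<^sub>\<real>\<close>.\<close>

definition growth :: "(real^'n) set set \<Rightarrow> (real^'n \<Rightarrow> int) \<Rightarrow> (real^'n \<Rightarrow> real^'n) \<Rightarrow> bool" where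
  "growth \<Sigma> a y \<longleftrightarrow> (\<exists>g. C2_fun g \<and> y = grad g \<and>
     (\<forall>b\<in>frames \<Sigma>. let \<xi> = (\<lambda>t::real^'n. \<Sum>j\<in>UNIV. (t $ j) *\<^sub>R b j) in
        (\<forall>j. \<exists>\<Lambda>.
           lim_minf j (\<lambda>t. 2 * exp (- 2 * t $ j) * (dir_deriv g (\<xi> t) (b j) + of_int (a (b j)))) \<Lambda> \<and>
           lim_minf j (\<lambda>t. exp (- 2 * t $ j) * hess g (\<xi> t) (b j) (b j)) \<Lambda>) \<and>
        (\<forall>j k l. \<exists>\<Lambda>. lim_minf l (\<lambda>t. hess g (\<xi> t) (b j) (b k)) \<Lambda>) \<and>
        (\<forall>j k. j \<noteq> k \<longrightarrow>
           lim_minf j (\<lambda>t. exp (- t $ j - t $ k) * hess g (\<xi> t) (b j) (b k)) (\<lambda>_. 0) \<and>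
           lim_minf k (\<lambda>t. exp (- t $ j - t $ k) * hess g (\<xi> t) (b j) (b k)) (\<lambda>_. 0))))"

definition growth_class ::
  "(real^'n) set set \<Rightarrow> (real^'n \<Rightarrow> int) set \<Rightarrow> 'n::finite section_Y \<Rightarrow> bool" where
  "growth_class \<Sigma> A L \<longleftrightarrow> (\<exists>y. is_lift y L \<and> (\<exists>a\<in>A. growth \<Sigma> a y))"

definition LYW :: "(real^'n) set set \<Rightarrow> 'n section_Y set" where
  "LYW \<Sigma> = {L. lagrangian_section L \<and> (\<exists>A\<in>AW \<Sigma>. growth_class \<Sigma> A L)}"


section \<open>The SYZ mirror transformation\<close>

definition metric_potential ::
  "(real^'n) set set \<Rightarrow> ('n lvect \<Rightarrow> 'n lvect \<Rightarrow> complex) \<Rightarrow> ('n toric_pt \<Rightarrow> 'n lvect) \<Rightarrow>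
     real^'n \<Rightarrow> real" where
  "metric_potential \<Sigma> h s \<xi> =
     (let x = orbit_pt \<Sigma> (\<chi> j. of_real (exp (\<xi> $ j))) in - (1/2) * ln (Re (h (s x) (s x))))"

definition section_of_potential :: "(real^'n \<Rightarrow> real) \<Rightarrow> 'n section_Y" where
  "section_of_potential g = (\<lambda>\<xi>. (\<xi>, mcoset (grad g \<xi>)))"

definition syz_mirror ::
  "(real^'n) set set \<Rightarrow> (real^'n \<Rightarrow> int) \<Rightarrow> ('n lvect \<Rightarrow> 'n lvect \<Rightarrow> complex) \<Rightarrow> 'n section_Y" where
  "syz_mirror \<Sigma> a h =
     section_of_potential (metric_potential \<Sigma> h (SOME s. equivariant_section \<Sigma> a s))"

definition syz_image :: "(real^'n) set set \<Rightarrow> 'n section_Y set" where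
  "syz_image \<Sigma> = {syz_mirror \<Sigma> a h | a h. a \<in> Zd \<Sigma> \<and> h \<in> metrics \<Sigma> a}"

end

theory Submission
  imports Defs
begin

text \<open>Over the \<open>n\<close>-dimensional cone with generators \<open>b\<close>, an invariant metric is a function of
  \<open>\<bar>z\<^sub>j\<bar> = exp t\<^sub>j\<close>, where \<open>\<xi> = \<Sum>\<^sub>j t\<^sub>j b\<^sub>j\<close>, and its potential satisfies \<open>g(\<xi>(t)) + \<Sum>\<^sub>j a\<^sub>j t\<^sub>j = \<phi>(e\<^sup>t)\<close> with \<open>\<phi>\<close> of
  class \<open>C\<^sup>2\<close> on \<open>\<complex>\<^sup>n\<close>. Since \<open>\<phi>\<close> is even in each real coordinate, its odd partial derivatives vanish on the
  coordinate hyperplanes, which yields \<open>(\<ast>\<^sub>a)\<close>. Conversely, \<open>(\<ast>\<^sub>a)\<close> makes \<open>e\<^bsup>-2t\<^sub>j\<^esup>\<partial>\<^sub>jG\<close> and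
  \<open>e\<^bsup>-t\<^sub>j-t\<^sub>k\<^esup>(\<partial>\<^sub>j\<partial>\<^sub>kG - 2\<delta>\<^sub>j\<^sub>k\<partial>\<^sub>jG)\<close>, for \<open>G(t) = g(\<xi>(t)) + \<Sum>\<^sub>j a\<^sub>j t\<^sub>j\<close>, uniformly Cauchy in every variable
  as \<open>t\<^sub>l \<rightarrow> -\<infinity>\<close>; hence the derivatives of \<open>z \<mapsto> G(ln \<bar>z\<bar>)\<close> of order at most two extend continuously to
  \<open>\<complex>\<^sup>n\<close>. The choice of the equivariant section is immaterial, because on the open orbit it is a multiple of
  a character and so changes \<open>dg\<close> by an element of \<open>M\<close>.\<close>

section \<open>Functions of class C1 and C2\<close>

text \<open>The real gradient of G(ln |z|) in z_j is e^(-2 t_j) (d_j G) z_j. Differentiating the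
  exponential factor produces the correction 2 d_j G on the diagonal, and the second derivatives
  consist of the gradient coefficients and of weighted coefficients multiplied by the signs of z_j
  and z_k. Signs have no limit on the coordinate hyperplanes, so the weighted coefficients have to
  vanish there: on the diagonal this is the equality of the two limits in (1), off the diagonal it
  is (3). The obstacle is the order of limits. In a third variable t_l only the unweighted condition
  (2) is given, while the weight is unbounded as t_j or t_k goes to minus infinity. It is overcome
  by raising t_j and t_k to a fixed level at a uniformly small cost and using (2) there. The
  resulting metric must live on a quotient of points over cones of all dimensions. Invariance lets
  it depend on moduli of characters only, so its value at a point can be defined as one limit along
  sequences in N_R; compatibility of frames is then uniqueness of limits.\<close>

lemma C1_fun_iff:
  fixes f :: "'a::euclidean_space \<Rightarrow> 'b::real_normed_vector"
  shows "C1_fun f \<longleftrightarrow>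
    (\<exists>f'. (\<forall>x. (f has_derivative f' x) (at x)) \<and> (\<forall>v. continuous_on UNIV (\<lambda>x. f' x v)))"
proof
  assume "C1_fun f"
  then obtain f' :: "'a \<Rightarrow> 'a \<Rightarrow>\<^sub>L 'b"
    where "\<forall>x. (f has_derivative blinfun_apply (f' x)) (at x)" "continuous_on UNIV f'"
    unfolding C1_fun_def by blast
  moreover from this(2) have "continuous_on UNIV (\<lambda>x. blinfun_apply (f' x) v)" for v
    by (intro continuous_intros)
  ultimately show "\<exists>f'. (\<forall>x. (f has_derivative f' x) (at x)) \<and> (\<forall>v. continuous_on UNIV (\<lambda>x. f' x v))"
    by (intro exI[of _ "\<lambda>x. blinfun_apply (f' x)"]) auto
next
  assume "\<exists>f'. (\<forall>x. (f has_derivative f' x) (at x)) \<and> (\<forall>v. continuous_on UNIV (\<lambda>x. f' x v))"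
  then obtain f' where d: "\<And>x. (f has_derivative f' x) (at x)"
    and c: "\<And>v. continuous_on UNIV (\<lambda>x. f' x v)" by blast
  have ap: "blinfun_apply (Blinfun (f' x)) = f' x" for x
    using d[of x] by (intro bounded_linear_Blinfun_apply has_derivative_bounded_linear)
  \<comment> \<open>The domain is finite-dimensional, so continuity of the values on basis vectors
    gives continuity in operator norm. Regularity can thus mostly be checked in one fixed direction
    \<open>v\<close> at a time.\<close>
  have "continuous_on UNIV (\<lambda>x. Blinfun (f' x))"
    by (rule continuous_on_blinfun_componentwise) (simp add: ap c)
  with d show "C1_fun f" unfolding C1_fun_def
    by (intro exI[of _ "\<lambda>x. Blinfun (f' x)"]) (auto simp: ap)
qed

lemma C1_fun_continuous: "C1_fun f \<Longrightarrow> continuous_on UNIV f"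
  unfolding C1_fun_def by (meson continuous_at_imp_continuous_on has_derivative_continuous)

lemma C1_fun_bounded_linear:
  fixes f :: "'a::euclidean_space \<Rightarrow> 'b::real_normed_vector"
  assumes "C1_fun f" "bounded_linear L"
  shows "C1_fun (\<lambda>x. L (f x))"
proof -
  obtain f' where d: "\<And>x. (f has_derivative f' x) (at x)"
    and c: "\<And>v. continuous_on UNIV (\<lambda>x. f' x v)" using assms(1) unfolding C1_fun_iff by blast
  show ?thesis unfolding C1_fun_iff
    using bounded_linear.has_derivative[OF assms(2) d] bounded_linear.continuous_on[OF assms(2) c]
    by (intro exI[of _ "\<lambda>x v. L (f' x v)"]) auto
qed

lemma C1_fun_const: "C1_fun (\<lambda>x::'a::euclidean_space. c)"
  unfolding C1_fun_iff by (intro exI[of _ "\<lambda>x v. 0"]) auto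

lemma C1_fun_add:
  fixes f :: "'a::euclidean_space \<Rightarrow> 'b::real_normed_vector"
  assumes "C1_fun f" "C1_fun g"
  shows "C1_fun (\<lambda>x. f x + g x)"
proof -
  obtain f' where d: "\<And>x. (f has_derivative f' x) (at x)"
    and c: "\<And>v. continuous_on UNIV (\<lambda>x. f' x v)" using assms(1) unfolding C1_fun_iff by blast
  obtain g' where e: "\<And>x. (g has_derivative g' x) (at x)"
    and k: "\<And>v. continuous_on UNIV (\<lambda>x. g' x v)" using assms(2) unfolding C1_fun_iff by blast
  show ?thesis unfolding C1_fun_iff
    using has_derivative_add[OF d e] continuous_on_add[OF c k]
    by (intro exI[of _ "\<lambda>x v. f' x v + g' x v"]) auto
qed

lemma C1_fun_sum:
  fixes f :: "'i \<Rightarrow> 'a::euclidean_space \<Rightarrow> 'b::real_normed_vector"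
  assumes "\<And>i. i \<in> I \<Longrightarrow> C1_fun (f i)"
  shows "C1_fun (\<lambda>x. \<Sum>i\<in>I. f i x)"
  using assms by (induction I rule: infinite_finite_induct) (auto intro: C1_fun_const C1_fun_add)

lemma C1_fun_scaleR:
  fixes f :: "'a::euclidean_space \<Rightarrow> 'b::real_normed_vector"
  assumes "C1_fun r" "C1_fun f"
  shows "C1_fun (\<lambda>x. r x *\<^sub>R f x)"
proof -
  obtain f' where d: "\<And>x. (f has_derivative f' x) (at x)"
    and c: "\<And>v. continuous_on UNIV (\<lambda>x. f' x v)" using assms(2) unfolding C1_fun_iff by blast
  obtain r' where e: "\<And>x. (r has_derivative r' x) (at x)"
    and k: "\<And>v. continuous_on UNIV (\<lambda>x. r' x v)" using assms(1) unfolding C1_fun_iff by blast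
  note cf = C1_fun_continuous[OF assms(1)] C1_fun_continuous[OF assms(2)]
  show ?thesis unfolding C1_fun_iff
    using has_derivative_scaleR[OF e d]
    by (intro exI[of _ "\<lambda>x v. r x *\<^sub>R f' x v + r' x v *\<^sub>R f x"])
       (auto intro!: continuous_intros c k cf)
qed

lemma C1_fun_compose:
  fixes f :: "'a::euclidean_space \<Rightarrow> 'b::euclidean_space" and g :: "'b \<Rightarrow> 'c::real_normed_vector"
  assumes "C1_fun g" "C1_fun f"
  shows "C1_fun (\<lambda>x. g (f x))"
proof -
  obtain f' where d: "\<And>x. (f has_derivative f' x) (at x)"
    and c: "\<And>v. continuous_on UNIV (\<lambda>x. f' x v)" using assms(2) unfolding C1_fun_iff by blast
  \<comment> \<open>The outer derivative is kept operator-valued: it is applied to the vector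
    \<open>f' x v\<close>, which moves with \<open>x\<close>.\<close>
  obtain g' :: "'b \<Rightarrow> 'b \<Rightarrow>\<^sub>L 'c"
    where e: "\<And>x. (g has_derivative blinfun_apply (g' x)) (at x)" and k: "continuous_on UNIV g'"
    using assms(1) unfolding C1_fun_def by blast
  have "continuous_on UNIV (\<lambda>x. g' (f x))"
    using continuous_on_compose2[OF k C1_fun_continuous[OF assms(2)]] by simp
  then show ?thesis unfolding C1_fun_iff
    using has_derivative_compose[OF d e]
    by (intro exI[of _ "\<lambda>x v. blinfun_apply (g' (f x)) (f' x v)"]) (auto intro!: continuous_intros c)
qed

lemma C1_fun_inverse:
  fixes f :: "'a::euclidean_space \<Rightarrow> real"
  assumes "C1_fun f" "\<And>x. f x \<noteq> 0"
  shows "C1_fun (\<lambda>x. inverse (f x))"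
proof -
  obtain f' where d: "\<And>x. (f has_derivative f' x) (at x)"
    and c: "\<And>v. continuous_on UNIV (\<lambda>x. f' x v)" using assms(1) unfolding C1_fun_iff by blast
  note cf = C1_fun_continuous[OF assms(1)]
  have "((\<lambda>x. inverse (f x)) has_derivative (\<lambda>v. - (inverse (f x) * f' x v * inverse (f x)))) (at x)" for x
    using Deriv.has_derivative_inverse[OF assms(2) d] .
  then show ?thesis unfolding C1_fun_iff
    by (intro exI[of _ "\<lambda>x v. - (inverse (f x) * f' x v * inverse (f x))"])
       (auto intro!: continuous_intros c cf simp: assms(2))
qed

lemma C2_fun_iff:
  fixes f :: "'a::euclidean_space \<Rightarrow> 'b::real_normed_vector"
  shows "C2_fun f \<longleftrightarrow>
    (\<exists>f'. (\<forall>x. (f has_derivative f' x) (at x)) \<and> (\<forall>v. C1_fun (\<lambda>x. f' x v)))"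
proof
  assume "C2_fun f"
  then obtain f' :: "'a \<Rightarrow> 'a \<Rightarrow>\<^sub>L 'b"
    where "\<forall>x. (f has_derivative blinfun_apply (f' x)) (at x)" "C1_fun f'"
    unfolding C2_fun_def by blast
  moreover from this(2) have "C1_fun (\<lambda>x. blinfun_apply (f' x) v)" for v
    by (rule C1_fun_bounded_linear) (rule blinfun.bounded_linear_left)
  ultimately show "\<exists>f'. (\<forall>x. (f has_derivative f' x) (at x)) \<and> (\<forall>v. C1_fun (\<lambda>x. f' x v))"
    by (intro exI[of _ "\<lambda>x. blinfun_apply (f' x)"]) auto
next
  assume "\<exists>f'. (\<forall>x. (f has_derivative f' x) (at x)) \<and> (\<forall>v. C1_fun (\<lambda>x. f' x v))"
  then obtain f' where d: "\<And>x. (f has_derivative f' x) (at x)"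
    and c: "\<And>v. C1_fun (\<lambda>x. f' x v)" by blast
  define F where "F x = (\<Sum>i\<in>Basis. blinfun_scaleR_left (f' x i) o\<^sub>L blinfun_inner_left i)" for x
  have "bounded_linear (\<lambda>y::'b. blinfun_scaleR_left y o\<^sub>L (blinfun_inner_left i :: 'a \<Rightarrow>\<^sub>L real))" for i
    by (intro bounded_linear_intros)
  then have C: "C1_fun F"
    unfolding F_def by (intro C1_fun_sum C1_fun_bounded_linear[OF c])
  have "blinfun_apply (F x) v = f' x v" for x v
  proof -
    interpret bounded_linear "f' x" using d[of x] by (rule has_derivative_bounded_linear)
    show ?thesis
      by (subst (2) euclidean_representation[of v, symmetric])
         (simp add: F_def blinfun.sum_left sum scaleR)
  qed
  then have "blinfun_apply (F x) = f' x" for x by blast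
  with C d show "C2_fun f" unfolding C2_fun_def by (intro exI[of _ F]) auto
qed

lemma C2_fun_imp_C1:
  fixes f :: "'a::euclidean_space \<Rightarrow> 'b::real_normed_vector"
  shows "C2_fun f \<Longrightarrow> C1_fun f"
  unfolding C2_fun_iff C1_fun_iff[of f] using C1_fun_continuous by fast

lemma C2_fun_linear: "bounded_linear L \<Longrightarrow> C2_fun (L :: 'a::euclidean_space \<Rightarrow> _)"
  unfolding C2_fun_iff
  by (intro exI[of _ "\<lambda>x v. L v"]) (auto intro: bounded_linear_imp_has_derivative C1_fun_const)

lemma C2_fun_const: "C2_fun (\<lambda>x::'a::euclidean_space. c)"
  unfolding C2_fun_iff by (intro exI[of _ "\<lambda>x v. 0"]) (auto intro: C1_fun_const)

lemma C2_fun_add: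
  fixes f :: "'a::euclidean_space \<Rightarrow> 'b::real_normed_vector"
  assumes "C2_fun f" "C2_fun g"
  shows "C2_fun (\<lambda>x. f x + g x)"
proof -
  obtain f' where d: "\<And>x. (f has_derivative f' x) (at x)"
    and c: "\<And>v. C1_fun (\<lambda>x. f' x v)" using assms(1) unfolding C2_fun_iff by blast
  obtain g' where e: "\<And>x. (g has_derivative g' x) (at x)"
    and k: "\<And>v. C1_fun (\<lambda>x. g' x v)" using assms(2) unfolding C2_fun_iff by blast
  show ?thesis unfolding C2_fun_iff
    using has_derivative_add[OF d e] C1_fun_add[OF c k]
    by (intro exI[of _ "\<lambda>x v. f' x v + g' x v"]) auto
qed

lemma C2_fun_compose:
  fixes f :: "'a::euclidean_space \<Rightarrow> 'b::euclidean_space" and g :: "'b \<Rightarrow> 'c::real_normed_vector"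
  assumes "C2_fun g" "C2_fun f"
  shows "C2_fun (\<lambda>x. g (f x))"
proof -
  obtain f' where d: "\<And>x. (f has_derivative f' x) (at x)"
    and c: "\<And>v. C1_fun (\<lambda>x. f' x v)" using assms(2) unfolding C2_fun_iff by blast
  obtain g' where e: "\<And>x. (g has_derivative g' x) (at x)"
    and k: "\<And>v. C1_fun (\<lambda>x. g' x v)" using assms(1) unfolding C2_fun_iff by blast
  \<comment> \<open>Expansion in the basis separates the two dependences on \<open>x\<close> in
    \<open>g' (f x) (f' x v)\<close> into products of a C1 scalar and a C1 map.\<close>
  have eq: "g' y v = (\<Sum>i\<in>Basis. (v \<bullet> i) *\<^sub>R g' y i)" for y v
  proof -
    interpret bounded_linear "g' y" using e[of y] by (rule has_derivative_bounded_linear)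
    show ?thesis
      by (subst euclidean_representation[of v, symmetric]) (simp add: sum scaleR)
  qed
  have "C1_fun (\<lambda>x. g' (f x) (f' x v))" for v
    by (subst eq) (intro C1_fun_sum C1_fun_scaleR C1_fun_compose[OF k C2_fun_imp_C1[OF assms(2)]]
       C1_fun_bounded_linear[OF c] bounded_linear_inner_left)
  then show ?thesis unfolding C2_fun_iff using has_derivative_compose[OF d e]
    by (intro exI[of _ "\<lambda>x v. g' (f x) (f' x v)"]) auto
qed

lemma C2_fun_bounded_linear:
  fixes f :: "'a::euclidean_space \<Rightarrow> 'b::euclidean_space"
  assumes "bounded_linear L" "C2_fun f"
  shows "C2_fun (\<lambda>x. L (f x))"
  using C2_fun_compose[OF C2_fun_linear[OF assms(1)] assms(2)] .

lemma C2_fun_sum: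
  fixes f :: "'i \<Rightarrow> 'a::euclidean_space \<Rightarrow> 'b::real_normed_vector"
  assumes "\<And>i. i \<in> I \<Longrightarrow> C2_fun (f i)"
  shows "C2_fun (\<lambda>x. \<Sum>i\<in>I. f i x)"
  using assms by (induction I rule: infinite_finite_induct) (auto intro: C2_fun_const C2_fun_add)

lemma C2_fun_exp: "C2_fun (exp :: real \<Rightarrow> real)"
proof -
  have 1: "(exp has_derivative (\<lambda>v. exp x * v)) (at x)" for x :: real
    by (auto intro!: derivative_eq_intros)
  then have "C1_fun (exp :: real \<Rightarrow> real)" unfolding C1_fun_iff
    by (intro exI[of _ "\<lambda>x v. exp x * v"]) (auto intro!: continuous_intros)
  then have "C1_fun (\<lambda>x::real. exp x * v)" for v
    using C1_fun_bounded_linear bounded_linear_mult_left by blast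
  with 1 show ?thesis unfolding C2_fun_iff by (intro exI[of _ "\<lambda>x v. exp x * v"]) auto
qed

lemma C2_fun_ln:
  fixes f :: "'a::euclidean_space \<Rightarrow> real"
  assumes "C2_fun f" "\<And>x. f x > 0"
  shows "C2_fun (\<lambda>x. ln (f x))"
proof -
  obtain f' where d: "\<And>x. (f has_derivative f' x) (at x)"
    and c: "\<And>v. C1_fun (\<lambda>x. f' x v)" using assms(1) unfolding C2_fun_iff by blast
  have "((\<lambda>x. ln (f x)) has_derivative (\<lambda>v. inverse (f x) *\<^sub>R f' x v)) (at x)" for x
    using assms(2)[of x] d[of x] by (auto intro!: derivative_eq_intros simp: field_simps)
  moreover have "C1_fun (\<lambda>x. inverse (f x) *\<^sub>R f' x v)" for v
    by (intro C1_fun_scaleR C1_fun_inverse[OF C2_fun_imp_C1[OF assms(1)]] c) (metis assms(2) less_irrefl)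
  ultimately show ?thesis unfolding C2_fun_iff
    by (intro exI[of _ "\<lambda>x v. inverse (f x) *\<^sub>R f' x v"]) auto
qed

lemma bounded_linear_axis: "bounded_linear (axis j :: 'b::euclidean_space \<Rightarrow> 'b^'n)"
  by (simp add: linear_conv_bounded_linear[symmetric]) (auto intro!: linearI simp: axis_def vec_eq_iff)

lemma vec_lambda_eq_sum_axis: "(\<chi> j. h j) = (\<Sum>j\<in>UNIV. axis j (h j :: 'b::comm_monoid_add))"
  by (simp add: vec_eq_iff axis_def if_distrib[of "\<lambda>f. f _"] cong: if_cong)

lemma C2_fun_componentwise:
  fixes f :: "'n::finite \<Rightarrow> 'a::euclidean_space \<Rightarrow> 'b::euclidean_space"
  assumes "\<And>i. C2_fun (f i)"
  shows "C2_fun (\<lambda>x. \<chi> i. f i x)"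
  unfolding vec_lambda_eq_sum_axis
  by (intro C2_fun_sum C2_fun_bounded_linear[of "axis _"] bounded_linear_axis assms)

section \<open>Directional derivatives, gradients and the symmetry of the Hessian\<close>

lemma C2_fun_dir_deriv:
  assumes "C2_fun g"
  shows "(g has_derivative dir_deriv g x) (at x)"
    and "C1_fun (\<lambda>x. dir_deriv g x v)"
    and "((\<lambda>x. dir_deriv g x v) has_derivative (\<lambda>w. hess g x w v)) (at x)"
    and "continuous_on UNIV (\<lambda>x. hess g x w v)"
proof -
  obtain f' where d: "\<And>x. (g has_derivative f' x) (at x)"
    and c: "\<And>v. C1_fun (\<lambda>x. f' x v)" using assms(1) unfolding C2_fun_iff by blast
  \<comment> \<open>\<open>dir_deriv\<close> and \<open>hess\<close> rest on the choice operator
    inside \<open>frechet_derivative\<close>; C2 regularity identifies them with genuine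
    derivatives.\<close>
  have e: "dir_deriv g x v = f' x v" for x v
    unfolding dir_deriv_def using frechet_derivative_at[OF d[of x]] by simp
  then show "(g has_derivative dir_deriv g x) (at x)" using d[of x] by presburger
  show k: "C1_fun (\<lambda>x. dir_deriv g x v)" for v using c by (simp add: e)
  then obtain f'' where d2: "\<And>x. ((\<lambda>x. dir_deriv g x v) has_derivative f'' x) (at x)"
    and c2: "\<And>v. continuous_on UNIV (\<lambda>x. f'' x v)" unfolding C1_fun_iff by blast
  have e2: "hess g x w v = f'' x w" for x w
    unfolding hess_def dir_deriv_def[of _ x w] using frechet_derivative_at[OF d2[of x]] by simp
  show "((\<lambda>x. dir_deriv g x v) has_derivative (\<lambda>w. hess g x w v)) (at x)"
    using d2[of x] by (simp add: e2)
  show "continuous_on UNIV (\<lambda>x. hess g x w v)" using c2 by (simp add: e2)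
qed

lemma dir_derivI: "(g has_derivative g') (at x) \<Longrightarrow> dir_deriv g x v = g' v"
  unfolding dir_deriv_def using frechet_derivative_at[of g g' x] by simp

lemma C1_fun_grad: 
  assumes "C2_fun g"
  shows "C1_fun (grad g)"
proof -
  have "grad g = (\<lambda>x. \<Sum>i\<in>UNIV. dir_deriv g x (axis i 1) *\<^sub>R axis i 1)"
    by (rule ext, simp add: vec_eq_iff grad_def axis_def if_distrib[of "\<lambda>g. g _"] if_distrib cong: if_cong)
  then show ?thesis using C2_fun_dir_deriv(2)[OF assms]
    by (auto intro!: C1_fun_sum C1_fun_scaleR C1_fun_const)
qed

lemma grad_inner: 
  assumes "C2_fun g"
  shows "grad g x \<bullet> v = dir_deriv g x v"
proof -
  interpret bounded_linear "dir_deriv g x"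
    using C2_fun_dir_deriv(1)[OF assms] by (rule has_derivative_bounded_linear)
  have v: "v = (\<Sum>i\<in>UNIV. (v $ i) *\<^sub>R axis i 1)"
    by (simp add: vec_eq_iff axis_def if_distrib cong: if_cong)
  have "dir_deriv g x v = (\<Sum>i\<in>UNIV. (v $ i) * dir_deriv g x (axis i 1))"
    by (subst v) (simp add: sum scaleR)
  then show ?thesis by (simp add: inner_vec_def grad_def mult.commute)
qed

text \<open>The mean value theorem is applied along \<open>v\<close> to the increment in direction
  \<open>w\<close>, and then along \<open>w\<close>. The left side is symmetric in \<open>v\<close>
  and \<open>w\<close>, which \<open>hess_commute\<close> exploits.\<close>

lemma second_difference:
  assumes "C2_fun g" "h > (0::real)"
  shows "\<exists>s\<in>{0<..<h}. \<exists>r\<in>{0<..<h}.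
    g (x + h *\<^sub>R v + h *\<^sub>R w) - g (x + h *\<^sub>R v) - g (x + h *\<^sub>R w) + g x
      = h * h * hess g (x + s *\<^sub>R v + r *\<^sub>R w) w v"
proof -
  note D = C2_fun_dir_deriv[OF assms(1)]
  have d1: "((\<lambda>s. g (x + s *\<^sub>R v + h *\<^sub>R w) - g (x + s *\<^sub>R v)) has_real_derivative
      dir_deriv g (x + s *\<^sub>R v + h *\<^sub>R w) v - dir_deriv g (x + s *\<^sub>R v) v) (at s)" for s
  proof -
    have "((\<lambda>s. g (x + s *\<^sub>R v + y)) has_derivative (\<lambda>k. dir_deriv g (x + s *\<^sub>R v + y) (k *\<^sub>R v))) (at s)" for y
      by (rule has_derivative_compose[OF _ D(1)]) (auto intro!: derivative_eq_intros)
    moreover have "dir_deriv g z (k *\<^sub>R v) = k * dir_deriv g z v" for z k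
      by (simp add: grad_inner[OF assms(1), symmetric])
    ultimately have "((\<lambda>s. g (x + s *\<^sub>R v + y)) has_real_derivative dir_deriv g (x + s *\<^sub>R v + y) v) (at s)" for y
      by (simp add: has_field_derivative_def mult.commute[of _ "dir_deriv _ _ _"])
    from this[of "h *\<^sub>R w"] this[of 0] show ?thesis by (auto intro!: derivative_eq_intros)
  qed
  obtain s where s: "s \<in> {0<..<h}" and e1:
    "(g (x + h *\<^sub>R v + h *\<^sub>R w) - g (x + h *\<^sub>R v)) - (g (x + 0 *\<^sub>R v + h *\<^sub>R w) - g (x + 0 *\<^sub>R v))
      = (h - 0) * (dir_deriv g (x + s *\<^sub>R v + h *\<^sub>R w) v - dir_deriv g (x + s *\<^sub>R v) v)"
    using MVT2[OF assms(2) d1] by auto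
  have d2: "((\<lambda>r. dir_deriv g (x + s *\<^sub>R v + r *\<^sub>R w) v) has_real_derivative
      hess g (x + s *\<^sub>R v + r *\<^sub>R w) w v) (at r)" for r
  proof -
    have "((\<lambda>r. dir_deriv g (x + s *\<^sub>R v + r *\<^sub>R w) v) has_derivative
       (\<lambda>k. hess g (x + s *\<^sub>R v + r *\<^sub>R w) (k *\<^sub>R w) v)) (at r)"
      by (rule has_derivative_compose[OF _ D(3)]) (auto intro!: derivative_eq_intros)
    moreover have "hess g z (k *\<^sub>R w) v = k * hess g z w v" for z k
      using linear_cmul[OF bounded_linear.linear[OF has_derivative_bounded_linear[OF D(3)]]] by simp
    ultimately show ?thesis by (simp add: has_field_derivative_def mult.commute[of _ "hess _ _ _ _"])
  qed
  obtain r where r: "r \<in> {0<..<h}" and e2: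
    "dir_deriv g (x + s *\<^sub>R v + h *\<^sub>R w) v - dir_deriv g (x + s *\<^sub>R v + 0 *\<^sub>R w) v
      = (h - 0) * hess g (x + s *\<^sub>R v + r *\<^sub>R w) w v"
    using MVT2[OF assms(2) d2] by auto
  show ?thesis using e1 e2 by (intro bexI[OF _ s] bexI[OF _ r]) simp
qed

text \<open>Schwarz's theorem: one second difference equals \<open>h * h\<close> times either mixed
  derivative at nearby points, and by continuity each is closer to its value at \<open>x\<close>
  than half of the assumed gap.\<close>

lemma hess_commute:
  assumes "C2_fun g"
  shows "hess g x v w = hess g x w v"
proof (rule ccontr)
  assume ne: "hess g x v w \<noteq> hess g x w v"
  define e where "e = \<bar>hess g x v w - hess g x w v\<bar> / 2"
  have e: "e > 0" using ne by (simp add: e_def)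
  have cont: "\<exists>d>0. \<forall>y. dist y x < d \<longrightarrow> \<bar>hess g y a b - hess g x a b\<bar> < e" for a b
    using C2_fun_dir_deriv(4)[OF assms, of a b] e
    unfolding continuous_on_iff by (auto simp: dist_real_def)
  obtain d1 d2 where d: "d1 > 0" "d2 > 0"
    "\<And>y. dist y x < d1 \<Longrightarrow> \<bar>hess g y v w - hess g x v w\<bar> < e"
    "\<And>y. dist y x < d2 \<Longrightarrow> \<bar>hess g y w v - hess g x w v\<bar> < e"
    using cont[of v w] cont[of w v] by blast
  \<comment> \<open>The \<open>+ 1\<close> keeps the denominator positive when both vectors vanish
    and makes the distance estimate strict.\<close>
  define h where "h = min d1 d2 / (norm v + norm w + 1)"
  have h: "h > 0" using d unfolding h_def by (intro divide_pos_pos) (auto intro: add_nonneg_pos)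
  have small: "dist (x + s *\<^sub>R a + r *\<^sub>R b) x < min d1 d2"
    if "s \<in> {0<..<h}" "r \<in> {0<..<h}" "{a, b} = {v, w}" for s r a b
  proof -
    have "dist (x + s *\<^sub>R a + r *\<^sub>R b) x \<le> norm (s *\<^sub>R a) + norm (r *\<^sub>R b)"
      using norm_triangle_ineq[of "s *\<^sub>R a" "r *\<^sub>R b"] by (simp add: dist_norm add.assoc)
    also have "\<dots> \<le> h * norm a + h * norm b"
      using that by (auto intro!: add_mono mult_right_mono)
    also have "\<dots> = h * (norm v + norm w)"
      using that(3) by (auto simp: doubleton_eq_iff algebra_simps)
    also have "\<dots> < h * (norm v + norm w + 1)" using h by simp
    also have "\<dots> = min d1 d2"
      unfolding h_def by (simp add: add_nonneg_pos[THEN less_imp_neq, THEN not_sym])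
    finally show ?thesis .
  qed
  obtain s r where 1: "s \<in> {0<..<h}" "r \<in> {0<..<h}"
    "g (x + h *\<^sub>R v + h *\<^sub>R w) - g (x + h *\<^sub>R v) - g (x + h *\<^sub>R w) + g x
      = h * h * hess g (x + s *\<^sub>R v + r *\<^sub>R w) w v"
    using second_difference[OF assms h, of x v w] by blast
  obtain s' r' where 2: "s' \<in> {0<..<h}" "r' \<in> {0<..<h}"
    "g (x + h *\<^sub>R w + h *\<^sub>R v) - g (x + h *\<^sub>R w) - g (x + h *\<^sub>R v) + g x
      = h * h * hess g (x + s' *\<^sub>R w + r' *\<^sub>R v) v w"
    using second_difference[OF assms h, of x w v] by blast
  have "h * h * hess g (x + s *\<^sub>R v + r *\<^sub>R w) w v = h * h * hess g (x + s' *\<^sub>R w + r' *\<^sub>R v) v w"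
    using 1(3) 2(3) by (simp add: algebra_simps)
  then have "hess g (x + s *\<^sub>R v + r *\<^sub>R w) w v = hess g (x + s' *\<^sub>R w + r' *\<^sub>R v) v w"
    using h by simp
  moreover have "\<bar>hess g (x + s *\<^sub>R v + r *\<^sub>R w) w v - hess g x w v\<bar> < e"
    using small[OF 1(1,2)] by (intro d(4)) auto
  moreover have "\<bar>hess g (x + s' *\<^sub>R w + r' *\<^sub>R v) v w - hess g x v w\<bar> < e"
    using small[OF 2(1,2)] by (intro d(3)) auto
  ultimately show False unfolding e_def by (smt (verit) field_sum_of_halves)
qed

section \<open>Continuous extension from the torus\<close>

definition upd :: "real^'n \<Rightarrow> 'n \<Rightarrow> real \<Rightarrow> real^'n" where
  "upd t l r = (\<chi> k. if k = l then r else t $ k)"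

lemma upd_nth [simp]: "upd t l r $ k = (if k = l then r else t $ k)"
  by (simp add: upd_def)

text \<open>The other coordinates are bounded above only, so the estimate is uniform up to the
  strata where several \<open>z $ k\<close> vanish.\<close>

abbreviation osc_less :: "'n::finite \<Rightarrow> (real^'n \<Rightarrow> real) \<Rightarrow> real \<Rightarrow> real \<Rightarrow> real \<Rightarrow> bool" where
  "osc_less l f c e T \<equiv> \<forall>t t'. (\<forall>k. k \<noteq> l \<longrightarrow> t $ k = t' $ k \<and> t $ k \<le> c) \<longrightarrow>
     t $ l \<le> T \<longrightarrow> t' $ l \<le> T \<longrightarrow> \<bar>f t - f t'\<bar> < e"

text \<open>A Cauchy form of \<open>lim_minf\<close> without a limit function: estimates in several
  variables can be combined before any limit at a deeper stratum is known.\<close>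

definition ucauchy :: "'n::finite \<Rightarrow> (real^'n \<Rightarrow> real) \<Rightarrow> bool" where
  "ucauchy l f \<longleftrightarrow> (\<forall>c. \<forall>e>0. \<exists>T. osc_less l f c e T)"

lemma lim_minf_near:
  assumes "lim_minf l f \<Lambda>" "e > 0"
  obtains T where "\<And>t r. (\<And>k. k \<noteq> l \<Longrightarrow> t $ k \<le> c) \<Longrightarrow> r \<le> T \<Longrightarrow> \<bar>f (upd t l r) - \<Lambda> t\<bar> < e"
proof -
  have "\<forall>\<^sub>F r in at_bot. \<forall>t\<in>{t. \<forall>k. k \<noteq> l \<longrightarrow> t $ k \<le> c}. dist (f (upd t l r)) (\<Lambda> t) < e"
    using assms unfolding lim_minf_def uniform_limit_iff upd_def by blast
  then show ?thesis
    using that unfolding eventually_at_bot_linorder dist_real_def by blast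
qed

lemma lim_minf_ucauchy:
  assumes "lim_minf l f \<Lambda>"
  shows "ucauchy l f"
  unfolding ucauchy_def
proof (intro allI impI)
  fix c and e :: real assume "e > 0"
  then obtain T where T: "\<And>t r. (\<And>k. k \<noteq> l \<Longrightarrow> t $ k \<le> c) \<Longrightarrow> r \<le> T \<Longrightarrow> \<bar>f (upd t l r) - \<Lambda> t\<bar> < e/2"
    using lim_minf_near[OF assms, of "e/2" c] by (metis half_gt_zero)
  have "\<bar>f t - f t'\<bar> < e" if "\<forall>k. k \<noteq> l \<longrightarrow> t $ k = t' $ k \<and> t $ k \<le> c" "t $ l \<le> T" "t' $ l \<le> T" for t t'
  proof -
    have "upd t l (t $ l) = t" "upd t l (t' $ l) = t'" using that by (auto simp: vec_eq_iff)
    with T[of t "t $ l"] T[of t "t' $ l"] that show ?thesis by (smt (verit) field_sum_of_halves)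
  qed
  then show "\<exists>T. osc_less l f c e T" by blast
qed

lemma lim_minf_zero:
  assumes "lim_minf l f (\<lambda>_. 0)" "e > 0"
  obtains T where "\<And>t. (\<And>k. k \<noteq> l \<Longrightarrow> t $ k \<le> c) \<Longrightarrow> t $ l \<le> T \<Longrightarrow> \<bar>f t\<bar> < e"
proof (rule lim_minf_near[OF assms, of c], rule that)
  fix T t assume "\<And>t r. (\<And>k. k \<noteq> l \<Longrightarrow> t $ k \<le> c) \<Longrightarrow> r \<le> T \<Longrightarrow> \<bar>f (upd t l r) - 0\<bar> < e"
    "\<And>k. k \<noteq> l \<Longrightarrow> t $ k \<le> c" "t $ l \<le> T"
  then have "\<bar>f (upd t l (t $ l)) - 0\<bar> < e" by blast
  moreover have "upd t l (t $ l) = t" by (simp add: vec_eq_iff)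
  ultimately show "\<bar>f t\<bar> < e" by simp
qed

lemma lim_minf_diff:
  assumes "lim_minf l f \<Lambda>" "lim_minf l g \<Lambda>'"
  shows "lim_minf l (\<lambda>t. f t - g t) (\<lambda>t. \<Lambda> t - \<Lambda>' t)"
  using assms unfolding lim_minf_def by (auto intro!: uniform_limit_intros)

lemma ucauchy_cmult:
  assumes "ucauchy l (\<lambda>t. a * f t)" "a \<noteq> (0::real)"
  shows "ucauchy l f"
  unfolding ucauchy_def
proof (intro allI impI)
  fix c and e :: real assume "e > 0"
  then have "\<bar>a\<bar> * e > 0" using assms by simp
  then obtain T where T: "osc_less l (\<lambda>t. a * f t) c (\<bar>a\<bar> * e) T"
    using assms(1) unfolding ucauchy_def by blast
  have "\<bar>a * x - a * y\<bar> < \<bar>a\<bar> * e \<longleftrightarrow> \<bar>x - y\<bar> < e" for x y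
    using assms(2) by (simp add: right_diff_distrib[symmetric] abs_mult)
  with T show "\<exists>T. osc_less l f c e T" by auto
qed

text \<open>The alternative "equal or both below \<open>T\<close>" is what two truncations of one
  point at different depths satisfy, see \<open>lnabs_cases\<close>.\<close>

abbreviation osc_less_on :: "'n::finite set \<Rightarrow> (real^'n \<Rightarrow> real) \<Rightarrow> real \<Rightarrow> real \<Rightarrow> real \<Rightarrow> bool" where
  "osc_less_on K f c e T \<equiv> \<forall>t t'. (\<forall>k. t $ k \<le> c \<and> t' $ k \<le> c) \<longrightarrow> (\<forall>k. k \<notin> K \<longrightarrow> t $ k = t' $ k) \<longrightarrow>
     (\<forall>k\<in>K. t $ k = t' $ k \<or> (t $ k \<le> T \<and> t' $ k \<le> T)) \<longrightarrow> \<bar>f t - f t'\<bar> < e"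

text \<open>The coordinates in \<open>K\<close> are changed one at a time, each at the cost of half
  of the remaining error.\<close>

lemma ucauchy_set:
  assumes "finite K" "\<And>l. l \<in> K \<Longrightarrow> ucauchy l f" "e > 0"
  shows "\<exists>T. osc_less_on K f c e T"
  using assms
proof (induction K arbitrary: e)
  case empty
  show ?case
  proof (intro exI[of _ 0] allI impI)
    fix t t' :: "real^'a" assume "\<forall>k. k \<notin> {} \<longrightarrow> t $ k = t' $ k"
    then have "t = t'" by (simp add: vec_eq_iff)
    then show "\<bar>f t - f t'\<bar> < e" using empty by simp
  qed
next
  case (insert l K)
  from insert.prems have "e / 2 > 0" by simp
  from insert.IH[OF insert.prems(1)[OF insertI2] this] obtain T1 where
    T1: "osc_less_on K f c (e / 2) T1"
    by blast
  obtain T2 where T2: "osc_less l f c (e / 2) T2"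
    using insert.prems(1)[of l] \<open>e / 2 > 0\<close> unfolding ucauchy_def by blast
  show ?case
  proof (intro exI[of _ "min T1 T2"] allI impI)
    fix t t' :: "real^'a"
    assume le: "\<forall>k. t $ k \<le> c \<and> t' $ k \<le> c" and eq: "\<forall>k. k \<notin> insert l K \<longrightarrow> t $ k = t' $ k"
      and K: "\<forall>k\<in>insert l K. t $ k = t' $ k \<or> (t $ k \<le> min T1 T2 \<and> t' $ k \<le> min T1 T2)"
    define s where "s = upd t l (t' $ l)"
    have "\<bar>f t - f s\<bar> < e / 2"
    \<comment> \<open>Equal coordinates need not lie below the threshold, but then nothing is
      changed.\<close>
    proof (cases "t $ l = t' $ l")
      case True
      then have "s = t" by (simp add: s_def vec_eq_iff)
      then show ?thesis using \<open>e / 2 > 0\<close> by simp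
    next
      case False
      with K le show ?thesis by (intro T2[rule_format]) (auto simp: s_def)
    qed
    moreover have "\<bar>f s - f t'\<bar> < e / 2"
    proof (intro T1[rule_format])
      show "s $ k = t' $ k" if "k \<notin> K" for k using that eq by (auto simp: s_def)
      show "s $ k = t' $ k \<or> (s $ k \<le> T1 \<and> t' $ k \<le> T1)" if "k \<in> K" for k
        using that K by (auto simp: s_def)
    qed (use le in \<open>auto simp: s_def\<close>)
    ultimately show "\<bar>f t - f t'\<bar> < e" by (smt (verit) field_sum_of_halves)
  qed
qed

text \<open>On the region where \<open>t\<^sub>j\<close> and \<open>t\<^sub>k\<close> are bounded below the weight is harmless; the
  rest is reduced to that region by the assumed convergence in \<open>t\<^sub>j\<close> and \<open>t\<^sub>k\<close>.\<close>

lemma ucauchy_weight: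
  assumes F: "ucauchy l F" and "l \<noteq> j" "l \<noteq> k"
    and j: "ucauchy j (\<lambda>t. exp (- t $ j - t $ k) * F t)"
    and k: "ucauchy k (\<lambda>t. exp (- t $ j - t $ k) * F t)"
  shows "ucauchy l (\<lambda>t. exp (- t $ j - t $ k) * F t)" (is "ucauchy l ?f")
  unfolding ucauchy_def
proof (intro allI impI)
  fix c and e :: real assume "e > 0"
  then have "e / 3 > 0" by simp
  have "\<exists>T. osc_less_on {j, k} ?f c (e / 3) T"
    by (rule ucauchy_set) (use j k \<open>e / 3 > 0\<close> in auto)
  then obtain T0 where T0: "osc_less_on {j, k} ?f c (e / 3) T0" ..
  \<comment> \<open>Capping by \<open>c\<close> keeps the coordinates raised by \<open>cl\<close>
    inside the region \<open>\<le> c\<close> of the estimates.\<close>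
  define T1 where "T1 = min T0 c"
  \<comment> \<open>Once the \<open>j\<close>-th and \<open>k\<close>-th coordinates are at least
    \<open>T1\<close>, the weight is at most \<open>exp (- 2 * T1)\<close>; this factor compensates
    it.\<close>
  have "e / 3 * exp (2 * T1) > 0" using \<open>e > 0\<close> by simp
  then obtain T where T: "osc_less l F c (e / 3 * exp (2 * T1)) T"
    using F unfolding ucauchy_def by blast
  show "\<exists>T. osc_less l ?f c e T"
  proof (intro exI[of _ "min T c"] allI impI)
    fix t t' :: "real^'a"
    assume eq: "\<forall>k. k \<noteq> l \<longrightarrow> t $ k = t' $ k \<and> t $ k \<le> c" and le: "t $ l \<le> min T c" "t' $ l \<le> min T c"
    define cl where "cl s = (\<chi> i. if i \<in> {j,k} then max (s $ i) T1 else s $ i)" for s :: "real^'a"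
    have le': "t $ i \<le> c" "t' $ i \<le> c" for i using eq[rule_format, of i] le by (cases "i = l"; simp)+
    have clc: "cl t $ i \<le> c" "cl t' $ i \<le> c" for i using le'[of i] by (auto simp: cl_def T1_def)
    have cll: "cl s $ l = s $ l" for s using assms(2,3) by (simp add: cl_def)
    have cleq: "cl t $ i = cl t' $ i" if "i \<noteq> l" for i using that eq by (simp add: cl_def)
    have clj: "cl s $ i \<ge> T1" if "i \<in> {j,k}" for s i using that by (simp add: cl_def)
    have 1: "\<bar>?f s - ?f (cl s)\<bar> < e / 3" if "\<And>i. s $ i \<le> c \<and> cl s $ i \<le> c" for s
      by (rule T0[rule_format]) (use that in \<open>auto simp: cl_def T1_def\<close>)
    have w: "exp (- cl t' $ j - cl t' $ k) = exp (- cl t $ j - cl t $ k)"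
      using cleq[of j] cleq[of k] assms(2,3) by simp
    have "\<bar>?f (cl t) - ?f (cl t')\<bar> = exp (- cl t $ j - cl t $ k) * \<bar>F (cl t) - F (cl t')\<bar>"
      by (simp only: w right_diff_distrib[symmetric] abs_mult abs_exp_cancel)
    also have "\<dots> \<le> exp (- 2 * T1) * \<bar>F (cl t) - F (cl t')\<bar>"
      using clj[of j t] clj[of k t] by (intro mult_right_mono) auto
    also have "\<dots> < exp (- 2 * T1) * (e / 3 * exp (2 * T1))"
    proof (intro mult_strict_left_mono T[rule_format] conjI)
      show "cl t $ l \<le> T" "cl t' $ l \<le> T" using le by (simp_all add: cll)
    qed (simp_all add: cleq clc)
    also have "\<dots> = e / 3" by (simp add: exp_minus field_simps)
    finally have "\<bar>?f (cl t) - ?f (cl t')\<bar> < e / 3" .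
    with 1[OF conjI[OF le'(1) clc(1)]] 1[OF conjI[OF le'(2) clc(2)]]
    show "\<bar>?f t - ?f t'\<bar> < e" by linarith
  qed
qed

text \<open>The bound \<open>M * exp (t $ l)\<close> is integrable at minus infinity: the
  oscillation below level \<open>T\<close> is at most the tail \<open>M * exp T\<close>.\<close>

lemma ucauchy_deriv:
  assumes d: "\<And>t. ((\<lambda>r. F (upd t l r)) has_real_derivative D t) (at (t $ l))"
    and b: "\<And>c. \<exists>T. \<exists>M\<ge>0. \<forall>t. (\<forall>k. t $ k \<le> c) \<longrightarrow> t $ l \<le> T \<longrightarrow> \<bar>D t\<bar> \<le> M * exp (t $ l)"
  shows "ucauchy l F"
  unfolding ucauchy_def
proof (intro allI impI)
  fix c and e :: real assume "e > 0"
  obtain T0 M where T0: "M \<ge> 0" "\<And>t. (\<And>k. t $ k \<le> c) \<Longrightarrow> t $ l \<le> T0 \<Longrightarrow> \<bar>D t\<bar> \<le> M * exp (t $ l)"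
    using b[of c] by auto
  \<comment> \<open>\<open>M + 1\<close> avoids dividing by zero when \<open>M = 0\<close>;
    \<open>T \<le> c\<close> puts the \<open>l\<close>-th coordinate, too, in the region of the
    bound.\<close>
  define T where "T = Min {T0, c, ln (e / (M + 1))}"
  have T: "T \<le> T0" "T \<le> c" "T \<le> ln (e / (M + 1))" by (simp_all add: T_def)
  have "M * exp T < (M + 1) * exp T" by simp
  also have "\<dots> \<le> (M + 1) * exp (ln (e / (M + 1)))" using T T0 by (intro mult_left_mono) auto
  also have "\<dots> = e" using T0 \<open>e > 0\<close> by simp
  finally have MT: "M * exp T < e" .
  have main: "\<bar>F t' - F t\<bar> < e"
    if eq: "\<forall>k. k \<noteq> l \<longrightarrow> t $ k = t' $ k \<and> t $ k \<le> c" and le: "t' $ l \<le> T" "t $ l < t' $ l" for t t'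
  proof -
    have der: "((\<lambda>r. F (upd t l r)) has_real_derivative D (upd t l r)) (at r)" for r
    proof -
      have "upd (upd t l r) l = upd t l" by (simp add: fun_eq_iff vec_eq_iff)
      then show ?thesis using d[of "upd t l r"] by simp
    qed
    have "norm (F (upd t l (t' $ l)) - F (upd t l (t $ l))) \<le> M * exp (t' $ l) - M * exp (t $ l)"
    proof (rule differentiable_bound_general[OF le(2), where f' = "\<lambda>r. D (upd t l r)" and \<phi>' = "\<lambda>r. M * exp r"])
      show "continuous_on {t $ l..t' $ l} (\<lambda>r. F (upd t l r))"
        using der by (intro continuous_at_imp_continuous_on ballI) (rule DERIV_isCont)
      show "norm (D (upd t l r)) \<le> M * exp r" if "t $ l < r" "r < t' $ l" for r
      proof -
          have "upd t l r $ k \<le> c" for k using that le eq T by (cases "k = l") auto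
          then show ?thesis using T0(2)[of "upd t l r"] that le T by simp
        qed
    qed (use der in \<open>auto intro!: continuous_intros derivative_eq_intros
        simp: has_real_derivative_iff_has_vector_derivative[symmetric]\<close>)
    moreover have "upd t l (t $ l) = t" "upd t l (t' $ l) = t'" using eq by (auto simp: vec_eq_iff)
    moreover have "M * exp (t' $ l) \<le> M * exp T" "M * exp (t $ l) \<ge> 0" using T0 le by (auto intro: mult_left_mono)
    ultimately show ?thesis using MT by simp
  qed
  show "\<exists>T. osc_less l F c e T"
  proof (intro exI[of _ T] allI impI)
    fix t t' assume *: "\<forall>k. k \<noteq> l \<longrightarrow> t $ k = t' $ k \<and> t $ k \<le> c" "t $ l \<le> T" "t' $ l \<le> T"
    consider "t $ l < t' $ l" | "t' $ l < t $ l" | "t $ l = t' $ l" by linarith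
    then show "\<bar>F t - F t'\<bar> < e"
    proof cases
      case 1 then show ?thesis using main[of t t'] * by (metis abs_minus_commute)
    next
      case 2 then show ?thesis using main[of t' t] * by metis
    next
      case 3 with * have "t = t'" by (metis vec_eq_iff)
      then show ?thesis using \<open>e > 0\<close> by simp
    qed
  qed
qed

text \<open>Truncating \<open>\<bar>z\<^sub>j\<bar>\<close> at \<open>e\<^sup>-\<^sup>N\<close> avoids the junk value \<open>ln 0 = 0\<close>.\<close>

definition lnabs :: "nat \<Rightarrow> complex^'n \<Rightarrow> real^'n" where
  "lnabs N z = (\<chi> j. ln (max (norm (z $ j)) (exp (- real N))))"

text \<open>Off the hyperplanes the truncation is eventually inactive, so this is \<open>f\<close>
  in logarithmic coordinates; on them the vanishing moduli are replaced by \<open>exp (- N)\<close>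
  and go to zero together.\<close>

definition ext :: "(real^'n \<Rightarrow> real) \<Rightarrow> complex^'n \<Rightarrow> real" where
  "ext f z = lim (\<lambda>N. f (lnabs N z))"

lemma lnabs_le:
  fixes z :: "complex^'n::finite"
  assumes "norm z \<le> exp c" "- real N \<le> c"
  shows "lnabs N z $ k \<le> c"
proof -
  have "max (norm (z $ k)) (exp (- real N)) \<le> exp c"
    using Finite_Cartesian_Product.norm_nth_le[of z k] assms by auto
  then have "ln (max (norm (z $ k)) (exp (- real N))) \<le> ln (exp c)"
    by (intro ln_mono) (auto simp: less_max_iff_disj)
  then show ?thesis by (simp add: lnabs_def)
qed

lemma lnabs_cases:
  fixes z :: "complex^'n"
  shows "M \<ge> N \<Longrightarrow> lnabs N z $ k = lnabs M z $ k \<or> (lnabs N z $ k \<le> - real N \<and> lnabs M z $ k \<le> - real N)"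
proof -
  assume "M \<ge> N"
  then have e: "exp (- real M) \<le> exp (- real N)" by simp
  show ?thesis
  proof (cases "norm (z $ k) \<ge> exp (- real N)")
    case True
    then have "exp (- real M) \<le> cmod (z $ k)" using e by linarith
    with True show ?thesis by (simp add: lnabs_def max_absorb1)
  next
    case False
    then have "max (norm (z $ k)) (exp (- real M)) \<le> exp (- real N)" using e by auto
    then have "ln (max (norm (z $ k)) (exp (- real M))) \<le> - real N"
      by (metis exp_gt_zero ln_exp ln_mono less_max_iff_disj)
    with False show ?thesis by (simp add: lnabs_def max_absorb2)
  qed
qed

lemma continuous_lnabs: "continuous_on UNIV (lnabs N)"
  unfolding lnabs_def
proof (intro continuous_intros continuous_on_vec_lambda ballI)
  fix z :: "complex^'a" and j
  have "max (norm (z $ j)) (exp (- real N)) > 0" by (simp add: less_max_iff_disj)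
  then show "max (norm (z $ j)) (exp (- real N)) \<noteq> 0" by linarith
qed

text \<open>Uniformity on balls, hyperplanes included, is what makes \<open>ext f\<close> continuous
  there. The radius \<open>exp c\<close> becomes the bound \<open>c\<close> on all logarithmic
  coordinates.\<close>

lemma ext_uniform:
  assumes "\<And>l. ucauchy l f"
  shows "uniform_limit (cball 0 (exp c)) (\<lambda>N z. f (lnabs N z)) (ext f) sequentially"
proof -
  have "uniformly_Cauchy_on (cball 0 (exp c)) (\<lambda>N z. f (lnabs N z))"
  proof (rule uniformly_Cauchy_onI')
    fix e :: real assume "e > 0"
    have "\<exists>T. osc_less_on UNIV f c e T"
      by (rule ucauchy_set) (use assms \<open>e > 0\<close> in auto)
    then obtain T where
      T: "\<And>t t'. (\<And>i. t $ i \<le> c \<and> t' $ i \<le> c) \<Longrightarrow>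
        (\<And>i. t $ i = t' $ i \<or> (t $ i \<le> T \<and> t' $ i \<le> T)) \<Longrightarrow> \<bar>f t - f t'\<bar> < e" by blast
    define M where "M = nat \<lceil>max (- T) (- c)\<rceil>"
    have M: "- real M \<le> T" "- real M \<le> c" unfolding M_def by linarith+
    have "\<bar>f (lnabs m z) - f (lnabs n z)\<bar> < e" if "z \<in> cball 0 (exp c)" "m \<ge> M" "n > m" for z m n
    proof (rule T)
      show "lnabs m z $ i \<le> c \<and> lnabs n z $ i \<le> c" for i using that M by (auto intro!: lnabs_le)
      show "lnabs m z $ i = lnabs n z $ i \<or> (lnabs m z $ i \<le> T \<and> lnabs n z $ i \<le> T)" for i
        using lnabs_cases[of m n z i] that M by auto
    qed
    then show "\<exists>M. \<forall>x\<in>cball 0 (exp c). \<forall>m\<ge>M. \<forall>n>m. dist (f (lnabs m x)) (f (lnabs n x)) < e"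
      unfolding dist_real_def by blast
  qed
  then have "uniformly_convergent_on (cball 0 (exp c)) (\<lambda>N z. f (lnabs N z))"
    by (rule Cauchy_uniformly_convergent)
  then show ?thesis unfolding uniformly_convergent_uniform_limit_iff ext_def .
qed

lemma ext_tendsto:
  assumes "\<And>l. ucauchy l f"
  shows "(\<lambda>N. f (lnabs N z)) \<longlonglongrightarrow> ext f z"
proof (rule tendsto_uniform_limitI[OF ext_uniform[OF assms]])
  show "z \<in> cball 0 (exp (ln (norm z + 1)))" by (simp add: add_nonneg_pos)
qed

lemma ext_continuous:
  assumes "\<And>l. ucauchy l f" "continuous_on UNIV f"
  shows "continuous_on UNIV (ext f)"
proof -
  have "continuous_on (cball 0 (exp c)) (ext f)" for c
    by (rule uniform_limit_theorem[OF _ ext_uniform[OF assms(1)]])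
       (auto intro!: always_eventually continuous_on_compose2[OF assms(2)] continuous_on_subset[OF continuous_lnabs])
  then have "continuous_on (ball 0 (exp c)) (ext f)" for c
    by (rule continuous_on_subset[of "cball 0 (exp c)"]) auto
  moreover have "z \<in> ball 0 (exp (ln (norm z + 1)))" for z :: "complex^'a" by (simp add: add_nonneg_pos)
  ultimately have "isCont (ext f) z" for z
    using continuous_on_eq_continuous_at[OF open_ball] by blast
  then show ?thesis by (simp add: continuous_at_imp_continuous_on)
qed

lemma exp_minus_real_tendsto: "(\<lambda>N. exp (- real N)) \<longlonglongrightarrow> 0"
  by (rule filterlim_compose[OF exp_at_bot])
     (simp add: filterlim_uminus_at_bot filterlim_real_sequentially)

lemma lnabs_large: "\<forall>j. z $ j \<noteq> 0 \<Longrightarrow> \<forall>\<^sub>F N in sequentially. lnabs N z = (\<chi> j. ln (norm (z $ j)))"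
proof -
  assume z: "\<forall>j. z $ j \<noteq> 0"
  have "\<forall>\<^sub>F N in sequentially. exp (- real N) < norm (z $ j)" for j
    using exp_minus_real_tendsto z by (intro order_tendstoD(2)) auto
  then have "\<forall>\<^sub>F N in sequentially. \<forall>j. exp (- real N) < norm (z $ j)"
    by (simp add: eventually_all_finite)
  then show ?thesis
    by eventually_elim (simp add: lnabs_def vec_eq_iff max_absorb1)
qed

lemma ext_eq: "\<forall>j. z $ j \<noteq> 0 \<Longrightarrow> ext f z = f (\<chi> j. ln (norm (z $ j)))"
  unfolding ext_def
  by (intro limI tendsto_eventually eventually_mono[OF lnabs_large]) auto

lemma ext_zero:
  assumes "\<And>l. ucauchy l f" "lim_minf j f (\<lambda>_. 0)" "z $ j = 0"
  shows "ext f z = 0"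
proof (rule LIMSEQ_unique[OF ext_tendsto[OF assms(1)]])
  show "(\<lambda>N. f (lnabs N z)) \<longlonglongrightarrow> 0"
  proof (rule LIMSEQ_I)
    fix e :: real assume "e > 0"
    define c where "c = ln (norm z + 1)"
    have c: "norm z \<le> exp c" "0 \<le> c" by (simp_all add: c_def add_nonneg_pos)
    obtain T where T: "\<And>t. (\<And>k. k \<noteq> j \<Longrightarrow> t $ k \<le> c) \<Longrightarrow> t $ j \<le> T \<Longrightarrow> \<bar>f t\<bar> < e"
      by (rule lim_minf_zero[OF assms(2) \<open>e > 0\<close>, of c]) (rule that, blast+)
    have "norm (f (lnabs N z) - 0) < e" if "N \<ge> nat \<lceil>- T\<rceil>" for N
    proof -
      have "- real N \<le> T" using that by linarith
      then have "lnabs N z $ j \<le> T" using assms(3) by (simp add: lnabs_def max_absorb2)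
      then show ?thesis using T[of "lnabs N z"] lnabs_le[OF c(1)] c(2) by simp
    qed
    then show "\<exists>M. \<forall>N\<ge>M. norm (f (lnabs N z) - 0) < e" by blast
  qed
qed

text \<open>The region is unbounded, but the moduli \<open>exp (t $ k)\<close> stay in a compact
  ball, on which the continuous extension is bounded.\<close>

lemma ext_bounded:
  assumes "\<And>l. ucauchy l f" "continuous_on UNIV f"
  shows "\<exists>M\<ge>0. \<forall>t. (\<forall>k. t $ k \<le> c) \<longrightarrow> \<bar>f t\<bar> \<le> M"
proof -
  let ?B = "cball (0::complex^'a) (real CARD('a) * exp c)"
  have "bounded (ext f ` ?B)"
    by (intro compact_imp_bounded compact_continuous_image continuous_on_subset[OF ext_continuous[OF assms]]) auto
  then obtain M where M: "\<And>z. z \<in> ?B \<Longrightarrow> \<bar>ext f z\<bar> \<le> M" unfolding bounded_iff real_norm_def by blast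
  have "\<bar>f t\<bar> \<le> M" if "\<forall>k. t $ k \<le> c" for t
  proof -
    define z :: "complex^'a" where "z = (\<chi> j. of_real (exp (t $ j)))"
    have "norm z \<le> (\<Sum>j\<in>UNIV. norm (z $ j))" by (simp add: norm_vec_def L2_set_le_sum)
    also have "\<dots> \<le> (\<Sum>j\<in>(UNIV::'a set). exp c)" using that by (intro sum_mono) (simp add: z_def)
    finally have "z \<in> ?B" by simp
    moreover have "ext f z = f t" by (subst ext_eq) (auto simp: z_def)
    ultimately show ?thesis using M by metis
  qed
  then show ?thesis by (intro exI[of _ "max M 0"]) force
qed

section \<open>Differentiable extension across the coordinate hyperplanes\<close>

abbreviation torus :: "(complex^'n) set" where
  "torus \<equiv> {z. \<forall>j. z $ j \<noteq> 0}"

lemma closure_torus: "closure torus = UNIV"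
proof (intro set_eqI iffI UNIV_I)
  fix z :: "complex^'n"
  define e :: "complex^'n" where "e = (\<chi> j. if z $ j = 0 then 1 else 0)"
  define p where "p k = (\<chi> j. if z $ j = 0 then of_real (inverse (real (Suc k))) else z $ j)" for k
  have "p k \<in> torus" for k
    using of_nat_neq_0[of k, where 'a = complex] by (auto simp: p_def simp del: of_nat_Suc)
  moreover have "p \<longlonglongrightarrow> z"
  proof (rule vec_tendstoI)
    fix j
    have "(\<lambda>k. of_real (inverse (real (Suc k))) :: complex) \<longlonglongrightarrow> of_real 0"
      by (intro tendsto_of_real LIMSEQ_inverse_real_of_nat)
    then show "(\<lambda>k. p k $ j) \<longlonglongrightarrow> z $ j"
      by (cases "z $ j = 0") (simp_all add: p_def del: of_nat_Suc)
  qed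
  ultimately show "z \<in> closure torus" unfolding closure_sequential by blast
qed

lemma open_torus: "open torus"
  unfolding Collect_all_eq by (intro open_INT ballI open_Collect_neq continuous_intros) auto

text \<open>A segment from \<open>z0\<close> to a nearby point off the coordinate hyperplanes meets them at most
  in \<open>z0\<close>, so the mean value theorem applies along it.\<close>

lemma has_derivative_across_hyperplanes:
  fixes F :: "complex^'n \<Rightarrow> 'b::real_normed_vector"
  assumes cF: "continuous_on UNIV F"
    and lin: "\<And>z. bounded_linear (F' z)"
    and cF': "\<And>v. continuous_on UNIV (\<lambda>z. F' z v)"
    and d: "\<And>z. \<forall>j. z $ j \<noteq> 0 \<Longrightarrow> (F has_derivative F' z) (at z)"
  shows "(F has_derivative F' z0) (at z0)"
  unfolding has_derivative_at_alt
proof (intro conjI lin allI impI)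
  fix e :: real assume "e > 0"
  have ap: "blinfun_apply (Blinfun (F' z)) = F' z" for z by (rule bounded_linear_Blinfun_apply[OF lin])
  have "continuous_on UNIV (\<lambda>z. Blinfun (F' z))"
    by (rule continuous_on_blinfun_componentwise) (simp add: ap cF')
  then obtain d1 where d1: "d1 > 0" "\<And>z. dist z z0 < d1 \<Longrightarrow> dist (Blinfun (F' z)) (Blinfun (F' z0)) < e"
    using \<open>e > 0\<close> unfolding continuous_on_iff by (metis UNIV_I)
  \<comment> \<open>Within this radius the nonzero coordinates of \<open>z0\<close> cannot vanish
    along a segment; inserting \<open>d1\<close> also keeps the set nonempty when
    \<open>z0 = 0\<close>.\<close>
  define d2 where "d2 = Min (insert d1 ((\<lambda>j. norm (z0 $ j)) ` {j. z0 $ j \<noteq> 0}))"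
  have d2: "d2 > 0" "d2 \<le> d1" "\<And>j. z0 $ j \<noteq> 0 \<Longrightarrow> d2 \<le> norm (z0 $ j)"
    using d1 by (auto simp: d2_def)
  let ?C = "{z. norm (F z - F z0 - F' z0 (z - z0)) \<le> e * norm (z - z0)}"
  have "z \<in> ?C" if z: "\<forall>j. z $ j \<noteq> 0" "z \<in> ball z0 d2" for z
  proof -
    define p where "p s = z0 + s *\<^sub>R (z - z0)" for s :: real
    have pnz: "p s $ j \<noteq> 0" if s: "0 < s" "s < 1" for s j
    proof (cases "z0 $ j = 0")
      case True then show ?thesis using z s by (simp add: p_def)
    next
      case False
      have "norm (s *\<^sub>R (z - z0) $ j) \<le> norm ((z - z0) $ j)" using s by (simp add: mult_left_le_one_le)
      also have "\<dots> \<le> norm (z - z0)" by (rule Finite_Cartesian_Product.norm_nth_le)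
      also have "\<dots> < norm (z0 $ j)" using z d2(3)[OF False] by (simp add: dist_norm norm_minus_commute)
      finally have lt: "norm (s *\<^sub>R (z - z0) $ j) < norm (z0 $ j)" .
      have "z0 $ j = - (s *\<^sub>R (z - z0) $ j)" if "p s $ j = 0"
        using that by (simp add: p_def add_eq_0_iff)
      with lt show ?thesis by (metis norm_minus_cancel less_irrefl)
    qed
    have pball: "dist (p s) z0 < d1" if s: "0 < s" "s < 1" for s
    proof -
      have "dist (p s) z0 \<le> norm (z - z0)" using s by (simp add: p_def dist_norm mult_left_le_one_le)
      also have "\<dots> < d1" using z d2 by (simp add: dist_norm norm_minus_commute)
      finally show ?thesis .
    qed
    interpret L: bounded_linear "F' z0" by (rule lin)
    \<comment> \<open>Subtracting the linear part at \<open>z0\<close> leaves a derivative of norm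
      at most \<open>e * norm (z - z0)\<close>.\<close>
    let ?f = "\<lambda>s. F (p s) - s *\<^sub>R F' z0 (z - z0)"
    have "norm (?f 1 - ?f 0) \<le> (e * norm (z - z0)) * 1 - (e * norm (z - z0)) * 0"
    proof (rule differentiable_bound_general[where f = ?f and f' = "\<lambda>s. F' (p s) (z - z0) - F' z0 (z - z0)"
          and \<phi>' = "\<lambda>s. e * norm (z - z0)"])
      show "continuous_on {0..1} ?f"
        unfolding p_def by (intro continuous_intros continuous_on_compose2[OF cF]) auto
      fix s :: real assume s: "0 < s" "s < 1"
      have "((\<lambda>s. F (p s)) has_derivative (\<lambda>k. F' (p s) (k *\<^sub>R (z - z0)))) (at s)"
        unfolding p_def[abs_def]
        by (rule has_derivative_compose[OF _ d]) (use pnz[OF s] in \<open>auto simp: p_def intro!: derivative_eq_intros\<close>)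
      then have "((\<lambda>s. F (p s)) has_vector_derivative F' (p s) (z - z0)) (at s)"
        by (simp add: has_vector_derivative_def linear_cmul[OF bounded_linear.linear[OF lin]])
      then show "(?f has_vector_derivative F' (p s) (z - z0) - F' z0 (z - z0)) (at s)"
        by (auto intro!: derivative_eq_intros)
      have "norm (F' (p s) (z - z0) - F' z0 (z - z0)) = norm (blinfun_apply (Blinfun (F' (p s)) - Blinfun (F' z0)) (z - z0))"
        by (simp add: blinfun.diff_left ap)
      also have "\<dots> \<le> norm (Blinfun (F' (p s)) - Blinfun (F' z0)) * norm (z - z0)" by (rule norm_blinfun)
      also have "\<dots> \<le> e * norm (z - z0)"
        using d1(2)[OF pball[OF s]] by (intro mult_right_mono) (auto simp: dist_norm)
      finally show "norm (F' (p s) (z - z0) - F' z0 (z - z0)) \<le> e * norm (z - z0)" .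
    qed (auto intro!: continuous_intros derivative_eq_intros)
    then show ?thesis by (simp add: p_def algebra_simps)
  qed
  then have "torus \<inter> ball z0 d2 \<subseteq> ?C" by blast
  \<comment> \<open>The estimate is a closed condition and the torus is dense, so it passes to
    points on the hyperplanes.\<close>
  moreover have "closed ?C"
    by (intro closed_Collect_le continuous_intros cF linear_continuous_on_compose[OF _ bounded_linear.linear[OF lin]])
  ultimately have "closure (ball z0 d2 \<inter> torus) \<subseteq> ?C"
    by (simp add: closure_minimal Int_commute)
  with open_Int_closure_subset[OF open_ball, of z0 d2 "torus"]
  have "ball z0 d2 \<subseteq> ?C" unfolding closure_torus by blast
  then show "\<exists>d>0. \<forall>y. norm (y - z0) < d \<longrightarrow> norm (F y - F z0 - F' z0 (y - z0)) \<le> e * norm (y - z0)"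
    using d2(1) by (intro exI[of _ d2]) (auto simp: dist_norm norm_minus_commute subset_iff)
qed

lemma ucauchy_diff:
  assumes "ucauchy l f" "ucauchy l g"
  shows "ucauchy l (\<lambda>t. f t - g t)"
  unfolding ucauchy_def
proof (intro allI impI)
  fix c and e :: real assume "e > 0"
  then have "e / 2 > 0" by simp
  then obtain T1 where
    T1: "osc_less l f c (e / 2) T1"
    using assms(1) unfolding ucauchy_def by blast
  from \<open>e / 2 > 0\<close> obtain T2 where
    T2: "osc_less l g c (e / 2) T2"
    using assms(2) unfolding ucauchy_def by blast
  show "\<exists>T. osc_less l (\<lambda>t. f t - g t) c e T"
  proof (intro exI[of _ "min T1 T2"] allI impI)
    fix t t' assume *: "\<forall>k. k \<noteq> l \<longrightarrow> t $ k = t' $ k \<and> t $ k \<le> c" "t $ l \<le> min T1 T2" "t' $ l \<le> min T1 T2"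
    have "\<bar>f t - f t'\<bar> < e / 2" "\<bar>g t - g t'\<bar> < e / 2"
      using T1[THEN spec, THEN spec, THEN mp, OF *(1)] T2[THEN spec, THEN spec, THEN mp, OF *(1)] *(2,3) by auto
    then show "\<bar>f t - g t - (f t' - g t')\<bar> < e" by linarith
  qed
qed

text \<open>\<open>sgn\<close> is bounded by 1 and discontinuous only at 0; wherever a sign may
  jump, the continuous factor \<open>X\<close> vanishes.\<close>

lemma continuous_sgn_product:
  fixes u v :: "'a::metric_space \<Rightarrow> complex"
  assumes X: "continuous_on UNIV X" and u: "continuous_on UNIV u" and v: "continuous_on UNIV v"
    and zero: "\<And>z. u z = 0 \<or> v z = 0 \<Longrightarrow> X z = (0::real)"
  shows "continuous_on UNIV (\<lambda>z. (X z * (sgn (u z) \<bullet> w)) *\<^sub>R sgn (v z))"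
proof (intro continuous_at_imp_continuous_on ballI)
  fix z
  have c: "isCont X z" "isCont u z" "isCont v z"
    using X u v by (simp_all add: continuous_on_eq_continuous_at)
  show "isCont (\<lambda>z. (X z * (sgn (u z) \<bullet> w)) *\<^sub>R sgn (v z)) z"
  proof (cases "u z = 0 \<or> v z = 0")
    case True
    have bd: "norm ((X y * (sgn (u y) \<bullet> w)) *\<^sub>R sgn (v y)) \<le> \<bar>X y\<bar> * norm w" for y
    proof -
      have "\<bar>sgn (u y) \<bullet> w\<bar> \<le> norm (sgn (u y)) * norm w" by (rule Cauchy_Schwarz_ineq2)
      also have "\<dots> \<le> 1 * norm w" by (intro mult_right_mono) (auto simp: norm_sgn)
      finally have "\<bar>X y\<bar> * \<bar>sgn (u y) \<bullet> w\<bar> * norm (sgn (v y)) \<le> \<bar>X y\<bar> * norm w * 1"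
        by (intro mult_mono mult_left_mono) (auto simp: norm_sgn)
      then show ?thesis by (simp add: abs_mult)
    qed
    have lim: "((\<lambda>y. \<bar>X y\<bar> * norm w) \<longlongrightarrow> \<bar>X z\<bar> * norm w) (at z)"
      using c(1) by (intro tendsto_intros) (simp add: isCont_def)
    have "((\<lambda>y. (X y * (sgn (u y) \<bullet> w)) *\<^sub>R sgn (v y)) \<longlongrightarrow> 0) (at z)"
      by (rule Lim_null_comparison[OF always_eventually[OF allI[OF bd]]])
         (use lim zero[OF True] in simp)
    then show ?thesis using zero[OF True] by (simp add: isCont_def)
  next
    case False
    then show ?thesis using c by (intro continuous_intros isCont_sgn) auto
  qed
qed

lemma has_derivative_vec_lambda:
  fixes f :: "'n::finite \<Rightarrow> 'a::real_normed_vector \<Rightarrow> 'b::euclidean_space"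
  assumes "\<And>j. (f j has_derivative f' j) F"
  shows "((\<lambda>x. \<chi> j. f j x) has_derivative (\<lambda>v. \<chi> j. f' j v)) F"
  unfolding vec_lambda_eq_sum_axis
  by (intro has_derivative_sum bounded_linear.has_derivative[OF bounded_linear_axis] assms)

lemma has_derivative_ln_norm:
  fixes z :: "complex^'n"
  assumes "\<forall>j. z $ j \<noteq> 0"
  shows "((\<lambda>z. \<chi> j. ln (norm (z $ j))) has_derivative (\<lambda>v. \<chi> j. (z $ j \<bullet> v $ j) / (norm (z $ j))\<^sup>2)) (at z)"
proof -
  have "((\<lambda>z. ln (norm (z $ j))) has_derivative (\<lambda>v. (z $ j \<bullet> v $ j) / (norm (z $ j))\<^sup>2)) (at z)" for j
  proof -
    have "((\<lambda>z. norm (z $ j)) has_derivative (\<lambda>v. v $ j \<bullet> sgn (z $ j))) (at z)"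
      using assms by (intro has_derivative_compose[where f = "\<lambda>z. z $ j" and g = norm and f' = "\<lambda>v. v $ j"]
          has_derivative_norm bounded_linear_imp_has_derivative bounded_linear_vec_nth) auto
    then show ?thesis
      using assms by (auto intro!: derivative_eq_intros simp: sgn_div_norm power2_eq_square divide_simps inner_commute)
  qed
  then show ?thesis by (rule has_derivative_vec_lambda)
qed

text \<open>\<open>A j\<close> and \<open>B j k\<close> stand for the first and second partial
  derivatives of the shifted potential in the coordinates \<open>t\<close>; the conjuncts are (1),
  (2), (3) of the growth condition for one cone.\<close>

definition frame_growth :: "('n::finite \<Rightarrow> real^'n \<Rightarrow> real) \<Rightarrow> ('n \<Rightarrow> 'n \<Rightarrow> real^'n \<Rightarrow> real) \<Rightarrow> bool" where
  "frame_growth A B \<longleftrightarrow>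
     (\<forall>j. \<exists>\<Lambda>. lim_minf j (\<lambda>t. 2 * exp (- 2 * t $ j) * A j t) \<Lambda> \<and> lim_minf j (\<lambda>t. exp (- 2 * t $ j) * B j j t) \<Lambda>) \<and>
     (\<forall>j k l. \<exists>\<Lambda>. lim_minf l (B j k) \<Lambda>) \<and>
     (\<forall>j k. j \<noteq> k \<longrightarrow> lim_minf j (\<lambda>t. exp (- t $ j - t $ k) * B j k t) (\<lambda>_. 0) \<and>
        lim_minf k (\<lambda>t. exp (- t $ j - t $ k) * B j k t) (\<lambda>_. 0))"

lemma potential_extends:
  fixes G :: "real^'n \<Rightarrow> real"
  assumes dG: "\<And>t. (G has_derivative (\<lambda>v. \<Sum>j\<in>UNIV. A j t * v $ j)) (at t)"
    and dA: "\<And>j t. (A j has_derivative (\<lambda>v. \<Sum>k\<in>UNIV. B k j t * v $ k)) (at t)"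
    and cB: "\<And>k j. continuous_on UNIV (B k j)"
    and growth: "frame_growth A B"
  shows "\<exists>\<phi>::complex^'n \<Rightarrow> real. C2_fun \<phi> \<and> (\<forall>z. (\<forall>j. z $ j \<noteq> 0) \<longrightarrow> \<phi> z = G (\<chi> j. ln (norm (z $ j))))"
proof -
  have 1: "\<exists>\<Lambda>. lim_minf j (\<lambda>t. 2 * exp (- 2 * t $ j) * A j t) \<Lambda> \<and> lim_minf j (\<lambda>t. exp (- 2 * t $ j) * B j j t) \<Lambda>"
    and 2: "\<exists>\<Lambda>. lim_minf l (B j k) \<Lambda>"
    and 3: "j \<noteq> k \<Longrightarrow> lim_minf j (\<lambda>t. exp (- t $ j - t $ k) * B j k t) (\<lambda>_. 0)"
      "j \<noteq> k \<Longrightarrow> lim_minf k (\<lambda>t. exp (- t $ j - t $ k) * B j k t) (\<lambda>_. 0)" for j k l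
    using growth unfolding frame_growth_def by blast+
  \<comment> \<open>With \<open>t $ j = ln (norm (z $ j))\<close> the gradient in
    \<open>z $ j\<close> is \<open>P j\<close> times \<open>z $ j\<close>. The derivatives of
    \<open>P j\<close> bring in \<open>U k j\<close> with the signs of \<open>z $ k\<close> and
    \<open>z $ j\<close>; the term \<open>2 * A j\<close> comes from differentiating
    \<open>exp (- 2 * t $ j)\<close>.\<close>
  define P where "P j t = exp (- t $ j - t $ j) * A j t" for j t
  define F where "F k j t = B k j t - (if k = j then 2 * A j t else 0)" for k j t
  define U where "U k j t = exp (- t $ k - t $ j) * F k j t" for k j t
  have cG: "continuous_on UNIV G" and cA: "continuous_on UNIV (A j)" for j
    using dG dA by (meson continuous_at_imp_continuous_on has_derivative_continuous)+
  have cP: "continuous_on UNIV (P j)" and cU: "continuous_on UNIV (U k j)" for j k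
    unfolding P_def U_def F_def by (cases "k = j"; auto intro!: continuous_intros cA cB)+
  have partial: "((\<lambda>r. f (upd t l r)) has_real_derivative D l t) (at (t $ l))"
    if "\<And>t. (f has_derivative (\<lambda>v. \<Sum>j\<in>UNIV. D j t * v $ j)) (at t)" for f D l t
  proof -
    have u: "upd t l (t $ l) = t" by (simp add: vec_eq_iff)
    have eq: "upd t l = (\<lambda>r. upd t l 0 + r *\<^sub>R axis l 1)"
      by (simp add: fun_eq_iff vec_eq_iff axis_def)
    have "(upd t l has_derivative (\<lambda>k. k *\<^sub>R axis l 1)) (at (t $ l))"
      by (subst eq) (auto intro!: derivative_eq_intros)
    moreover have "(f has_derivative (\<lambda>v. \<Sum>j\<in>UNIV. D j t * v $ j)) (at (upd t l (t $ l)))"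
      using that[of t] by (simp only: u)
    ultimately
    have "((\<lambda>r. f (upd t l r)) has_derivative (\<lambda>k. \<Sum>j\<in>UNIV. D j t * (k *\<^sub>R axis l 1) $ j)) (at (t $ l))"
      by (rule has_derivative_compose)
    then show ?thesis
      by (simp add: has_field_derivative_def axis_def if_distrib cong: if_cong)
  qed
  \<comment> \<open>Far down in \<open>t $ l\<close>, condition (3) bounds the derivative
    \<open>B l j\<close> by a constant times \<open>exp (t $ l)\<close>. Direction \<open>j\<close>
    itself is handled through \<open>P j\<close>.\<close>
  have uA: "ucauchy l (A j)" if ne: "l \<noteq> j" for l j
  proof (rule ucauchy_deriv)
    show "((\<lambda>r. A j (upd t l r)) has_real_derivative B l j t) (at (t $ l))" for t
      by (rule partial[of "A j" "\<lambda>k. B k j"]) (rule dA)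
    fix c
    obtain T where T: "\<And>t. (\<And>k. k \<noteq> l \<Longrightarrow> t $ k \<le> c) \<Longrightarrow> t $ l \<le> T \<Longrightarrow> \<bar>exp (- t $ l - t $ j) * B l j t\<bar> < 1"
      by (rule lim_minf_zero[OF 3(1)[OF ne] zero_less_one, of c]) blast
    have "\<bar>B l j t\<bar> \<le> exp c * exp (t $ l)" if "\<forall>k. t $ k \<le> c" "t $ l \<le> T" for t
    proof -
      have "\<bar>B l j t\<bar> = exp (t $ l + t $ j) * \<bar>exp (- t $ l - t $ j) * B l j t\<bar>"
        by (simp add: abs_mult mult.assoc[symmetric] exp_add[symmetric])
      also have "\<dots> \<le> exp (t $ l + t $ j) * 1" using T[of t] that by (intro mult_left_mono) auto
      also have "\<dots> \<le> exp c * exp (t $ l)" using that by (simp add: exp_add[symmetric])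
      finally show ?thesis .
    qed
    then show "\<exists>T. \<exists>M\<ge>0. \<forall>t. (\<forall>k. t $ k \<le> c) \<longrightarrow> t $ l \<le> T \<longrightarrow> \<bar>B l j t\<bar> \<le> M * exp (t $ l)"
      by (intro exI[of _ T] exI[of _ "exp c"]) auto
  qed
  have two: "- t $ j - t $ j = - 2 * t $ j" for t :: "real^'n" and j by simp
  have uPj: "ucauchy j (P j)" for j
  proof -
    obtain \<Lambda> where "lim_minf j (\<lambda>t. 2 * exp (- 2 * t $ j) * A j t) \<Lambda>" using 1 by blast
    then have "ucauchy j (\<lambda>t. 2 * P j t)" unfolding P_def two by (simp add: lim_minf_ucauchy mult.assoc)
    then show ?thesis by (rule ucauchy_cmult) simp
  qed
  have uP: "ucauchy l (P j)" for l j
    using uPj[of j] ucauchy_weight[OF uA, of l j j j] unfolding P_def by (cases "l = j") auto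
  have U0: "lim_minf k (U k j) (\<lambda>_. 0)" "lim_minf j (U k j) (\<lambda>_. 0)" for k j
  proof -
    have "lim_minf k (U k j) (\<lambda>_. 0) \<and> lim_minf j (U k j) (\<lambda>_. 0)"
    \<comment> \<open>On the diagonal \<open>U j j\<close> is the difference of the two functions in
      (1), so their common limit makes it tend to 0.\<close>
    proof (cases "k = j")
      case True
      obtain \<Lambda> where "lim_minf j (\<lambda>t. 2 * exp (- 2 * t $ j) * A j t) \<Lambda>"
        "lim_minf j (\<lambda>t. exp (- 2 * t $ j) * B j j t) \<Lambda>" using 1 by blast
      from lim_minf_diff[OF this(2,1)] show ?thesis
        unfolding True U_def F_def two by (simp add: algebra_simps)
    next
      case False then show ?thesis using 3[OF False] unfolding U_def F_def by simp
    qed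
    then show "lim_minf k (U k j) (\<lambda>_. 0)" "lim_minf j (U k j) (\<lambda>_. 0)" by auto
  qed
  have uU: "ucauchy l (U k j)" for l k j
  proof (cases "l = k \<or> l = j")
    case True then show ?thesis using U0 lim_minf_ucauchy by blast
  next
    case False
    \<comment> \<open>In the other variables only the unweighted (2) is available;
      \<open>ucauchy_weight\<close> then restores the weight, given the behaviour in the variables
      \<open>k\<close> and \<open>j\<close>.\<close>
    have "ucauchy l (B k j)" using 2 lim_minf_ucauchy by blast
    moreover have "ucauchy l (\<lambda>t. 2 * A j t)"
      using ucauchy_cmult[of l "1/2" "\<lambda>t. 2 * A j t"] uA[of l j] False by simp
    ultimately have "ucauchy l (F k j)" unfolding F_def by (cases "k = j") (auto intro: ucauchy_diff)
    then show ?thesis unfolding U_def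
      by (rule ucauchy_weight) (use False U0[THEN lim_minf_ucauchy, unfolded U_def] in auto)
  qed
  have uG: "ucauchy l G" for l
  proof (rule ucauchy_deriv)
    show "((\<lambda>r. G (upd t l r)) has_real_derivative A l t) (at (t $ l))" for t by (rule partial) (rule dG)
    fix c
    \<comment> \<open>\<open>A l\<close> is \<open>exp (2 * t $ l)\<close> times \<open>P l\<close>,
      and \<open>P l\<close> is bounded for coordinates \<open>\<le> c\<close>; so the derivative of
      \<open>G\<close> is integrable at minus infinity.\<close>
    obtain M where M: "M \<ge> 0" "\<And>t. (\<forall>k. t $ k \<le> c) \<Longrightarrow> \<bar>P l t\<bar> \<le> M"
      using ext_bounded[OF uP cP, of c l] by auto
    have "\<bar>A l t\<bar> \<le> (M * exp c) * exp (t $ l)" if "\<forall>k. t $ k \<le> c" "t $ l \<le> 0" for t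
    proof -
      have "\<bar>A l t\<bar> = exp (t $ l + t $ l) * \<bar>P l t\<bar>"
        unfolding P_def by (simp add: abs_mult mult.assoc[symmetric] exp_add[symmetric])
      also have "\<dots> \<le> exp (t $ l + c) * M" using that M by (intro mult_mono) auto
      finally show ?thesis by (simp add: exp_add mult_ac)
    qed
    then show "\<exists>T. \<exists>M\<ge>0. \<forall>t. (\<forall>k. t $ k \<le> c) \<longrightarrow> t $ l \<le> T \<longrightarrow> \<bar>A l t\<bar> \<le> M * exp (t $ l)"
      using M(1) by (intro exI[of _ 0] exI[of _ "M * exp c"]) auto
  qed
  have expln: "exp (- ln r - ln s) = inverse r * inverse s" if "r > 0" "s > 0" for r s :: real
    using that by (simp add: exp_diff exp_minus field_simps)
  have expln2: "exp (- (2 * ln r)) = inverse r * inverse r" if "r > 0" for r :: real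
    using expln[OF that that] by simp
  let ?ln = "\<lambda>z::complex^'n. \<chi> j. ln (norm (z $ j))"
  have ext_deriv: "(ext f has_derivative f' z) (at z)"
    if z: "\<forall>j. z $ j \<noteq> 0" and f: "((\<lambda>z. f (?ln z)) has_derivative f' z) (at z)" for f f' z
  proof (rule has_derivative_transform_within_open[OF f open_torus])
    show "z \<in> torus" using z by simp
    show "f (?ln x) = ext f x" if "x \<in> torus" for x :: "complex^'n"
      using ext_eq[of x f] that by simp
  qed
  \<comment> \<open>\<open>V j\<close> is the gradient in \<open>z $ j\<close>, seen as a vector of
    the real plane. Its derivative \<open>V'\<close> is written with \<open>sgn\<close> so that it
    makes sense at \<open>z $ j = 0\<close>.\<close>
  define V where "V j z = ext (P j) z *\<^sub>R z $ j" for j and z :: "complex^'n"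
  define V' where "V' j z w = ext (P j) z *\<^sub>R w $ j
     + (\<Sum>k\<in>UNIV. (ext (U k j) z * (sgn (z $ k) \<bullet> w $ k)) *\<^sub>R sgn (z $ j))" for j and z w :: "complex^'n"
  have cV: "continuous_on UNIV (V j)" for j
    unfolding V_def by (intro continuous_intros ext_continuous uP cP)
  \<comment> \<open>The coefficient \<open>ext (U k j)\<close> vanishes on both hyperplanes where a
    sign jumps.\<close>
  have cV': "continuous_on UNIV (\<lambda>z. V' j z w)" for j w unfolding V'_def
    by (intro continuous_intros continuous_sgn_product ext_continuous uP cP uU cU)
       (use ext_zero[OF uU U0(1)] ext_zero[OF uU U0(2)] in auto)
  have dV: "(V j has_derivative V' j z) (at z)" for j z
  proof (rule has_derivative_across_hyperplanes[OF cV])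
    show "bounded_linear (V' j z)" for z unfolding V'_def
      by (intro bounded_linear_intros bounded_linear_scaleR_left[THEN bounded_linear_compose]
          bounded_linear_mult_right[THEN bounded_linear_compose] bounded_linear_inner_right[THEN bounded_linear_compose] bounded_linear_vec_nth)
    show "continuous_on UNIV (\<lambda>z. V' j z w)" for w by (rule cV')
    fix z :: "complex^'n" assume z: "\<forall>j. z $ j \<noteq> 0"
    have "(P j has_derivative (\<lambda>v. \<Sum>k\<in>UNIV. exp (- t $ j - t $ j) * F k j t * v $ k)) (at t)" for t
    proof -
      have "(\<Sum>k\<in>UNIV. exp (- t $ j - t $ j) * F k j t * v $ k)
          = exp (- t $ j - t $ j) * ((\<Sum>k\<in>UNIV. B k j t * v $ k) - 2 * A j t * v $ j)" for v
      proof -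
        have "F k j t * v $ k = B k j t * v $ k - (if k = j then 2 * A j t * v $ j else 0)" for k
          by (simp add: F_def left_diff_distrib)
        then have "(\<Sum>k\<in>UNIV. F k j t * v $ k) = (\<Sum>k\<in>UNIV. B k j t * v $ k) - 2 * A j t * v $ j"
          by (simp add: sum_subtractf)
        then show ?thesis by (simp add: mult.assoc sum_distrib_left[symmetric])
      qed
      then show ?thesis unfolding P_def
        by (auto intro!: derivative_eq_intros dA bounded_linear_imp_has_derivative bounded_linear_vec_nth
            simp: fun_eq_iff algebra_simps)
    qed
    from has_derivative_compose[OF has_derivative_ln_norm[OF z] this]
    have "(ext (P j) has_derivative (\<lambda>w. \<Sum>k\<in>UNIV. exp (- ?ln z $ j - ?ln z $ j) * F k j (?ln z) *
        ((z $ k \<bullet> w $ k) / (norm (z $ k))\<^sup>2))) (at z)"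
      by (intro ext_deriv[OF z]) simp
    then have "(V j has_derivative (\<lambda>w. ext (P j) z *\<^sub>R w $ j + (\<Sum>k\<in>UNIV. exp (- ?ln z $ j - ?ln z $ j) * F k j (?ln z) *
        ((z $ k \<bullet> w $ k) / (norm (z $ k))\<^sup>2)) *\<^sub>R z $ j)) (at z)"
      unfolding V_def by (auto intro!: derivative_eq_intros bounded_linear_imp_has_derivative bounded_linear_vec_nth)
    moreover have "(exp (- ?ln z $ j - ?ln z $ j) * F k j (?ln z) * ((z $ k \<bullet> w) / (norm (z $ k))\<^sup>2)) *\<^sub>R z $ j
        = (ext (U k j) z * (sgn (z $ k) \<bullet> w)) *\<^sub>R sgn (z $ j)" for k w
      using z by (simp add: ext_eq U_def expln expln2 sgn_div_norm power2_eq_square field_simps)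
    ultimately show "(V j has_derivative V' j z) (at z)"
      unfolding V'_def by (simp add: scaleR_sum_left)
  qed
  have C1: "C1_fun (V j)" for j
    unfolding C1_fun_iff using dV cV' by blast
  have d\<phi>: "(ext G has_derivative (\<lambda>v. \<Sum>j\<in>UNIV. V j z \<bullet> v $ j)) (at z)" for z
  proof (rule has_derivative_across_hyperplanes[OF ext_continuous[OF uG cG]])
    show "bounded_linear (\<lambda>v. \<Sum>j\<in>UNIV. V j z \<bullet> v $ j)" for z
      by (intro bounded_linear_intros bounded_linear_inner_right[THEN bounded_linear_compose] bounded_linear_vec_nth)
    show "continuous_on UNIV (\<lambda>z. \<Sum>j\<in>UNIV. V j z \<bullet> v $ j)" for v by (intro continuous_intros cV)
    fix z :: "complex^'n" assume z: "\<forall>j. z $ j \<noteq> 0"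
    have "(ext G has_derivative (\<lambda>v. \<Sum>j\<in>UNIV. A j (?ln z) * ((z $ j \<bullet> v $ j) / (norm (z $ j))\<^sup>2))) (at z)"
      by (intro ext_deriv[OF z]) (use has_derivative_compose[OF has_derivative_ln_norm[OF z] dG] in simp)
    moreover have "A j (?ln z) * ((z $ j \<bullet> w) / (norm (z $ j))\<^sup>2) = V j z \<bullet> w" for j w
      using z by (simp add: V_def ext_eq P_def expln expln2 power2_eq_square field_simps)
    ultimately show "(ext G has_derivative (\<lambda>v. \<Sum>j\<in>UNIV. V j z \<bullet> v $ j)) (at z)" by simp
  qed
  have "C2_fun (ext G)"
    unfolding C2_fun_iff using d\<phi>
    by (intro exI[of _ "\<lambda>z v. \<Sum>j\<in>UNIV. V j z \<bullet> v $ j"])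
       (auto intro!: C1_fun_sum C1_fun_bounded_linear[OF C1] bounded_linear_inner_left)
  then show ?thesis using ext_eq by blast
qed

section \<open>The growth conditions for an invariant function\<close>

definition expv :: "real^'n \<Rightarrow> real^'n" where
  "expv t = (\<chi> j. exp (t $ j))"

lemma expv_nth [simp]: "expv t $ j = exp (t $ j)"
  by (simp add: expv_def)

text \<open>Allowing any \<open>s\<close> up to \<open>exp (t $ l)\<close> covers composites with
  \<open>expv\<close> as well as intermediate points of the mean value theorem. Uniform continuity
  of \<open>\<rho>\<close> on a compact box gives uniformity in the other variables.\<close>

lemma lim_minf_expv:
  fixes \<rho> :: "real^'n \<Rightarrow> real"
  assumes c\<rho>: "continuous_on UNIV \<rho>"
    and f: "\<And>t. \<exists>s. 0 \<le> s \<and> s \<le> exp (t $ l) \<and> f t = \<rho> (upd (expv t) l s)"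
  shows "lim_minf l f (\<lambda>t. \<rho> (upd (expv t) l 0))"
  unfolding lim_minf_def uniform_limit_iff eventually_at_bot_linorder upd_def[symmetric]
proof (intro allI impI)
  fix c e :: real assume "e > 0"
  define K where "K = cbox (0::real^'n) (\<chi> k. exp (max c 0))"
  have "uniformly_continuous_on K \<rho>"
    by (rule compact_uniformly_continuous) (auto simp: K_def intro: continuous_on_subset[OF c\<rho>])
  then obtain d where d: "d > 0" "\<And>x y. x \<in> K \<Longrightarrow> y \<in> K \<Longrightarrow> dist x y < d \<Longrightarrow> dist (\<rho> x) (\<rho> y) < e"
    using \<open>e > 0\<close> unfolding uniformly_continuous_on_def by metis
  \<comment> \<open>\<open>exp T \<le> 1\<close> keeps \<open>s\<close> inside the box
    \<open>K\<close>, and \<open>exp T < d\<close> makes the shift to the hyperplane small enough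
    for \<open>d\<close>.\<close>
  define T where "T = min 0 (ln (d / 2))"
  have T: "exp T \<le> 1" "exp T < d"
  proof -
    show "exp T \<le> 1" by (simp add: T_def)
    have "exp T \<le> exp (ln (d / 2))" by (simp add: T_def)
    also have "\<dots> = d / 2" using d by simp
    finally show "exp T < d" using d by simp
  qed
  show "\<exists>T. \<forall>r\<le>T. \<forall>t\<in>{t. \<forall>k. k \<noteq> l \<longrightarrow> t $ k \<le> c}. dist (f (upd t l r)) (\<rho> (upd (expv t) l 0)) < e"
  proof (intro exI[of _ T] allI impI ballI)
    fix r t assume r: "r \<le> T" and "t \<in> {t. \<forall>k. k \<noteq> l \<longrightarrow> t $ k \<le> c}"
    then have t: "t $ k \<le> max c 0" if "k \<noteq> l" for k using that by auto
    obtain s where s: "0 \<le> s" "s \<le> exp (upd t l r $ l)" "f (upd t l r) = \<rho> (upd (expv (upd t l r)) l s)"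
      using f by blast
    have "exp r \<le> exp T" using r by simp
    moreover have "s \<le> exp r" using s(2) by simp
    ultimately have sT: "s \<le> exp T" by linarith
    have u: "upd (expv (upd t l r)) l s = upd (expv t) l s" by (simp add: vec_eq_iff)
    have "upd (expv t) l s' \<in> K" if "0 \<le> s'" "s' \<le> 1" for s'
      using that t by (auto simp: K_def mem_box_cart order_trans[OF that(2)])
    moreover have "dist (upd (expv t) l s) (upd (expv t) l 0) = norm (s *\<^sub>R axis l (1::real))"
      unfolding dist_norm by (rule arg_cong[of _ _ norm]) (simp add: vec_eq_iff axis_def)
    then have "dist (upd (expv t) l s) (upd (expv t) l 0) < d" using s(1) sT T by simp
    moreover have "s \<le> 1" using sT T by linarith
    ultimately show "dist (f (upd t l r)) (\<rho> (upd (expv t) l 0)) < e"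
      unfolding s(3) u using s(1) by (intro d(2)) auto
  qed
qed

lemma lim_minf_add:
  assumes "lim_minf l f \<Lambda>" "lim_minf l g \<Lambda>'"
  shows "lim_minf l (\<lambda>t. f t + g t) (\<lambda>t. \<Lambda> t + \<Lambda>' t)"
  using assms unfolding lim_minf_def by (auto intro!: uniform_limit_intros)

lemma lim_minf_cmult:
  assumes "lim_minf l f \<Lambda>"
  shows "lim_minf l (\<lambda>t. c * f t) (\<lambda>t. c * \<Lambda> t)"
  using assms unfolding lim_minf_def
  by (auto intro!: bounded_linear.uniform_limit[OF bounded_linear_mult_right])

lemma bounded_linear_flip: "bounded_linear (\<lambda>x::real^'n. upd x l (- x $ l))"
  by (simp add: linear_conv_bounded_linear[symmetric]) (auto intro!: linearI simp: vec_eq_iff)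

text \<open>The reflection fixes \<open>x\<close> and reverses the \<open>l\<close>-th direction, so
  the derivative in that direction equals its own negative.\<close>

lemma even_deriv_zero:
  fixes f :: "real^'n \<Rightarrow> real"
  assumes even: "\<And>x. f (upd x l (- x $ l)) = f x"
    and d: "(f has_derivative f') (at x)" and x: "x $ l = 0"
  shows "f' (axis l 1) = 0"
proof -
  have "upd x l (- x $ l) = x" using x by (simp add: vec_eq_iff)
  then have "((\<lambda>x. f (upd x l (- x $ l))) has_derivative (\<lambda>v. f' (upd v l (- v $ l)))) (at x)"
    by (intro has_derivative_compose[OF bounded_linear_imp_has_derivative[OF bounded_linear_flip]]) (simp add: d)
  then have "(f has_derivative (\<lambda>v. f' (upd v l (- v $ l)))) (at x)" by (simp add: even)
  then have "(\<lambda>v. f' (upd v l (- v $ l))) = f'" using d by (rule has_derivative_unique)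
  then have "f' (upd (axis l 1) l (- axis l 1 $ l)) = f' (axis l 1)" by metis
  moreover have "upd (axis l 1) l (- axis l 1 $ l) = - axis l (1::real)"
    by (simp add: vec_eq_iff axis_def)
  ultimately have "f' (- axis l 1) = f' (axis l 1)" by simp
  then show ?thesis using linear_neg[OF has_derivative_linear[OF d], of "axis l 1"] by simp
qed

text \<open>In \<open>x = expv t\<close>, the functions in (1) are \<open>2 a_j / x_j\<close> and
  \<open>h_jj + a_j / x_j\<close>; both tend to twice the pure second derivative at
  \<open>x_j = 0\<close>, which explains the factor 2. The weight in (3) leaves exactly the mixed
  derivative, which evenness kills on both hyperplanes.\<close>

lemma growth_of_invariant_C2:
  fixes \<psi> :: "real^'n \<Rightarrow> real"
  assumes C2: "C2_fun \<psi>" and even: "\<And>l x. \<psi> (upd x l (- x $ l)) = \<psi> x"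
    and dG: "\<And>t. ((\<lambda>t. \<psi> (expv t)) has_derivative (\<lambda>v. \<Sum>j\<in>UNIV. A j t * v $ j)) (at t)"
    and dA: "\<And>j t. (A j has_derivative (\<lambda>v. \<Sum>k\<in>UNIV. B k j t * v $ k)) (at t)"
  shows "frame_growth A B"
proof -
  note D = C2_fun_dir_deriv[OF C2]
  define a where "a j x = dir_deriv \<psi> x (axis j 1)" for j x
  define h where "h k j x = hess \<psi> x (axis k 1) (axis j 1)" for k j x
  have ca: "continuous_on UNIV (a j)" and ch: "continuous_on UNIV (h k j)" for j k
    unfolding a_def h_def using C1_fun_continuous[OF D(2)] D(4) by blast+
  have sum_axis: "(\<Sum>j\<in>UNIV. c j * axis i 1 $ j) = c i" for c :: "'n \<Rightarrow> real" and i
    by (simp add: axis_def if_distrib cong: if_cong)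
  have dexp: "(expv has_derivative (\<lambda>v. \<chi> j. exp (t $ j) * v $ j)) (at t)" for t :: "real^'n"
    unfolding expv_def[abs_def] by (intro has_derivative_vec_lambda)
      (auto intro!: derivative_eq_intros bounded_linear_imp_has_derivative bounded_linear_vec_nth)
  have axis: "(\<chi> j. exp (t $ j) * axis i 1 $ j) = exp (t $ i) *\<^sub>R axis i 1" for t :: "real^'n" and i
    by (simp add: vec_eq_iff axis_def)
  have A: "A i t = exp (t $ i) * a i (expv t)" for i t
  proof -
    have "(\<lambda>v. \<Sum>j\<in>UNIV. A j t * v $ j) = (\<lambda>v. dir_deriv \<psi> (expv t) (\<chi> j. exp (t $ j) * v $ j))"
      by (rule has_derivative_unique[OF dG has_derivative_compose[OF dexp D(1)]])
    from fun_cong[OF this, of "axis i 1"] show ?thesis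
      unfolding sum_axis axis a_def
      using linear_cmul[OF has_derivative_linear[OF D(1)]] by (simp add: sum_axis)
  qed
  have B: "B k j t = exp (t $ k) * exp (t $ j) * h k j (expv t) + (if k = j then exp (t $ j) * a j (expv t) else 0)" for k j t
  proof -
    have "((\<lambda>t. a j (expv t)) has_derivative (\<lambda>v. hess \<psi> (expv t) (\<chi> j. exp (t $ j) * v $ j) (axis j 1))) (at t)"
      unfolding a_def by (rule has_derivative_compose[OF dexp D(3)])
    then have d: "((\<lambda>t. exp (t $ j) * a j (expv t)) has_derivative
        (\<lambda>v. exp (t $ j) * hess \<psi> (expv t) (\<chi> j. exp (t $ j) * v $ j) (axis j 1) + exp (t $ j) * v $ j * a j (expv t))) (at t)"
      by (auto intro!: derivative_eq_intros bounded_linear_imp_has_derivative bounded_linear_vec_nth)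
    have "A j = (\<lambda>t. exp (t $ j) * a j (expv t))" using A by blast
    from has_derivative_unique[OF dA d[folded this]] have "(\<lambda>v. \<Sum>k\<in>UNIV. B k j t * v $ k) = (\<lambda>v. exp (t $ j) * hess \<psi> (expv t) (\<chi> j. exp (t $ j) * v $ j) (axis j 1) + exp (t $ j) * v $ j * a j (expv t))" .
    from fun_cong[OF this, of "axis k 1"] show ?thesis
      unfolding sum_axis axis h_def
      using linear_cmul[OF has_derivative_linear[OF D(3)]] by (simp add: axis_def)
  qed
  \<comment> \<open>A partial derivative in another direction is again even in the
    \<open>l\<close>-th variable, so \<open>even_deriv_zero\<close> can be applied a second
    time.\<close>
  have even_a: "a j (upd x l (- x $ l)) = a j x" if "j \<noteq> l" for j l x
  proof -
    have "((\<lambda>x. \<psi> (upd x l (- x $ l))) has_derivative (\<lambda>v. dir_deriv \<psi> (upd x l (- x $ l)) (upd v l (- v $ l)))) (at x)"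
      by (rule has_derivative_compose[OF bounded_linear_imp_has_derivative[OF bounded_linear_flip] D(1)])
    then have "dir_deriv \<psi> x = (\<lambda>v. dir_deriv \<psi> (upd x l (- x $ l)) (upd v l (- v $ l)))"
      using has_derivative_unique[OF D(1)] by (simp add: even)
    from fun_cong[OF this, of "axis j 1"] have "a j x = dir_deriv \<psi> (upd x l (- x $ l)) (upd (axis j 1) l (- axis j 1 $ l))"
      by (simp add: a_def)
    moreover have "upd (axis j 1) l (- axis j 1 $ l) = axis j (1::real)"
      using that by (simp add: vec_eq_iff axis_def)
    ultimately show ?thesis by (simp add: a_def)
  qed
  have a0: "a l x = 0" if "x $ l = 0" for l x
    unfolding a_def by (rule even_deriv_zero[OF even D(1) that])
  have h0: "h l j x = 0" if "x $ l = 0" "j \<noteq> l" for l j x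
    unfolding h_def
    by (rule even_deriv_zero[OF _ D(3) that(1)]) (use even_a[OF that(2)] in \<open>simp add: a_def\<close>)
  have hc: "h k j x = h j k x" for k j x unfolding h_def by (rule hess_commute[OF C2])
  have full: "upd (expv t) l (exp (t $ l)) = expv t" for l t by (simp add: vec_eq_iff)
  \<comment> \<open>As \<open>a j\<close> vanishes on its hyperplane, its quotient by the
    \<open>j\<close>-th coordinate is a value of \<open>h j j\<close> at an intermediate
    point.\<close>
  have mvt: "\<exists>s. 0 \<le> s \<and> s \<le> exp (t $ j) \<and> exp (- t $ j) * a j (expv t) = h j j (upd (expv t) j s)" for j t
  proof -
    have eq: "upd (expv t) j = (\<lambda>s. upd (expv t) j 0 + s *\<^sub>R axis j 1)"
      by (simp add: fun_eq_iff vec_eq_iff axis_def)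
    have u: "(upd (expv t) j has_derivative (\<lambda>k. k *\<^sub>R axis j 1)) (at s)" for s
      by (subst eq) (auto intro!: derivative_eq_intros)
    have "((\<lambda>s. a j (upd (expv t) j s)) has_real_derivative h j j (upd (expv t) j s)) (at s)" for s
      using has_derivative_compose[OF u D(3)] linear_cmul[OF has_derivative_linear[OF D(3)]]
      by (simp add: a_def h_def has_field_derivative_def mult_commute_abs)
    from MVT2[OF exp_gt_zero[of "t $ j"] this] obtain s where s: "0 < s" "s < exp (t $ j)"
      "a j (upd (expv t) j (exp (t $ j))) - a j (upd (expv t) j 0) = (exp (t $ j) - 0) * h j j (upd (expv t) j s)"
      by auto
    then show ?thesis by (intro exI[of _ s]) (simp add: full a0 exp_minus)
  qed
  have lim_a: "lim_minf j (\<lambda>t. exp (- t $ j) * a j (expv t)) (\<lambda>t. h j j (upd (expv t) j 0))" for j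
    by (rule lim_minf_expv[OF ch mvt])
  have lim: "lim_minf l (\<lambda>t. \<rho> (expv t)) (\<lambda>t. \<rho> (upd (expv t) l 0))" if "continuous_on UNIV \<rho>" for \<rho> l
    by (rule lim_minf_expv[OF that]) (metis full exp_ge_zero order_refl)
  have ee: "exp (- 2 * r) * exp r = exp (- r)" for r :: real by (simp add: exp_add[symmetric])
  have ee2: "exp (- r - s) * (exp r * exp s) = 1" for r s :: real by (simp add: exp_add[symmetric])
  have ee3: "exp (- 2 * r) * (exp r * exp r) = 1" for r :: real by (simp add: exp_add[symmetric])
  have 1: "\<exists>\<Lambda>. lim_minf j (\<lambda>t. 2 * exp (- 2 * t $ j) * A j t) \<Lambda> \<and> lim_minf j (\<lambda>t. exp (- 2 * t $ j) * B j j t) \<Lambda>" for j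
  proof (intro exI conjI)
    have eq1: "2 * exp (- 2 * t $ j) * A j t = 2 * (exp (- t $ j) * a j (expv t))" for t
      unfolding A using ee[of "t $ j"] by (simp add: mult.assoc[symmetric])
    show "lim_minf j (\<lambda>t. 2 * exp (- 2 * t $ j) * A j t) (\<lambda>t. 2 * h j j (upd (expv t) j 0))"
      unfolding eq1 by (rule lim_minf_cmult[OF lim_a])
    have eq2: "exp (- 2 * t $ j) * B j j t = h j j (expv t) + exp (- t $ j) * a j (expv t)" for t
      unfolding B using ee[of "t $ j"] ee3[of "t $ j"] by (simp add: distrib_left mult.assoc[symmetric])
    show "lim_minf j (\<lambda>t. exp (- 2 * t $ j) * B j j t) (\<lambda>t. 2 * h j j (upd (expv t) j 0))"
      unfolding eq2 mult_2 using lim_minf_add[OF lim[OF ch, of j j j] lim_a] .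
  qed
  have 2: "\<exists>\<Lambda>. lim_minf l (B j k) \<Lambda>" for j k l
  proof -
    have "continuous_on UNIV (\<lambda>x. x $ j * x $ k * h j k x + (if j = k then x $ k * a k x else 0))"
      by (cases "j = k") (auto intro!: continuous_intros ca ch)
    from lim[OF this, of l] show ?thesis unfolding B[abs_def] expv_nth by blast
  qed
  have 3: "lim_minf j (\<lambda>t. exp (- t $ j - t $ k) * B j k t) (\<lambda>_. 0) \<and>
    lim_minf k (\<lambda>t. exp (- t $ j - t $ k) * B j k t) (\<lambda>_. 0)" if ne: "j \<noteq> k" for j k
  proof -
    have eq: "exp (- t $ j - t $ k) * B j k t = h j k (expv t)" for t
      unfolding B using ne ee2[of "t $ j" "t $ k"] by (simp add: mult.assoc[symmetric])
    have "h j k (upd x j 0) = 0" "h j k (upd x k 0) = 0" for x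
      using h0[of "upd x j 0" j k] h0[of "upd x k 0" k j] hc ne by auto
    then show ?thesis unfolding eq using lim[OF ch, of j j k] lim[OF ch, of k j k] by simp_all
  qed
  show ?thesis unfolding frame_growth_def using 1 2 3 by blast
qed

section \<open>Smooth complete fans\<close>

lemma int_lattice_0: "0 \<in> int_lattice"
  and int_lattice_add: "x \<in> int_lattice \<Longrightarrow> y \<in> int_lattice \<Longrightarrow> x + y \<in> int_lattice"
  and int_lattice_minus: "x \<in> int_lattice \<Longrightarrow> - x \<in> int_lattice"
  and int_lattice_diff: "x \<in> int_lattice \<Longrightarrow> y \<in> int_lattice \<Longrightarrow> x - y \<in> int_lattice"
  and int_lattice_scale: "x \<in> int_lattice \<Longrightarrow> of_int n *\<^sub>R x \<in> int_lattice"
  and int_lattice_axis: "axis i 1 \<in> int_lattice"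
  by (auto simp: int_lattice_def axis_def)

lemma int_lattice_sum: "(\<And>i. i \<in> I \<Longrightarrow> f i \<in> int_lattice) \<Longrightarrow> sum f I \<in> int_lattice"
  by (induction I rule: infinite_finite_induct) (auto intro: int_lattice_0 int_lattice_add)

lemma int_lattice_inner: "x \<in> int_lattice \<Longrightarrow> y \<in> int_lattice \<Longrightarrow> x \<bullet> y \<in> \<int>"
  by (auto simp: int_lattice_def inner_vec_def intro!: Ints_sum Ints_mult)

lemma floor_inner: "x \<in> int_lattice \<Longrightarrow> y \<in> int_lattice \<Longrightarrow> of_int \<lfloor>x \<bullet> y\<rfloor> = x \<bullet> y"
  using int_lattice_inner by (metis Ints_cases floor_of_int)

lemma floor_inner_add:
  "x \<in> int_lattice \<Longrightarrow> x' \<in> int_lattice \<Longrightarrow> y \<in> int_lattice \<Longrightarrow> \<lfloor>(x + x') \<bullet> y\<rfloor> = \<lfloor>x \<bullet> y\<rfloor> + \<lfloor>x' \<bullet> y\<rfloor>"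
  using int_lattice_inner by (metis Ints_cases floor_add_int floor_of_int inner_add_left)

section \<open>Dual lattice bases and the cones spanned by part of a basis\<close>

definition dual_basis :: "('n::finite \<Rightarrow> real^'n) \<Rightarrow> ('n \<Rightarrow> real^'n) \<Rightarrow> bool" where
  "dual_basis b d \<longleftrightarrow> (\<forall>j. d j \<in> int_lattice) \<and> (\<forall>x. x = (\<Sum>j\<in>UNIV. (d j \<bullet> x) *\<^sub>R b j)) \<and>
    (\<forall>j k. d j \<bullet> b k = (if j = k then 1 else 0))"

text \<open>The integer coordinates of the unit vectors form an integral matrix whose columns are
  the \<open>d j\<close>. Duality follows from uniqueness of the integer expansion of
  \<open>b k\<close>.\<close>

lemma zbasis_dual:
  fixes b :: "'n::finite \<Rightarrow> real^'n"
  assumes "zbasis b"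
  shows "\<exists>d. dual_basis b d"
proof -
  have "\<forall>i. \<exists>c :: 'n \<Rightarrow> int. axis i 1 = (\<Sum>j\<in>UNIV. of_int (c j) *\<^sub>R b j)"
    using assms int_lattice_axis unfolding zbasis_def by blast
  then obtain c :: "'n \<Rightarrow> 'n \<Rightarrow> int" where c: "\<And>i. axis i 1 = (\<Sum>j\<in>UNIV. of_int (c i j) *\<^sub>R b j)" by metis
  define d :: "'n \<Rightarrow> real^'n" where "d j = (\<chi> i. of_int (c i j))" for j
  have dl: "d j \<in> int_lattice" for j by (simp add: d_def int_lattice_def)
  have ex: "x = (\<Sum>j\<in>UNIV. (d j \<bullet> x) *\<^sub>R b j)" for x
  proof -
    have "x = (\<Sum>i\<in>UNIV. (x $ i) *\<^sub>R axis i 1)"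
      by (simp add: vec_eq_iff axis_def if_distrib cong: if_cong)
    also have "\<dots> = (\<Sum>i\<in>UNIV. \<Sum>j\<in>UNIV. (x $ i * of_int (c i j)) *\<^sub>R b j)"
      by (simp add: c scaleR_sum_right)
    also have "\<dots> = (\<Sum>j\<in>UNIV. \<Sum>i\<in>UNIV. (x $ i * of_int (c i j)) *\<^sub>R b j)" by (rule sum.swap)
    also have "\<dots> = (\<Sum>j\<in>UNIV. (d j \<bullet> x) *\<^sub>R b j)"
      by (simp add: d_def inner_vec_def scaleR_sum_left mult.commute)
    finally show ?thesis .
  qed
  have "d j \<bullet> b k = (if j = k then 1 else 0)" for j k
  proof -
    have bk: "b k \<in> int_lattice" using assms by (simp add: zbasis_def)
    have u: "\<exists>!c :: 'n \<Rightarrow> int. b k = (\<Sum>j\<in>UNIV. of_int (c j) *\<^sub>R b j)"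
      using assms bk unfolding zbasis_def by (elim conjE) (rule bspec)
    have 1: "b k = (\<Sum>j\<in>UNIV. of_int \<lfloor>d j \<bullet> b k\<rfloor> *\<^sub>R b j)"
      using ex[of "b k"] by (simp add: floor_inner[OF dl bk])
    have 2: "b k = (\<Sum>j\<in>UNIV. of_int (if j = k then 1 else 0) *\<^sub>R b j)"
      by (simp add: if_distrib[of of_int] if_distrib[of "\<lambda>x. x *\<^sub>R _"] cong: if_cong)
    have "(\<lambda>j. \<lfloor>d j \<bullet> b k\<rfloor>) = (\<lambda>j. if j = k then 1 else 0)"
      proof -
      have "y = y'" if "b k = (\<Sum>j\<in>UNIV. of_int (y j) *\<^sub>R b j)" "b k = (\<Sum>j\<in>UNIV. of_int (y' j) *\<^sub>R b j)"
        for y y' :: "'n \<Rightarrow> int" using u that by blast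
      from this[of "\<lambda>j. \<lfloor>d j \<bullet> b k\<rfloor>" "\<lambda>j. if j = k then 1 else 0", OF 1 2] show ?thesis .
    qed
    then have "\<lfloor>d j \<bullet> b k\<rfloor> = (if j = k then 1 else 0)" by (rule fun_cong)
    then show ?thesis using floor_inner[OF dl bk, of j] by (cases "j = k") auto
  qed
  with dl ex show ?thesis unfolding dual_basis_def by (intro exI[of _ d]) auto
qed

definition dualb :: "('n::finite \<Rightarrow> real^'n) \<Rightarrow> 'n \<Rightarrow> real^'n" where
  "dualb b = (SOME d. dual_basis b d)"

lemma
  assumes "zbasis b"
  shows dualb_lattice: "dualb b j \<in> int_lattice"
    and dualb_expand: "(\<Sum>j\<in>UNIV. (dualb b j \<bullet> x) *\<^sub>R b j) = x"
    and dualb_inner: "dualb b j \<bullet> b k = (if j = k then 1 else 0)"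
proof -
  have "dual_basis b (dualb b)" unfolding dualb_def by (rule someI_ex[OF zbasis_dual[OF assms]])
  then show "dualb b j \<in> int_lattice" "(\<Sum>j\<in>UNIV. (dualb b j \<bullet> x) *\<^sub>R b j) = x"
    "dualb b j \<bullet> b k = (if j = k then 1 else 0)" by (simp_all add: dual_basis_def)
qed

lemma zbasis_lattice: "zbasis b \<Longrightarrow> b j \<in> int_lattice"
  by (simp add: zbasis_def)

lemma zbasis_inner_expand:
  assumes "zbasis b"
  shows "u \<bullet> x = (\<Sum>j\<in>UNIV. (dualb b j \<bullet> x) * (u \<bullet> b j))"
  by (subst (1) dualb_expand[OF assms, of x, symmetric]) (simp add: inner_sum_right)

definition frame_pt :: "('n::finite \<Rightarrow> real^'n) \<Rightarrow> real^'n \<Rightarrow> real^'n" where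
  "frame_pt b t = (\<Sum>j\<in>UNIV. (t $ j) *\<^sub>R b j)"

lemma frame_coords:
  assumes "zbasis b"
  shows "dualb b j \<bullet> frame_pt b t = t $ j"
  by (simp add: frame_pt_def inner_sum_right dualb_inner[OF assms] if_distrib cong: if_cong)

lemma dual_expand:
  assumes "zbasis b"
  shows "(\<Sum>j\<in>UNIV. (u \<bullet> b j) *\<^sub>R dualb b j) = u"
proof -
  have "(\<Sum>j\<in>UNIV. (u \<bullet> b j) *\<^sub>R dualb b j) \<bullet> x = u \<bullet> x" for x
    unfolding zbasis_inner_expand[OF assms, of u x] by (simp add: inner_sum_left mult.commute)
  then show ?thesis by (subst vector_eq_rdot[symmetric]) blast
qed

lemma zbasis_axis: "zbasis (\<lambda>i. axis i 1)"
  unfolding zbasis_def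
proof (intro conjI allI ballI int_lattice_axis)
  fix x :: "real^'a" assume x: "x \<in> int_lattice"
  have sum: "(\<Sum>i\<in>UNIV. of_int (c i) *\<^sub>R (axis i 1 :: real^'a)) $ k = of_int (c k)" for c :: "'a \<Rightarrow> int" and k
    by (simp add: axis_def if_distrib cong: if_cong)
  show "\<exists>!c :: 'a \<Rightarrow> int. x = (\<Sum>i\<in>UNIV. of_int (c i) *\<^sub>R axis i 1)"
  proof (rule ex1I[of _ "\<lambda>i. \<lfloor>x $ i\<rfloor>"])
    show "x = (\<Sum>i\<in>UNIV. of_int \<lfloor>x $ i\<rfloor> *\<^sub>R axis i 1)"
      unfolding vec_eq_iff sum using x by (metis (mono_tags, lifting) Ints_cases floor_of_int int_lattice_def mem_Collect_eq)
    show "c = (\<lambda>i. \<lfloor>x $ i\<rfloor>)" if "x = (\<Sum>i\<in>UNIV. of_int (c i) *\<^sub>R axis i 1)" for c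
      unfolding that sum by simp
  qed
qed

lemma cone_hull_sum:
  assumes "\<And>i. i \<in> I \<Longrightarrow> f i \<in> convex_cone hull S"
  shows "sum f I \<in> convex_cone hull S"
  using assms
  by (induction I rule: infinite_finite_induct) (auto intro: convex_cone_hull_add convex_cone_hull_contains_0)

lemma cone_hull_basis:
  assumes "zbasis b"
  shows "convex_cone hull (b ` J) =
    {x. (\<forall>j. 0 \<le> dualb b j \<bullet> x) \<and> (\<forall>j. j \<notin> J \<longrightarrow> dualb b j \<bullet> x = 0)}" (is "_ = ?R")
proof
  have "convex_cone ?R"
    unfolding convex_cone_iff by (auto simp: inner_add_right)
  then show "convex_cone hull (b ` J) \<subseteq> ?R"
    by (intro hull_minimal) (auto simp: dualb_inner[OF assms])
  show "?R \<subseteq> convex_cone hull (b ` J)"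
  proof
    fix x assume x: "x \<in> ?R"
    have "(\<Sum>j\<in>UNIV. (dualb b j \<bullet> x) *\<^sub>R b j) \<in> convex_cone hull (b ` J)"
    proof (rule cone_hull_sum)
      fix j
      show "(dualb b j \<bullet> x) *\<^sub>R b j \<in> convex_cone hull (b ` J)"
        using x by (cases "j \<in> J") (auto intro!: convex_cone_hull_mul hull_inc[of "b j"] convex_cone_hull_contains_0)
    qed
    then show "x \<in> convex_cone hull (b ` J)" by (simp add: dualb_expand[OF assms])
  qed
qed

lemma fcone_iff: "zbasis b \<Longrightarrow> x \<in> fcone b \<longleftrightarrow> (\<forall>j. 0 \<le> dualb b j \<bullet> x)"
  unfolding fcone_def using cone_hull_basis[of b UNIV] by auto

section \<open>Cones, frames and rays of a smooth complete fan\<close>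

locale smooth_complete_fan =
  fixes \<Sigma> :: "(real^'n) set set"
  assumes smooth: "smooth_fan \<Sigma>" and complete: "complete_fan \<Sigma>"
begin

lemma fan: "fan \<Sigma>" using smooth by (simp add: smooth_fan_def)

lemma cone_convex_cone: "\<sigma> \<in> \<Sigma> \<Longrightarrow> convex_cone \<sigma>"
  using fan unfolding fan_def by (metis convex_cone_convex_cone_hull)

lemma cone_0: "\<sigma> \<in> \<Sigma> \<Longrightarrow> 0 \<in> \<sigma>"
  using cone_convex_cone convex_cone_contains_0 by blast

lemma cone_scale: "\<sigma> \<in> \<Sigma> \<Longrightarrow> x \<in> \<sigma> \<Longrightarrow> 0 \<le> c \<Longrightarrow> c *\<^sub>R x \<in> \<sigma>"
  using cone_convex_cone[of \<sigma>] by (simp add: convex_cone_iff)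

lemma cone_face: "\<sigma> \<in> \<Sigma> \<Longrightarrow> \<tau> face_of \<sigma> \<Longrightarrow> \<tau> \<noteq> {} \<Longrightarrow> \<tau> \<in> \<Sigma>"
  using fan by (simp add: fan_def)

lemma cone_Int: "\<sigma> \<in> \<Sigma> \<Longrightarrow> \<sigma>' \<in> \<Sigma> \<Longrightarrow> \<sigma> \<inter> \<sigma>' \<in> \<Sigma>"
proof -
  assume \<sigma>: "\<sigma> \<in> \<Sigma>" and \<sigma>': "\<sigma>' \<in> \<Sigma>"
  then have "\<sigma> \<inter> \<sigma>' face_of \<sigma>" using fan by (simp add: fan_def)
  moreover have "0 \<in> \<sigma> \<inter> \<sigma>'" using cone_0 \<sigma> \<sigma>' by blast
  ultimately show ?thesis using cone_face[OF \<sigma>] by blast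
qed

text \<open>\<open>p + q\<close> is the midpoint of \<open>2 *\<^sub>R p\<close> and
  \<open>2 *\<^sub>R q\<close>, and a face contains the endpoints of a segment once it contains an
  inner point.\<close>

lemma cone_summand:
  assumes "\<sigma> \<in> \<Sigma>" "\<sigma>' \<in> \<Sigma>" "p \<in> \<sigma>" "q \<in> \<sigma>" "p + q \<in> \<sigma>'"
  shows "p \<in> \<sigma>'"
proof -
  have f: "\<sigma> \<inter> \<sigma>' face_of \<sigma>" using fan assms(1,2) by (simp add: fan_def)
  have pq: "p + q \<in> \<sigma> \<inter> \<sigma>'"
    using assms cone_convex_cone[OF assms(1)] by (simp add: convex_cone_iff)
  have "2 *\<^sub>R p \<in> \<sigma> \<inter> \<sigma>'"
  \<comment> \<open>For \<open>p = q\<close> the open segment is empty.\<close>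
  proof (cases "p = q")
    case True then show ?thesis using pq by (simp add: scaleR_2)
  next
    case False
    have "p + q = (1 - 1/2) *\<^sub>R (2 *\<^sub>R p) + (1/2) *\<^sub>R (2 *\<^sub>R q)" by simp
    then have "p + q \<in> open_segment (2 *\<^sub>R p) (2 *\<^sub>R q)"
      using False unfolding in_segment by (intro conjI exI[of _ "1/2"]) auto
    then show ?thesis
      using f pq cone_scale[OF assms(1,3), of 2] cone_scale[OF assms(1,4), of 2] unfolding face_of_def by auto
  qed
  then show ?thesis using cone_scale[OF assms(2), of "2 *\<^sub>R p" "1/2"] by simp
qed

lemma frame_zbasis: "b \<in> frames \<Sigma> \<Longrightarrow> zbasis b"
  by (simp add: frames_def)

lemma frame_cone: "b \<in> frames \<Sigma> \<Longrightarrow> fcone b \<in> \<Sigma>"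
  by (simp add: frames_def fcone_def)

text \<open>Cones on a proper part of a basis lie in hyperplanes. By completeness they cover the
  complement of the closed union of the full cones; this complement is open and negligible, hence
  empty.\<close>

lemma cone_in_frame:
  assumes "\<sigma> \<in> \<Sigma>"
  shows "\<exists>b\<in>frames \<Sigma>. \<sigma> \<subseteq> fcone b"
proof -
  let ?T = "\<Union>(fcone ` frames \<Sigma>)" and ?S = "{\<sigma> \<in> \<Sigma>. negligible \<sigma>}"
  have fin: "finite \<Sigma>" using fan by (simp add: fan_def)
  have "negligible (\<Union>?S)" using fin by (intro negligible_Union) auto
  moreover have "- ?T \<subseteq> \<Union>?S"
  proof
    fix x assume x: "x \<in> - ?T"
    obtain \<sigma> where \<sigma>: "\<sigma> \<in> \<Sigma>" "x \<in> \<sigma>" using complete unfolding complete_fan_def by blast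
    obtain b J where b: "zbasis b" "\<sigma> = convex_cone hull (b ` J)"
      using smooth \<sigma>(1) unfolding smooth_fan_def by blast
    show "x \<in> \<Union>?S"
    proof (cases "J = UNIV")
      case True
      then have "b \<in> frames \<Sigma>" "\<sigma> = fcone b" using b \<sigma> by (auto simp: frames_def fcone_def)
      with x \<sigma> show ?thesis by blast
    next
      case False
      then obtain j where j: "j \<notin> J" by blast
      have "dualb b j \<noteq> 0" using dualb_inner[OF b(1), of j j] by auto
      then have "negligible {x. dualb b j \<bullet> x = 0}" by (intro negligible_hyperplane) auto
      moreover have "\<sigma> \<subseteq> {x. dualb b j \<bullet> x = 0}" using j unfolding b(2) cone_hull_basis[OF b(1)] by auto
      ultimately have "negligible \<sigma>" by (rule negligible_subset)
      with \<sigma> show ?thesis by blast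
    qed
  qed
  ultimately have "negligible (- ?T)" by (rule negligible_subset)
  moreover have "open (- ?T)"
  proof -
    have "finite (fcone ` frames \<Sigma>)" by (rule finite_subset[OF _ fin]) (auto intro: frame_cone)
    moreover have "closed (fcone b)" for b :: "'n \<Rightarrow> real^'n" unfolding fcone_def by (intro closed_convex_cone_hull) auto
    ultimately have "closed ?T" by (intro closed_Union) auto
    then show ?thesis by (rule open_Compl)
  qed
  ultimately have T: "?T = UNIV" using open_not_negligible by blast
  obtain b J where b: "zbasis b" "\<sigma> = convex_cone hull (b ` J)"
    using smooth assms unfolding smooth_fan_def by blast
  \<comment> \<open>A full cone that contains the sum of the generators contains each of them, by
    \<open>cone_summand\<close>.\<close>
  obtain b' where b': "b' \<in> frames \<Sigma>" "(\<Sum>j\<in>J. b j) \<in> fcone b'" using T by blast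
  have "b j \<in> fcone b'" if "j \<in> J" for j
  proof (rule cone_summand[OF assms frame_cone[OF b'(1)]])
    show "b j \<in> \<sigma>" using that b by (auto intro: hull_inc)
    show "(\<Sum>j\<in>J - {j}. b j) \<in> \<sigma>" unfolding b(2) by (intro cone_hull_sum hull_inc) auto
    show "b j + (\<Sum>j\<in>J - {j}. b j) \<in> fcone b'" using b'(2) that by (simp add: sum.remove[symmetric])
  qed
  then have "\<sigma> \<subseteq> fcone b'"
    unfolding b(2) fcone_def by (intro hull_minimal convex_cone_convex_cone_hull) auto
  with b' show ?thesis by blast
qed

text \<open>Inside the full cone \<open>x\<close> splits into its component along \<open>b j\<close>
  and the rest, so \<open>cone_summand\<close> puts a positive multiple of \<open>b j\<close> into
  \<open>\<tau>\<close>.\<close>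

lemma generator_in_cone:
  assumes "b \<in> frames \<Sigma>" "\<tau> \<in> \<Sigma>" "x \<in> \<tau>" "x \<in> fcone b" "dualb b j \<bullet> x \<noteq> 0"
  shows "b j \<in> \<tau>"
proof -
  note zb = frame_zbasis[OF assms(1)]
  let ?c = "dualb b j \<bullet> x"
  have c: "?c > 0" using assms(4,5) fcone_iff[OF zb] by (metis order_le_less)
  have "?c *\<^sub>R b j \<in> \<tau>"
  proof (rule cone_summand[OF frame_cone[OF assms(1)] assms(2)])
    show "?c *\<^sub>R b j \<in> fcone b" using c by (simp add: fcone_iff[OF zb] dualb_inner[OF zb])
    show "x - ?c *\<^sub>R b j \<in> fcone b"
      using assms(4) by (simp add: fcone_iff[OF zb] inner_diff_right dualb_inner[OF zb])
  qed (simp add: assms)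
  from cone_scale[OF assms(2) this, of "1 / ?c"] c show ?thesis by simp
qed

text \<open>The sum of the dual vectors outside \<open>J\<close> is nonnegative on the full cone and
  vanishes there exactly on the part spanned by \<open>J\<close>, which is therefore a face.\<close>

lemma subcone_of_frame:
  assumes "b \<in> frames \<Sigma>"
  shows "convex_cone hull (b ` J) \<in> \<Sigma>"
proof -
  note zb = frame_zbasis[OF assms]
  let ?a = "\<Sum>k\<in>- J. dualb b k"
  have "fcone b \<inter> {x. ?a \<bullet> x = 0} face_of fcone b"
  proof (rule face_of_Int_supporting_hyperplane_ge)
    show "convex (fcone b)" unfolding fcone_def by (rule convex_convex_cone_hull)
  qed (auto simp: fcone_iff[OF zb] inner_sum_left intro: sum_nonneg)
  moreover have "fcone b \<inter> {x. ?a \<bullet> x = 0} = convex_cone hull (b ` J)"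
    unfolding cone_hull_basis[OF zb] by (auto simp: fcone_iff[OF zb] inner_sum_left sum_nonneg_eq_0_iff)
  ultimately show ?thesis
    using cone_face[OF frame_cone[OF assms]] convex_cone_hull_nonempty by metis
qed

lemma zero_cone: "{0} \<in> \<Sigma>"
proof -
  obtain \<sigma> where "\<sigma> \<in> \<Sigma>" using fan by (auto simp: fan_def)
  then obtain b where "b \<in> frames \<Sigma>" using cone_in_frame by blast
  from subcone_of_frame[OF this, of "{}"] show ?thesis by simp
qed

lemma frame_ray:
  assumes "b \<in> frames \<Sigma>"
  shows "b j \<in> rays \<Sigma>"
proof -
  note zb = frame_zbasis[OF assms]
  have "primitive (b j)" unfolding primitive_def
  proof (intro conjI ballI allI impI)
    show "b j \<noteq> 0" using dualb_inner[OF zb, of j j] by auto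
    fix u :: "real^'n" and k :: nat assume u: "u \<in> int_lattice" and eq: "b j = real k *\<^sub>R u"
    have "1 = real k * (dualb b j \<bullet> u)" using dualb_inner[OF zb, of j j] eq by simp
    also have "\<dots> = of_int (int k * \<lfloor>dualb b j \<bullet> u\<rfloor>)"
      by (simp only: of_int_mult of_int_of_nat_eq floor_inner[OF dualb_lattice[OF zb] u])
    finally have "int k * \<lfloor>dualb b j \<bullet> u\<rfloor> = 1" by linarith
    then show "k = 1" by (auto simp: zmult_eq_1_iff)
  qed (rule zbasis_lattice[OF zb])
  then show ?thesis using subcone_of_frame[OF assms, of "{j}"] by (simp add: rays_def)
qed

text \<open>A generator \<open>b j\<close> with nonzero coefficient in \<open>v\<close> lies on the
  ray of \<open>v\<close>, so \<open>b j = s *\<^sub>R v\<close>. Pairing with the dual vector makes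
  \<open>1 / s\<close> an integer, and primitivity of \<open>v\<close> forces it to be 1.\<close>

lemma ray_in_frame:
  assumes "b \<in> frames \<Sigma>" "v \<in> rays \<Sigma>" "v \<in> fcone b"
  shows "\<exists>j. v = b j"
proof -
  note zb = frame_zbasis[OF assms(1)]
  have v: "primitive v" "convex_cone hull {v} \<in> \<Sigma>" using assms(2) by (auto simp: rays_def)
  then have "v \<noteq> 0" by (simp add: primitive_def)
  then obtain j where j: "dualb b j \<bullet> v \<noteq> 0" using dualb_expand[OF zb, of v]
    by (metis (mono_tags, lifting) scaleR_zero_left sum.neutral)
  have "b j \<in> convex_cone hull {v}"
    by (rule generator_in_cone[OF assms(1) v(2) _ assms(3) j]) (auto intro: hull_inc)
  moreover have "convex_cone {s *\<^sub>R v | s. 0 \<le> s}"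
    unfolding convex_cone_iff
  proof (intro conjI ballI allI impI)
    show "0 \<in> {s *\<^sub>R v | s. 0 \<le> s}" by (auto intro!: exI[of _ 0])
    fix x y assume "x \<in> {s *\<^sub>R v | s. 0 \<le> s}" "y \<in> {s *\<^sub>R v | s. 0 \<le> s}"
    then obtain s s' where "x = s *\<^sub>R v" "y = s' *\<^sub>R v" "0 \<le> s" "0 \<le> s'" by blast
    then show "x + y \<in> {s *\<^sub>R v | s. 0 \<le> s}"
      by (auto simp: scaleR_left_distrib intro!: exI[of _ "s + s'"])
  next
    fix x and c :: real assume "x \<in> {s *\<^sub>R v | s. 0 \<le> s}" "0 \<le> c"
    then obtain s where "x = s *\<^sub>R v" "0 \<le> s" by blast
    then show "c *\<^sub>R x \<in> {s *\<^sub>R v | s. 0 \<le> s}"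
      using \<open>0 \<le> c\<close> by (auto intro!: exI[of _ "c * s"])
  qed
  then have "convex_cone hull {v} \<subseteq> {s *\<^sub>R v | s. 0 \<le> s}"
    by (intro hull_minimal) (auto intro!: exI[of _ 1])
  ultimately obtain s where s: "0 \<le> s" "b j = s *\<^sub>R v" by blast
  let ?N = "\<lfloor>dualb b j \<bullet> v\<rfloor>"
  have N: "of_int ?N = dualb b j \<bullet> v"
    using floor_inner[OF dualb_lattice[OF zb]] v(1) by (auto simp: primitive_def)
  have sN: "s * of_int ?N = 1" unfolding N using dualb_inner[OF zb, of j j] s(2) by simp
  then have "s * of_int ?N > 0" by simp
  then have "of_int ?N > (0::real)" using s(1) by (simp only: zero_less_mult_iff) linarith
  then have N0: "?N > 0" by simp
  have "v = (s * of_int ?N) *\<^sub>R v" using sN by simp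
  also have "\<dots> = real (nat ?N) *\<^sub>R b j" using N0 by (simp add: s(2) mult.commute)
  finally have "v = real (nat ?N) *\<^sub>R b j" .
  then have "nat ?N = 1" using v(1) zbasis_lattice[OF zb] unfolding primitive_def by blast
  with \<open>v = real (nat ?N) *\<^sub>R b j\<close> show ?thesis by auto
qed

lemma local_data_frame:
  assumes "b \<in> frames \<Sigma>"
  shows "m \<in> local_data \<Sigma> a (fcone b) \<longleftrightarrow> m \<in> int_lattice \<and> (\<forall>j. m \<bullet> b j = of_int (a (b j)))"
proof -
  have "b j \<in> rays \<Sigma> \<inter> fcone b" for j
    using frame_ray[OF assms] by (auto simp: fcone_def intro: hull_inc)
  then show ?thesis using ray_in_frame[OF assms] unfolding local_data_def by blast
qed

lemma local_data_frame_ex: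
  assumes "b \<in> frames \<Sigma>"
  shows "\<exists>m. m \<in> local_data \<Sigma> a (fcone b)"
proof -
  note zb = frame_zbasis[OF assms]
  have "(\<Sum>j\<in>UNIV. of_int (a (b j)) *\<^sub>R dualb b j) \<bullet> b k = of_int (a (b k))" for k
    by (simp add: inner_sum_left dualb_inner[OF zb] if_distrib cong: if_cong)
  then have "(\<Sum>j\<in>UNIV. of_int (a (b j)) *\<^sub>R dualb b j) \<in> local_data \<Sigma> a (fcone b)"
    unfolding local_data_frame[OF assms]
    by (auto intro!: int_lattice_sum int_lattice_scale dualb_lattice[OF zb])
  then show ?thesis by blast
qed

text \<open>A primitive vector is nonzero, so the zero cone imposes no condition: over the open
  orbit \<open>e_0 = 1\<close> is a frame for every \<open>a\<close>.\<close>

lemma zero_local_data: "0 \<in> local_data \<Sigma> a {0}"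
  by (auto simp: local_data_def rays_def primitive_def int_lattice_0)

text \<open>Both vectors take the prescribed values on the generators of \<open>\<tau>\<close>, so
  their difference vanishes on \<open>\<tau>\<close>. By symmetry the negative belongs to the monoid
  too, and the transition function is invertible.\<close>

lemma local_data_diff:
  assumes "\<tau> \<in> \<Sigma>" "\<tau> \<subseteq> \<sigma>" "\<tau> \<subseteq> \<sigma>'" "m \<in> local_data \<Sigma> a \<sigma>" "m' \<in> local_data \<Sigma> a \<sigma>'"
  shows "m' - m \<in> dual_monoid \<tau>"
proof -
  obtain b where b: "b \<in> frames \<Sigma>" "\<tau> \<subseteq> fcone b" using cone_in_frame[OF assms(1)] by blast
  note zb = frame_zbasis[OF b(1)]
  have "(m' - m) \<bullet> x = 0" if x: "x \<in> \<tau>" for x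
  proof -
    have "(dualb b j \<bullet> x) * ((m' - m) \<bullet> b j) = 0" for j
    proof (cases "dualb b j \<bullet> x = 0")
      case False
      then have "b j \<in> \<tau>" using generator_in_cone[OF b(1) assms(1) x _ False] b(2) x by blast
      then have "m \<bullet> b j = of_int (a (b j))" "m' \<bullet> b j = of_int (a (b j))"
        using assms frame_ray[OF b(1)] by (auto simp: local_data_def)
      then show ?thesis by (simp add: inner_diff_left)
    qed simp
    then show ?thesis unfolding zbasis_inner_expand[OF zb, of "m' - m" x] by (intro sum.neutral) auto
  qed
  then show ?thesis using assms(4,5) by (auto simp: dual_monoid_def local_data_def intro: int_lattice_diff)
qed

end

section \<open>Gluing\<close>

lemma dual_monoid_lattice: "m \<in> dual_monoid \<sigma> \<Longrightarrow> m \<in> int_lattice"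
  and dual_monoid_0: "0 \<in> dual_monoid \<sigma>"
  and dual_monoid_add: "m \<in> dual_monoid \<sigma> \<Longrightarrow> m' \<in> dual_monoid \<sigma> \<Longrightarrow> m + m' \<in> dual_monoid \<sigma>"
  and dual_monoid_antimono: "\<tau> \<subseteq> \<sigma> \<Longrightarrow> dual_monoid \<sigma> \<subseteq> dual_monoid \<tau>"
  and dual_monoid_zero_cone: "dual_monoid {0} = int_lattice"
  by (auto simp: dual_monoid_def int_lattice_0 int_lattice_add inner_add_left)

lemma dual_monoid_sum: "(\<And>i. i \<in> I \<Longrightarrow> f i \<in> dual_monoid \<sigma>) \<Longrightarrow> sum f I \<in> dual_monoid \<sigma>"
  by (induction I rule: infinite_finite_induct) (auto intro: dual_monoid_0 dual_monoid_add)

lemma affine_pts_0: "\<gamma> \<in> affine_pts \<sigma> \<Longrightarrow> \<gamma> 0 = 1"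
  and affine_pts_add: "\<gamma> \<in> affine_pts \<sigma> \<Longrightarrow> m \<in> dual_monoid \<sigma> \<Longrightarrow> m' \<in> dual_monoid \<sigma> \<Longrightarrow> \<gamma> (m + m') = \<gamma> m * \<gamma> m'"
  and affine_pts_ext: "\<gamma> \<in> affine_pts \<sigma> \<Longrightarrow> \<gamma> \<in> extensional (dual_monoid \<sigma>)"
  by (auto simp: affine_pts_def)

lemma affine_pts_sum:
  assumes "\<gamma> \<in> affine_pts \<sigma>" "\<And>i. i \<in> I \<Longrightarrow> f i \<in> dual_monoid \<sigma>"
  shows "\<gamma> (sum f I) = (\<Prod>i\<in>I. \<gamma> (f i))"
  using assms(2)
  by (induction I rule: infinite_finite_induct)
     (auto simp: affine_pts_0[OF assms(1)] affine_pts_add[OF assms(1)] dual_monoid_sum)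

lemma affine_pts_nonzero:
  assumes "\<gamma> \<in> affine_pts \<sigma>" "m \<in> dual_monoid \<sigma>" "- m \<in> dual_monoid \<sigma>"
  shows "\<gamma> m \<noteq> 0"
  using affine_pts_add[OF assms] affine_pts_0[OF assms(1)] by auto

lemma affine_pts_restrict:
  assumes "\<delta> \<in> affine_pts \<tau>" "\<tau> \<subseteq> \<sigma>"
  shows "restrict \<delta> (dual_monoid \<sigma>) \<in> affine_pts \<sigma>"
proof -
  have "m \<in> dual_monoid \<tau>" if "m \<in> dual_monoid \<sigma>" for m
    using that dual_monoid_antimono[OF assms(2)] by blast
  then show ?thesis
    using affine_pts_0[OF assms(1)] affine_pts_add[OF assms(1)]
    by (auto simp: affine_pts_def dual_monoid_0 dual_monoid_add)
qed

lemma affine_pts_powi: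
  assumes \<gamma>: "\<gamma> \<in> affine_pts \<sigma>" and d: "d \<in> dual_monoid \<sigma>" and n: "0 \<le> n \<or> - d \<in> dual_monoid \<sigma>"
  shows "of_int n *\<^sub>R d \<in> dual_monoid \<sigma> \<and> \<gamma> (of_int n *\<^sub>R d) = \<gamma> d powi n"
proof -
  have nat: "of_nat k *\<^sub>R e \<in> dual_monoid \<sigma> \<and> \<gamma> (of_nat k *\<^sub>R e) = \<gamma> e ^ k" if "e \<in> dual_monoid \<sigma>" for k e
    by (induction k)
       (auto simp: scaleR_left_distrib dual_monoid_0 affine_pts_0[OF \<gamma>] affine_pts_add[OF \<gamma> that] that intro: dual_monoid_add)
  show ?thesis
  proof (cases "0 \<le> n")
    case True
    then show ?thesis using nat[OF d, of "nat n"] by (simp add: power_int_def)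
  next
    case False
    then have md: "- d \<in> dual_monoid \<sigma>" using n by blast
    have "\<gamma> d * \<gamma> (- d) = 1" using affine_pts_add[OF \<gamma> d md] affine_pts_0[OF \<gamma>] by simp
    then have "\<gamma> (- d) = inverse (\<gamma> d)" by (metis inverse_unique)
    then show ?thesis using nat[OF md, of "nat (- n)"] False by (simp add: power_int_def)
  qed
qed

text \<open>If \<open>b j\<close> lies in \<open>\<tau>\<close> the exponent is nonnegative;
  otherwise the character \<open>dualb b j\<close> is invertible. Hence \<open>powi\<close> never
  meets a negative power of 0.\<close>

lemma affine_pts_formula:
  fixes b :: "'n::finite \<Rightarrow> real^'n"
  assumes zb: "zbasis b" and \<gamma>: "\<gamma> \<in> affine_pts \<tau>" and d: "\<And>j. dualb b j \<in> dual_monoid \<tau>"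
    and alt: "\<And>j. b j \<in> \<tau> \<or> - dualb b j \<in> dual_monoid \<tau>" and u: "u \<in> dual_monoid \<tau>"
  shows "\<gamma> u = (\<Prod>j\<in>UNIV. \<gamma> (dualb b j) powi \<lfloor>u \<bullet> b j\<rfloor>)"
proof -
  have n: "0 \<le> \<lfloor>u \<bullet> b j\<rfloor> \<or> - dualb b j \<in> dual_monoid \<tau>" for j
    using alt[of j] u by (auto simp: dual_monoid_def)
  have "u = (\<Sum>j\<in>UNIV. of_int \<lfloor>u \<bullet> b j\<rfloor> *\<^sub>R dualb b j)"
    by (simp only: floor_inner[OF dual_monoid_lattice[OF u] zbasis_lattice[OF zb]] dual_expand[OF zb])
  then have "\<gamma> u = (\<Prod>j\<in>UNIV. \<gamma> (of_int \<lfloor>u \<bullet> b j\<rfloor> *\<^sub>R dualb b j))"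
    using affine_pts_sum[OF \<gamma>, of UNIV "\<lambda>j. of_int \<lfloor>u \<bullet> b j\<rfloor> *\<^sub>R dualb b j"] affine_pts_powi[OF \<gamma> d n]
    by metis
  then show ?thesis by (simp add: affine_pts_powi[OF \<gamma> d n])
qed

definition torus_pt :: "('n::finite \<Rightarrow> real^'n) \<Rightarrow> complex^'n \<Rightarrow> real^'n \<Rightarrow> complex" where
  "torus_pt b z = restrict (\<lambda>m. \<Prod>j\<in>UNIV. (z $ j) powi \<lfloor>m \<bullet> b j\<rfloor>) (dual_monoid {0})"

lemma orbit_hom_eq: "orbit_hom = torus_pt (\<lambda>i. axis i 1)"
  by (simp add: orbit_hom_def torus_pt_def fun_eq_iff inner_axis)

lemma torus_pt_affine:
  assumes "zbasis b" "\<And>j. z $ j \<noteq> 0"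
  shows "torus_pt b z \<in> affine_pts {0}"
  using assms(2)
  by (auto simp: affine_pts_def torus_pt_def dual_monoid_zero_cone int_lattice_0 int_lattice_add
      floor_inner_add zbasis_lattice[OF assms(1)] power_int_add prod.distrib)

lemma affine_torus_pt:
  assumes zb: "zbasis b" and \<gamma>: "\<gamma> \<in> affine_pts {0}"
  shows "\<gamma> = torus_pt b (\<chi> j. \<gamma> (dualb b j))" and "\<gamma> (dualb b j) \<noteq> 0"
proof -
  have d: "dualb b j \<in> dual_monoid {0}" "- dualb b j \<in> dual_monoid {0}" for j
    by (auto simp: dual_monoid_zero_cone dualb_lattice[OF zb] intro: int_lattice_minus)
  show "\<gamma> (dualb b j) \<noteq> 0" using affine_pts_nonzero[OF \<gamma> d] .
  have "torus_pt b (\<chi> j. \<gamma> (dualb b j)) \<in> extensional (dual_monoid {0})" by (simp add: torus_pt_def)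
  then show "\<gamma> = torus_pt b (\<chi> j. \<gamma> (dualb b j))"
  proof (rule extensionalityI[OF affine_pts_ext[OF \<gamma>]])
    show "\<gamma> m = torus_pt b (\<chi> j. \<gamma> (dualb b j)) m" if "m \<in> dual_monoid {0}" for m
      using affine_pts_formula[OF zb \<gamma> d(1) _ that] d(2) that by (simp add: torus_pt_def)
  qed
qed

lemma restrict_torus_pt:
  "restrict (torus_pt b z) (dual_monoid (fcone b)) = chart b z"
proof
  fix m
  have "0 \<le> m \<bullet> b j" if "m \<in> dual_monoid (fcone b)" for j
    using that by (auto simp: dual_monoid_def fcone_def intro: hull_inc)
  then show "restrict (torus_pt b z) (dual_monoid (fcone b)) m = chart b z m"
    by (auto simp: chart_def torus_pt_def restrict_def dual_monoid_zero_cone power_int_nonneg_exp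
        dest: dual_monoid_lattice)
qed

text \<open>The exponential of N_R into the open orbit, written by characters so that it does not
  refer to a basis.\<close>

definition real_pt :: "real^'n \<Rightarrow> real^'n \<Rightarrow> complex" where
  "real_pt \<xi> = restrict (\<lambda>m. of_real (exp (m \<bullet> \<xi>))) (dual_monoid {0})"

lemma torus_pt_real:
  assumes zb: "zbasis b"
  shows "torus_pt b (\<chi> j. of_real (exp (dualb b j \<bullet> \<xi>))) = real_pt \<xi>"
proof
  fix m
  have "(\<Prod>j\<in>UNIV. complex_of_real (exp (dualb b j \<bullet> \<xi>)) powi \<lfloor>m \<bullet> b j\<rfloor>) = of_real (exp (m \<bullet> \<xi>))"
    if "m \<in> int_lattice"
  proof -
    have "exp (dualb b j \<bullet> \<xi>) powi \<lfloor>m \<bullet> b j\<rfloor> = exp ((dualb b j \<bullet> \<xi>) * (m \<bullet> b j))" for j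
      using exp_power_int[of "dualb b j \<bullet> \<xi>" "\<lfloor>m \<bullet> b j\<rfloor>"]
      by (simp only: floor_inner[OF that zbasis_lattice[OF zb]] mult.commute)
    then show ?thesis
      by (simp add: of_real_power_int[symmetric] of_real_prod[symmetric] exp_sum[symmetric]
          zbasis_inner_expand[OF zb, of m \<xi>] del: of_real_power_int of_real_prod of_real_exp)
  qed
  then show "torus_pt b (\<chi> j. of_real (exp (dualb b j \<bullet> \<xi>))) m = real_pt \<xi> m"
    by (simp add: torus_pt_def real_pt_def restrict_def dual_monoid_zero_cone)
qed

lemma real_pt_affine: "real_pt \<xi> \<in> affine_pts {0}"
  by (auto simp: affine_pts_def real_pt_def dual_monoid_zero_cone int_lattice_0 int_lattice_add
      inner_add_left exp_add)

lemma orbit_hom_real: "orbit_hom (\<chi> j. of_real (exp (\<xi> $ j))) = real_pt \<xi>"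
proof -
  have "dualb (\<lambda>i. axis i 1) j \<bullet> \<xi> = \<xi> $ j" for j
    using arg_cong[OF dualb_expand[OF zbasis_axis, of \<xi>], of "\<lambda>x. x $ j"]
    by (simp add: axis_def if_distrib cong: if_cong)
  then show ?thesis using torus_pt_real[OF zbasis_axis, of \<xi>] by (simp add: orbit_hom_eq)
qed

lemma chart_dualb:
  assumes "zbasis b"
  shows "chart b z (dualb b j) = z $ j"
proof -
  have "dualb b j \<in> dual_monoid (fcone b)"
    by (auto simp: dual_monoid_def dualb_lattice[OF assms] fcone_iff[OF assms])
  then show ?thesis
    by (simp add: chart_def dualb_inner[OF assms] if_distrib[of "\<lambda>x. _ ^ nat \<lfloor>x\<rfloor>"] cong: if_cong)
qed

lemma chart_affine:
  assumes "zbasis b"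
  shows "chart b z \<in> affine_pts (fcone b)"
proof -
  have nn: "0 \<le> \<lfloor>m \<bullet> b j\<rfloor>" if "m \<in> dual_monoid (fcone b)" for j m
    using that by (auto simp: dual_monoid_def fcone_def intro: hull_inc)
  then show ?thesis
    by (auto simp: affine_pts_def chart_def dual_monoid_0 dual_monoid_add floor_inner_add
        dual_monoid_lattice zbasis_lattice[OF assms] nat_add_distrib power_add prod.distrib)
qed

text \<open>Convergence of the real points with logarithms \<open>X k\<close> to
  \<open>\<gamma>\<close> modulo the compact torus: only moduli of characters are compared, which
  suffices for invariant metrics.\<close>

definition tends_to_pt :: "(real^'n) set \<Rightarrow> (real^'n \<Rightarrow> complex) \<Rightarrow> (nat \<Rightarrow> real^'n) \<Rightarrow> bool" where
  "tends_to_pt \<sigma> \<gamma> X \<longleftrightarrow> (\<forall>u\<in>dual_monoid \<sigma>. (\<lambda>k. exp (u \<bullet> X k)) \<longlonglongrightarrow> norm (\<gamma> u))"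

lemma tends_to_pt_restrict:
  assumes "tends_to_pt \<tau> \<delta> X" "\<tau> \<subseteq> \<sigma>"
  shows "tends_to_pt \<sigma> (restrict \<delta> (dual_monoid \<sigma>)) X"
  using assms dual_monoid_antimono[OF assms(2)] by (auto simp: tends_to_pt_def)

lemma rot_apply: "m \<in> dual_monoid \<sigma> \<Longrightarrow> rot \<theta> \<sigma> \<gamma> m = cis (m \<bullet> \<theta>) * \<gamma> m"
  by (simp add: rot_def)

lemma rot_affine: "\<gamma> \<in> affine_pts \<sigma> \<Longrightarrow> rot \<theta> \<sigma> \<gamma> \<in> affine_pts \<sigma>"
  by (auto simp: affine_pts_def rot_def dual_monoid_0 dual_monoid_add inner_add_left cis_mult[symmetric])

lemma rot_inverse: "\<gamma> \<in> extensional (dual_monoid \<sigma>) \<Longrightarrow> rot \<theta> \<sigma> (rot (- \<theta>) \<sigma> \<gamma>) = \<gamma>"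
  by (auto simp: rot_def fun_eq_iff extensional_def restrict_def mult.assoc[symmetric] cis_mult)

lemma rot_restrict:
  "\<tau> \<subseteq> \<sigma> \<Longrightarrow> rot \<theta> \<sigma> (restrict \<delta> (dual_monoid \<sigma>)) = restrict (rot \<theta> \<tau> \<delta>) (dual_monoid \<sigma>)"
  using dual_monoid_antimono[of \<tau> \<sigma>] by (auto simp: rot_def restrict_def fun_eq_iff)

lemma cis_sum: "cis (\<Sum>j\<in>J. f j) = (\<Prod>j\<in>J. cis (f j))"
  by (induction J rule: infinite_finite_induct) (auto simp: cis_mult[symmetric])

lemma rot_torus_pt:
  assumes "zbasis b"
  shows "rot \<theta> {0} (torus_pt b z) = torus_pt b (\<chi> j. cis (dualb b j \<bullet> \<theta>) * z $ j)"
proof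
  fix m
  have "cis (m \<bullet> \<theta>) = (\<Prod>j\<in>UNIV. cis (dualb b j \<bullet> \<theta>) powi \<lfloor>m \<bullet> b j\<rfloor>)" if m: "m \<in> int_lattice"
  proof -
    have "cis (dualb b j \<bullet> \<theta>) powi \<lfloor>m \<bullet> b j\<rfloor> = cis ((dualb b j \<bullet> \<theta>) * (m \<bullet> b j))" for j
      unfolding cis_power_int floor_inner[OF m zbasis_lattice[OF assms]] by (simp add: mult.commute)
    then show ?thesis by (simp add: zbasis_inner_expand[OF assms, of m \<theta>] cis_sum)
  qed
  then show "rot \<theta> {0} (torus_pt b z) m = torus_pt b (\<chi> j. cis (dualb b j \<bullet> \<theta>) * z $ j) m"
    by (auto simp: rot_def torus_pt_def restrict_def dual_monoid_zero_cone power_int_mult_distrib prod.distrib)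
qed

text \<open>Invariance of \<open>R\<close> gives one inclusion; for the other, a member of the
  target class is pulled back by the inverse action.\<close>

lemma image_equivariant_relation:
  assumes step: "\<And>x y. (x, y) \<in> R \<Longrightarrow> (act x, act y) \<in> R" "\<And>x y. (x, y) \<in> R \<Longrightarrow> (act' x, act' y) \<in> R"
    and inv: "\<And>x y. (x, y) \<in> R \<Longrightarrow> act (act' y) = y" "act' (act x) = x"
  shows "act ` (R `` {x}) = R `` {act x}"
proof
  show "R `` {act x} \<subseteq> act ` (R `` {x})"
  proof
    fix y assume "y \<in> R `` {act x}"
    then have "y = act (act' y)" "act' y \<in> R `` {x}"
      using step(2)[of "act x" y] inv(1)[of "act x" y] inv(2) by auto
    then show "y \<in> act ` (R `` {x})" by (rule image_eqI)
  qed
qed (use step(1) in auto)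

section \<open>Affine points, their coordinates and their approximation by real points\<close>

context smooth_complete_fan
begin

lemma dualb_in_dual:
  assumes "b \<in> frames \<Sigma>" "\<tau> \<in> \<Sigma>" "\<tau> \<subseteq> fcone b"
  shows "dualb b j \<in> dual_monoid \<tau>" and "b j \<in> \<tau> \<or> - dualb b j \<in> dual_monoid \<tau>"
proof -
  note zb = frame_zbasis[OF assms(1)]
  show "dualb b j \<in> dual_monoid \<tau>"
    using assms(3) by (auto simp: dual_monoid_def dualb_lattice[OF zb] fcone_iff[OF zb])
  have "dualb b j \<bullet> x = 0" if "b j \<notin> \<tau>" "x \<in> \<tau>" for x
    using generator_in_cone[OF assms(1,2) that(2)] that assms(3) by blast
  then show "b j \<in> \<tau> \<or> - dualb b j \<in> dual_monoid \<tau>"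
    by (auto simp: dual_monoid_def dualb_lattice[OF zb] int_lattice_minus)
qed

lemma affine_formula:
  assumes "b \<in> frames \<Sigma>" "\<tau> \<in> \<Sigma>" "\<tau> \<subseteq> fcone b" "\<gamma> \<in> affine_pts \<tau>" "u \<in> dual_monoid \<tau>"
  shows "\<gamma> u = (\<Prod>j\<in>UNIV. \<gamma> (dualb b j) powi \<lfloor>u \<bullet> b j\<rfloor>)"
  by (rule affine_pts_formula[OF frame_zbasis[OF assms(1)] assms(4) dualb_in_dual[OF assms(1-3)] assms(5)])

text \<open>Injectivity of the inclusion of affine charts: the dual basis of a frame containing
  \<open>\<sigma>\<close> already lies in the smaller monoid, and its values determine the
  point.\<close>

lemma affine_determined:
  assumes "\<tau> \<in> \<Sigma>" "\<sigma> \<in> \<Sigma>" "\<tau> \<subseteq> \<sigma>" "\<delta> \<in> affine_pts \<tau>" "\<delta>' \<in> affine_pts \<tau>"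
    and eq: "restrict \<delta> (dual_monoid \<sigma>) = restrict \<delta>' (dual_monoid \<sigma>)"
  shows "\<delta> = \<delta>'"
proof (rule extensionalityI[OF affine_pts_ext affine_pts_ext])
  obtain b where b: "b \<in> frames \<Sigma>" "\<sigma> \<subseteq> fcone b" using cone_in_frame[OF assms(2)] by blast
  have \<tau>b: "\<tau> \<subseteq> fcone b" using b assms by blast
  have "\<delta> (dualb b j) = \<delta>' (dualb b j)" for j
    using dualb_in_dual(1)[OF b(1) assms(2) b(2), of j] eq by (metis restrict_apply')
  then show "\<delta> u = \<delta>' u" if "u \<in> dual_monoid \<tau>" for u
    using affine_formula[OF b(1) assms(1) \<tau>b assms(4) that] affine_formula[OF b(1) assms(1) \<tau>b assms(5) that] by simp
qed (use assms in auto)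

lemma affine_chart:
  assumes "b \<in> frames \<Sigma>" "\<gamma> \<in> affine_pts (fcone b)"
  shows "\<gamma> = chart b (\<chi> j. \<gamma> (dualb b j))"
proof (rule extensionalityI[OF affine_pts_ext affine_pts_ext, OF assms(2) chart_affine[OF frame_zbasis[OF assms(1)]]])
  fix u assume u: "u \<in> dual_monoid (fcone b)"
  have "0 \<le> \<lfloor>u \<bullet> b j\<rfloor>" for j using u by (auto simp: dual_monoid_def fcone_def intro: hull_inc)
  then show "\<gamma> u = chart b (\<chi> j. \<gamma> (dualb b j)) u"
    using affine_formula[OF assms(1) frame_cone[OF assms(1)] order_refl assms(2) u] u
    by (simp add: chart_def power_int_nonneg_exp)
qed

lemma tends_to_pt_exists:
  assumes "\<tau> \<in> \<Sigma>" "\<delta> \<in> affine_pts \<tau>"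
  shows "\<exists>X. tends_to_pt \<tau> \<delta> X"
proof -
  obtain b where b: "b \<in> frames \<Sigma>" "\<tau> \<subseteq> fcone b" using cone_in_frame[OF assms(1)] by blast
  note zb = frame_zbasis[OF b(1)]
  note D = dualb_in_dual[OF b(1) assms(1) b(2)]
  \<comment> \<open>Vanishing coordinates are sent to minus infinity, the others are held at their
    logarithmic modulus.\<close>
  define t where "t j k = (if \<delta> (dualb b j) = 0 then - real k else ln (norm (\<delta> (dualb b j))))" for j and k :: nat
  define X where "X k = (\<Sum>j\<in>UNIV. t j k *\<^sub>R b j)" for k
  have t: "(\<lambda>k. exp (t j k)) \<longlonglongrightarrow> norm (\<delta> (dualb b j))" for j
  proof (cases "\<delta> (dualb b j) = 0")
    case True
    then show ?thesis using exp_minus_real_tendsto by (simp add: t_def)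
  qed (simp add: t_def)
  have "(\<lambda>k. exp (u \<bullet> X k)) \<longlonglongrightarrow> norm (\<delta> u)" if u: "u \<in> dual_monoid \<tau>" for u
  proof -
    have "(\<lambda>k. exp (t j k) powi \<lfloor>u \<bullet> b j\<rfloor>) \<longlonglongrightarrow> norm (\<delta> (dualb b j)) powi \<lfloor>u \<bullet> b j\<rfloor>" for j
    proof (cases "0 \<le> \<lfloor>u \<bullet> b j\<rfloor>")
      case True
      then show ?thesis by (simp add: power_int_nonneg_exp tendsto_power[OF t])
    next
      case False
      then have "- dualb b j \<in> dual_monoid \<tau>" using D(2)[of j] u by (auto simp: dual_monoid_def)
      then have "\<delta> (dualb b j) \<noteq> 0" by (rule affine_pts_nonzero[OF assms(2) D(1)])
      then show ?thesis by (intro tendsto_power_int t) simp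
    qed
    then have "(\<lambda>k. \<Prod>j\<in>UNIV. exp (t j k) powi \<lfloor>u \<bullet> b j\<rfloor>) \<longlonglongrightarrow> (\<Prod>j\<in>UNIV. norm (\<delta> (dualb b j)) powi \<lfloor>u \<bullet> b j\<rfloor>)"
      by (intro tendsto_prod)
    moreover have "(\<Prod>j\<in>UNIV. exp (t j k) powi \<lfloor>u \<bullet> b j\<rfloor>) = exp (u \<bullet> X k)" for k
    proof -
      have "exp (t j k) powi \<lfloor>u \<bullet> b j\<rfloor> = exp (t j k * (u \<bullet> b j))" for j
        unfolding exp_power_int floor_inner[OF dual_monoid_lattice[OF u] zbasis_lattice[OF zb]]
        by (simp add: mult.commute)
      then show ?thesis by (simp add: X_def inner_sum_right exp_sum)
    qed
    moreover have "(\<Prod>j\<in>UNIV. norm (\<delta> (dualb b j)) powi \<lfloor>u \<bullet> b j\<rfloor>) = norm (\<delta> u)"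
      unfolding affine_pts_formula[OF zb assms(2) D u] by (simp add: prod_norm[symmetric] norm_power_int)
    ultimately show ?thesis by simp
  qed
  then show ?thesis unfolding tends_to_pt_def by blast
qed

section \<open>Vectors of the line bundle and the torus action on classes\<close>

lemma lvec_refl:
  assumes "\<sigma> \<in> \<Sigma>" "m \<in> local_data \<Sigma> a \<sigma>" "\<gamma> \<in> affine_pts \<sigma>"
  shows "(\<sigma>, m, \<gamma>, c) \<in> lvec \<Sigma> a \<sigma> m \<gamma> c"
  using assms affine_pts_ext[OF assms(3)] affine_pts_0[OF assms(3)]
  by (auto simp: lvec_def lglue_rel_def extensional_restrict intro!: bexI[of _ \<gamma>])

text \<open>A quadruple lies in its own class, hence in the other one, whose description supplies
  the common point \<open>\<delta>\<close>.\<close>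

lemma lvec_eqD:
  assumes "\<sigma> \<in> \<Sigma>" "m \<in> local_data \<Sigma> a \<sigma>" "\<gamma> \<in> affine_pts \<sigma>"
    and "lvec \<Sigma> a \<sigma> m \<gamma> c = lvec \<Sigma> a \<sigma>' m' \<gamma>' c'"
  shows "\<exists>\<delta>\<in>affine_pts (\<sigma>' \<inter> \<sigma>). \<gamma>' = restrict \<delta> (dual_monoid \<sigma>') \<and> \<gamma> = restrict \<delta> (dual_monoid \<sigma>) \<and>
        c = \<delta> (m - m') * c'"
  using lvec_refl[OF assms(1-3), of c] unfolding assms(4) by (auto simp: lvec_def lglue_rel_def)

lemma lvec_inject:
  assumes "\<sigma> \<in> \<Sigma>" "m \<in> local_data \<Sigma> a \<sigma>" "\<gamma> \<in> affine_pts \<sigma>"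
    and "lvec \<Sigma> a \<sigma> m \<gamma> c = lvec \<Sigma> a \<sigma> m \<gamma> c'"
  shows "c = c'"
  using lvec_eqD[OF assms] by (auto simp: affine_pts_0)

lemma lscale_lvec: "lscale k (lvec \<Sigma> a \<sigma> m \<gamma> c) = lvec \<Sigma> a \<sigma> m \<gamma> (k * c)"
proof
  show "lvec \<Sigma> a \<sigma> m \<gamma> (k * c) \<subseteq> lscale k (lvec \<Sigma> a \<sigma> m \<gamma> c)"
  proof
    fix y assume "y \<in> lvec \<Sigma> a \<sigma> m \<gamma> (k * c)"
    then obtain \<sigma>' m' \<gamma>' \<delta> where y: "y = (\<sigma>', m', \<gamma>', \<delta> (m' - m) * (k * c))"
      and "\<sigma> \<in> \<Sigma>" "\<sigma>' \<in> \<Sigma>" "m \<in> local_data \<Sigma> a \<sigma>" "m' \<in> local_data \<Sigma> a \<sigma>'" "\<delta> \<in> affine_pts (\<sigma> \<inter> \<sigma>')"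
      "\<gamma> = restrict \<delta> (dual_monoid \<sigma>)" "\<gamma>' = restrict \<delta> (dual_monoid \<sigma>')"
      by (auto simp: lvec_def lglue_rel_def)
    then have "(\<sigma>', m', \<gamma>', \<delta> (m' - m) * c) \<in> lvec \<Sigma> a \<sigma> m \<gamma> c" by (auto simp: lvec_def lglue_rel_def)
    then show "y \<in> lscale k (lvec \<Sigma> a \<sigma> m \<gamma> c)"
      unfolding lscale_def y by (rule rev_image_eqI) simp
  qed
qed (auto simp: lscale_def lvec_def lglue_rel_def)

lemma lact_lvec:
  assumes ext: "\<gamma> \<in> extensional (dual_monoid \<sigma>)"
  shows "lact \<theta> (lvec \<Sigma> a \<sigma> m \<gamma> c) = lvec \<Sigma> a \<sigma> m (rot \<theta> \<sigma> \<gamma>) (cis (m \<bullet> \<theta>) * c)"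
proof -
  let ?act = "\<lambda>\<theta> (\<sigma>, m, \<gamma>, c). (\<sigma>, m, rot \<theta> \<sigma> \<gamma>, cis (m \<bullet> \<theta>) * c)"
  have inv: "?act \<theta> (?act (- \<theta>) (\<sigma>, m, \<gamma>, c)) = (\<sigma>, m, \<gamma>, c)" if "\<gamma> \<in> extensional (dual_monoid \<sigma>)" for \<theta> \<sigma> m \<gamma> c
    by (simp add: rot_inverse[OF that] mult.assoc[symmetric] cis_mult)
  have "?act \<theta> ` (lglue_rel \<Sigma> a `` {(\<sigma>, m, \<gamma>, c)}) = lglue_rel \<Sigma> a `` {?act \<theta> (\<sigma>, m, \<gamma>, c)}"
  proof (rule image_equivariant_relation[where act' = "?act (- \<theta>)"])
    show "(?act \<theta> x, ?act \<theta> y) \<in> lglue_rel \<Sigma> a" if rel: "(x, y) \<in> lglue_rel \<Sigma> a" for x y \<theta>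
    proof -
      obtain \<sigma> m \<gamma> c \<sigma>' m' \<gamma>' c' where xy: "x = (\<sigma>, m, \<gamma>, c)" "y = (\<sigma>', m', \<gamma>', c')" by (metis prod_cases4)
      with rel obtain \<delta> where \<delta>: "\<sigma> \<in> \<Sigma>" "\<sigma>' \<in> \<Sigma>" "m \<in> local_data \<Sigma> a \<sigma>" "m' \<in> local_data \<Sigma> a \<sigma>'"
        "\<delta> \<in> affine_pts (\<sigma> \<inter> \<sigma>')" "\<gamma> = restrict \<delta> (dual_monoid \<sigma>)" "\<gamma>' = restrict \<delta> (dual_monoid \<sigma>')"
        "c' = \<delta> (m' - m) * c"
        by (auto simp: lglue_rel_def)
      have mm: "m' - m \<in> dual_monoid (\<sigma> \<inter> \<sigma>')"
        by (rule local_data_diff[OF cone_Int[OF \<delta>(1,2)] Int_lower1 Int_lower2 \<delta>(3,4)])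
      \<comment> \<open>The rotation factors of the two frames differ by that of the transition
        function \<open>\<delta> (m' - m)\<close>, so the action respects the gluing.\<close>
      have "cis (m' \<bullet> \<theta>) = cis ((m' - m) \<bullet> \<theta>) * cis (m \<bullet> \<theta>)" by (simp add: cis_mult inner_diff_left)
      then have "rot \<theta> (\<sigma> \<inter> \<sigma>') \<delta> (m' - m) * (cis (m \<bullet> \<theta>) * c) = cis (m' \<bullet> \<theta>) * c'"
        unfolding rot_apply[OF mm] \<delta>(8) by (simp only: mult_ac)
      then show ?thesis
        unfolding xy lglue_rel_def using \<delta>
        by (auto simp: rot_restrict[of "\<sigma> \<inter> \<sigma>'"] intro!: bexI[OF _ rot_affine[OF \<delta>(5)]])
    qed
    then show "(?act (- \<theta>) x, ?act (- \<theta>) y) \<in> lglue_rel \<Sigma> a" if "(x, y) \<in> lglue_rel \<Sigma> a" for x y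
      using that by blast
    show "?act \<theta> (?act (- \<theta>) y) = y" if "(x, y) \<in> lglue_rel \<Sigma> a" for x y
    proof -
      obtain \<sigma>' m' \<gamma>' c' where y: "y = (\<sigma>', m', \<gamma>', c')" by (metis prod_cases4)
      with that have "\<gamma>' \<in> extensional (dual_monoid \<sigma>')" by (auto simp: lglue_rel_def)
      then show ?thesis unfolding y by (rule inv)
    qed
    show "?act (- \<theta>) (?act \<theta> (\<sigma>, m, \<gamma>, c)) = (\<sigma>, m, \<gamma>, c)"
      using inv[OF ext, of "- \<theta>" m c] by (simp only: minus_minus)
  qed
  then show ?thesis unfolding lact_def lvec_def by simp
qed

lemma xact_xpt:
  assumes ext: "\<gamma> \<in> extensional (dual_monoid \<sigma>)"
  shows "xact \<theta> (xpt \<Sigma> \<sigma> \<gamma>) = xpt \<Sigma> \<sigma> (rot \<theta> \<sigma> \<gamma>)"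
proof -
  let ?act = "\<lambda>\<theta> (\<sigma>, \<gamma>). (\<sigma>, rot \<theta> \<sigma> \<gamma>)"
  have "?act \<theta> ` (glue_rel \<Sigma> `` {(\<sigma>, \<gamma>)}) = glue_rel \<Sigma> `` {?act \<theta> (\<sigma>, \<gamma>)}"
  proof (rule image_equivariant_relation[where act' = "?act (- \<theta>)"])
    show "(?act \<theta> x, ?act \<theta> y) \<in> glue_rel \<Sigma>" if "(x, y) \<in> glue_rel \<Sigma>" for x y \<theta>
    proof -
      obtain \<sigma> \<gamma> \<sigma>' \<gamma>' where xy: "x = (\<sigma>, \<gamma>)" "y = (\<sigma>', \<gamma>')" by (metis surj_pair)
      with that obtain \<delta> where "\<sigma> \<in> \<Sigma>" "\<sigma>' \<in> \<Sigma>" "\<delta> \<in> affine_pts (\<sigma> \<inter> \<sigma>')"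
        "\<gamma> = restrict \<delta> (dual_monoid \<sigma>)" "\<gamma>' = restrict \<delta> (dual_monoid \<sigma>')"
        by (auto simp: glue_rel_def)
      then show ?thesis unfolding xy glue_rel_def
        by (auto simp: rot_restrict[of "\<sigma> \<inter> \<sigma>'"] intro!: bexI[OF _ rot_affine[of \<delta>]])
    qed
    then show "(?act (- \<theta>) x, ?act (- \<theta>) y) \<in> glue_rel \<Sigma>" if "(x, y) \<in> glue_rel \<Sigma>" for x y
      using that by blast
    show "?act \<theta> (?act (- \<theta>) y) = y" if "(x, y) \<in> glue_rel \<Sigma>" for x y
      using that by (auto simp: glue_rel_def rot_inverse)
    show "?act (- \<theta>) (?act \<theta> (\<sigma>, \<gamma>)) = (\<sigma>, \<gamma>)"
      using rot_inverse[OF ext, of "- \<theta>"] by simp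
  qed
  then show ?thesis unfolding xact_def xpt_def by simp
qed

lemma xpt_zero_inject:
  assumes "\<gamma> \<in> affine_pts {0}" "xpt \<Sigma> {0} \<gamma> = xpt \<Sigma> {0} \<gamma>'"
  shows "\<gamma> = \<gamma>'"
proof -
  have "({0}, \<gamma>) \<in> xpt \<Sigma> {0} \<gamma>"
    using zero_cone assms(1) affine_pts_ext[OF assms(1)]
    by (auto simp: xpt_def glue_rel_def extensional_restrict intro!: bexI[of _ \<gamma>])
  then show ?thesis unfolding assms(2) by (auto simp: xpt_def glue_rel_def)
qed

text \<open>Over the open orbit the common point \<open>\<delta>\<close> is forced to be a
  restriction of \<open>\<gamma>\<close>. The predicate \<open>P\<close> carries the extra
  transition condition for vectors of the line bundle.\<close>

lemma restrict_zero_pt_iff: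
  assumes \<gamma>: "\<gamma> \<in> affine_pts {0}" and \<sigma>: "\<sigma> \<in> \<Sigma>" and \<sigma>': "\<sigma>' \<in> \<Sigma>"
  shows "(\<exists>\<delta>\<in>affine_pts (\<sigma> \<inter> \<sigma>'). restrict \<gamma> (dual_monoid \<sigma>) = restrict \<delta> (dual_monoid \<sigma>) \<and>
      \<gamma>' = restrict \<delta> (dual_monoid \<sigma>') \<and> P \<delta>)
    \<longleftrightarrow> \<gamma>' = restrict \<gamma> (dual_monoid \<sigma>') \<and> P (restrict \<gamma> (dual_monoid (\<sigma> \<inter> \<sigma>')))" (is "?L \<longleftrightarrow> ?R")
proof -
  let ?r = "restrict \<gamma> (dual_monoid (\<sigma> \<inter> \<sigma>'))"
  have \<tau>: "\<sigma> \<inter> \<sigma>' \<in> \<Sigma>" using cone_Int \<sigma> \<sigma>' by blast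
  have r: "?r \<in> affine_pts (\<sigma> \<inter> \<sigma>')"
    by (rule affine_pts_restrict[OF \<gamma>]) (use cone_0[OF \<tau>] in auto)
  have e: "restrict ?r (dual_monoid \<sigma>) = restrict \<gamma> (dual_monoid \<sigma>)"
    "restrict ?r (dual_monoid \<sigma>') = restrict \<gamma> (dual_monoid \<sigma>')"
    using dual_monoid_antimono[of "\<sigma> \<inter> \<sigma>'" \<sigma>] dual_monoid_antimono[of "\<sigma> \<inter> \<sigma>'" \<sigma>']
    by (simp_all add: Int_absorb1)
  show ?thesis
  proof
    assume ?L
    then obtain \<delta> where \<delta>: "\<delta> \<in> affine_pts (\<sigma> \<inter> \<sigma>')" "restrict \<gamma> (dual_monoid \<sigma>) = restrict \<delta> (dual_monoid \<sigma>)"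
      "\<gamma>' = restrict \<delta> (dual_monoid \<sigma>')" "P \<delta>" by blast
    have "\<delta> = ?r" by (rule affine_determined[OF \<tau> \<sigma> Int_lower1 \<delta>(1) r]) (simp only: e(1) \<delta>(2))
    then show ?R using \<delta>(3,4) e(2) by metis
  next
    assume ?R then show ?L using r e by metis
  qed
qed

lemma xpt_of_torus_pt:
  assumes "\<gamma> \<in> affine_pts {0}" "\<sigma> \<in> \<Sigma>"
  shows "xpt \<Sigma> \<sigma> (restrict \<gamma> (dual_monoid \<sigma>)) = {(\<sigma>', restrict \<gamma> (dual_monoid \<sigma>')) | \<sigma>'. \<sigma>' \<in> \<Sigma>}"
proof -
  have "(\<sigma>', \<gamma>') \<in> xpt \<Sigma> \<sigma> (restrict \<gamma> (dual_monoid \<sigma>)) \<longleftrightarrow> \<sigma>' \<in> \<Sigma> \<and> \<gamma>' = restrict \<gamma> (dual_monoid \<sigma>')" for \<sigma>' \<gamma>'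
    using restrict_zero_pt_iff[OF assms, of \<sigma>' \<gamma>' "\<lambda>_. True"] assms(2)
    unfolding xpt_def glue_rel_def by (cases "\<sigma>' \<in> \<Sigma>") simp_all
  then show ?thesis by auto
qed

lemma xpt_zero:
  assumes "\<gamma> \<in> affine_pts {0}" "\<sigma> \<in> \<Sigma>"
  shows "xpt \<Sigma> {0} \<gamma> = xpt \<Sigma> \<sigma> (restrict \<gamma> (dual_monoid \<sigma>))"
  using xpt_of_torus_pt[OF assms] xpt_of_torus_pt[OF assms(1) zero_cone] extensional_restrict[OF affine_pts_ext[OF assms(1)]] by simp

text \<open>On the torus \<open>e_0 = \<chi>^m e_m\<close>, so the coefficients
  \<open>\<gamma> m * c\<close> and \<open>\<gamma> m' * c\<close> describe the same vector
  \<open>c e_0\<close>.\<close>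

lemma lvec_of_torus_pt:
  assumes \<gamma>: "\<gamma> \<in> affine_pts {0}" and \<sigma>: "\<sigma> \<in> \<Sigma>" and m: "m \<in> local_data \<Sigma> a \<sigma>"
  shows "lvec \<Sigma> a \<sigma> m (restrict \<gamma> (dual_monoid \<sigma>)) (\<gamma> m * c) =
    {(\<sigma>', m', restrict \<gamma> (dual_monoid \<sigma>'), \<gamma> m' * c) | \<sigma>' m'. \<sigma>' \<in> \<Sigma> \<and> m' \<in> local_data \<Sigma> a \<sigma>'}"
proof -
  have "(\<sigma>', m', \<gamma>', c') \<in> lvec \<Sigma> a \<sigma> m (restrict \<gamma> (dual_monoid \<sigma>)) (\<gamma> m * c) \<longleftrightarrow>
    (\<sigma>' \<in> \<Sigma> \<and> m' \<in> local_data \<Sigma> a \<sigma>') \<and> \<gamma>' = restrict \<gamma> (dual_monoid \<sigma>') \<and> c' = \<gamma> m' * c" for \<sigma>' m' \<gamma>' c'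
  proof (cases "\<sigma>' \<in> \<Sigma> \<and> m' \<in> local_data \<Sigma> a \<sigma>'")
    case True
    have mm: "m' - m \<in> dual_monoid (\<sigma> \<inter> \<sigma>')"
      by (rule local_data_diff[OF cone_Int[OF \<sigma> conjunct1[OF True]] Int_lower1 Int_lower2 m conjunct2[OF True]])
    have "\<gamma> (m' - m) * \<gamma> m = \<gamma> ((m' - m) + m)"
      using m mm by (intro affine_pts_add[OF \<gamma>, symmetric])
        (auto simp: dual_monoid_zero_cone local_data_def dest: dual_monoid_lattice)
    then have e: "restrict \<gamma> (dual_monoid (\<sigma> \<inter> \<sigma>')) (m' - m) * (\<gamma> m * c) = \<gamma> m' * c"
      using mm by (simp add: mult.assoc[symmetric])
    show ?thesis
      using restrict_zero_pt_iff[OF \<gamma> \<sigma> conjunct1[OF True], of \<gamma>' "\<lambda>\<delta>. c' = \<delta> (m' - m) * (\<gamma> m * c)", unfolded e] True \<sigma> m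
      unfolding lvec_def lglue_rel_def by simp
  qed (auto simp: lvec_def lglue_rel_def)
  then show ?thesis by auto
qed

lemma lvec_zero:
  assumes "\<gamma> \<in> affine_pts {0}" "\<sigma> \<in> \<Sigma>" "m \<in> local_data \<Sigma> a \<sigma>"
  shows "lvec \<Sigma> a {0} 0 \<gamma> c = lvec \<Sigma> a \<sigma> m (restrict \<gamma> (dual_monoid \<sigma>)) (\<gamma> m * c)"
  using lvec_of_torus_pt[OF assms] lvec_of_torus_pt[OF assms(1) zero_cone zero_local_data] affine_pts_0[OF assms(1)]
    extensional_restrict[OF affine_pts_ext[OF assms(1)]] by simp

end

section \<open>Equivariant sections\<close>

lemma holo_fun_const: "holo_fun (\<lambda>z. c) W"
  unfolding holo_fun_def by (auto intro!: exI[of _ "\<lambda>v. 0"])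

lemma holo_fun_nth: "holo_fun (\<lambda>z. z $ j) W"
  unfolding holo_fun_def
  by (auto intro!: exI[of _ "\<lambda>v. v $ j"] bounded_linear_imp_has_derivative bounded_linear_vec_nth)

lemma holo_fun_mult:
  assumes "holo_fun f W" "holo_fun g W"
  shows "holo_fun (\<lambda>z. f z * g z) W"
  unfolding holo_fun_def
proof
  fix z assume "z \<in> W"
  then obtain D E where D: "(f has_derivative D) (at z)" "\<forall>c v. D (c *s v) = c * D v"
    and E: "(g has_derivative E) (at z)" "\<forall>c v. E (c *s v) = c * E v"
    using assms unfolding holo_fun_def by meson
  show "\<exists>D. ((\<lambda>z. f z * g z) has_derivative D) (at z) \<and> (\<forall>c v. D (c *s v) = c * D v)"
    using has_derivative_mult[OF D(1) E(1)] D(2) E(2)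
    by (intro exI[of _ "\<lambda>v. f z * E v + D v * g z"]) (simp add: algebra_simps)
qed

lemma holo_fun_power: "holo_fun f W \<Longrightarrow> holo_fun (\<lambda>z. f z ^ k) W"
  by (induction k) (auto intro: holo_fun_const holo_fun_mult)

lemma holo_fun_prod: "(\<And>i. i \<in> I \<Longrightarrow> holo_fun (f i) W) \<Longrightarrow> holo_fun (\<lambda>z. \<Prod>i\<in>I. f i z) W"
  by (induction I rule: infinite_finite_induct) (auto intro: holo_fun_const holo_fun_mult)

lemma has_derivative_cis_0: "((\<lambda>r. cis (r * x)) has_derivative (\<lambda>r. of_real r * (\<i> * of_real x))) (at 0)"
proof -
  have "((\<lambda>r. exp (\<i> * complex_of_real (r * x))) has_derivative
      (\<lambda>r. exp (\<i> * complex_of_real (0 * x)) * (\<i> * of_real (r * x)))) (at 0)"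
    by (rule has_derivative_compose[OF
          has_derivative_mult_right[OF has_derivative_of_real[OF has_derivative_mult_left[OF has_derivative_ident]]]
          DERIV_exp[unfolded has_field_derivative_def]])
  then show ?thesis by (simp add: cis_conv_exp mult_ac)
qed

text \<open>Differentiating the homogeneity in the angular directions and using complex linearity of
  the derivative gives Euler's identity in the radial directions.\<close>

lemma homogeneous_holomorphic:
  fixes F :: "complex^'n \<Rightarrow> complex"
  assumes F: "holo_fun F UNIV"
    and hom: "\<And>z \<theta>. \<forall>j. z $ j \<noteq> 0 \<Longrightarrow> F (\<chi> j. cis (\<theta> $ j) * z $ j) = cis (\<theta> \<bullet> q) * F z"
  shows "\<exists>C. \<forall>t::real^'n. F (\<chi> j. of_real (exp (t $ j))) = C * of_real (exp (t \<bullet> q))"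
proof -
  define E :: "real^'n \<Rightarrow> complex^'n" where "E t = (\<chi> j. of_real (exp (t $ j)))" for t
  have euler: "D (\<chi> j. of_real (v $ j * exp (t $ j))) = of_real (v \<bullet> q) * F (E t)"
    if D: "(F has_derivative D) (at (E t))" and lin: "\<And>c v. D (c *s v) = c * D v" for D t v
  proof -
    have d1: "((\<lambda>r. \<chi> j. cis (r * v $ j) * E t $ j) has_derivative (\<lambda>r. \<chi> j. (of_real r * (\<i> * of_real (v $ j))) * E t $ j)) (at 0)"
    proof (rule has_derivative_vec_lambda)
      fix j
      show "((\<lambda>r. cis (r * v $ j) * E t $ j) has_derivative (\<lambda>r. (of_real r * (\<i> * of_real (v $ j))) * E t $ j)) (at 0)"
        by (rule has_derivative_mult_left[OF has_derivative_cis_0])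
    qed
    have "(F has_derivative D) (at (\<chi> j. cis (0 * v $ j) * E t $ j))" using D by (simp add: vec_lambda_eta)
    from has_derivative_compose[OF d1 this]
    have "((\<lambda>r. F (\<chi> j. cis (r * v $ j) * E t $ j)) has_derivative (\<lambda>r. D (\<chi> j. (of_real r * (\<i> * of_real (v $ j))) * E t $ j))) (at 0)" .
    moreover have "F (\<chi> j. cis (r * v $ j) * E t $ j) = cis (r * (v \<bullet> q)) * F (E t)" for r
      using hom[of "E t" "r *\<^sub>R v"] by (simp add: E_def)
    ultimately have l: "((\<lambda>r. cis (r * (v \<bullet> q)) * F (E t)) has_derivative (\<lambda>r. D (\<chi> j. (of_real r * (\<i> * of_real (v $ j))) * E t $ j))) (at 0)"
      by simp
    have r: "((\<lambda>r. cis (r * (v \<bullet> q)) * F (E t)) has_derivative (\<lambda>r. (of_real r * (\<i> * of_real (v \<bullet> q))) * F (E t))) (at 0)"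
      by (rule has_derivative_mult_left[OF has_derivative_cis_0])
    from fun_cong[OF has_derivative_unique[OF l r], of 1]
    have "D (\<chi> j. (\<i> * of_real (v $ j)) * E t $ j) = (\<i> * of_real (v \<bullet> q)) * F (E t)" by simp
    moreover have "(\<chi> j. (\<i> * of_real (v $ j)) * E t $ j) = \<i> *s (\<chi> j. of_real (v $ j * exp (t $ j)))"
      by (simp add: E_def vec_eq_iff)
    ultimately have "\<i> * D (\<chi> j. of_real (v $ j * exp (t $ j))) = \<i> * (of_real (v \<bullet> q) * F (E t))"
      by (simp add: lin mult.assoc)
    then show ?thesis by simp
  qed
  \<comment> \<open>By Euler's identity the derivative of \<open>F (E t)\<close> along
    \<open>v\<close> is multiplication by \<open>v \<bullet> q\<close>, so dividing by the
    exponential leaves a constant.\<close>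
  have "\<exists>C. \<forall>t\<in>UNIV. F (E t) * of_real (exp (- (t \<bullet> q))) = C"
  proof (rule has_derivative_zero_constant[OF convex_UNIV])
    fix t :: "real^'n"
    obtain D where D: "(F has_derivative D) (at (E t))" "\<And>c v. D (c *s v) = c * D v"
      using F unfolding holo_fun_def by blast
    have dE: "(E has_derivative (\<lambda>v. \<chi> j. of_real (v $ j * exp (t $ j)))) (at t)"
      unfolding E_def[abs_def]
      by (intro has_derivative_vec_lambda has_derivative_of_real)
        (auto intro!: derivative_eq_intros bounded_linear_imp_has_derivative bounded_linear_vec_nth)
    have "((\<lambda>t. F (E t)) has_derivative (\<lambda>v. of_real (v \<bullet> q) * F (E t))) (at t)"
      using has_derivative_compose[OF dE D(1)] euler[OF D] by simp
    moreover have "((\<lambda>t. complex_of_real (exp (- (t \<bullet> q)))) has_derivative (\<lambda>v. of_real (exp (- (t \<bullet> q)) * - (v \<bullet> q)))) (at t)"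
      by (intro has_derivative_of_real) (auto intro!: derivative_eq_intros)
    ultimately show "((\<lambda>t. F (E t) * of_real (exp (- (t \<bullet> q)))) has_derivative (\<lambda>h. 0)) (at t within UNIV)"
      by (rule has_derivative_eq_rhs[OF has_derivative_mult]) (simp add: fun_eq_iff mult_ac)
  qed
  then obtain C where C: "\<And>t. F (E t) * of_real (exp (- (t \<bullet> q))) = C" by blast
  have "F (E t) = C * of_real (exp (t \<bullet> q))" for t
    unfolding C[of t, symmetric] by (simp add: mult.assoc of_real_mult[symmetric] exp_minus del: of_real_mult)
  then show ?thesis unfolding E_def by blast
qed

lemma mcoset_diff:
  assumes u: "u \<in> int_lattice"
  shows "mcoset (y - u) = mcoset y"
  unfolding mcoset_def
proof safe
  fix v :: "real^'a" assume v: "v \<in> int_lattice"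
  show "\<exists>w. y - u + v = y + w \<and> w \<in> int_lattice"
    by (rule exI[of _ "v - u"]) (simp add: u v int_lattice_diff)
  show "\<exists>w. y + v = y - u + w \<and> w \<in> int_lattice"
    by (rule exI[of _ "v + u"]) (simp add: u v int_lattice_add)
qed

context smooth_complete_fan
begin

lemma open_orbit_eq: "open_orbit \<Sigma> = xpt \<Sigma> {0} ` affine_pts {0}"
proof
  show "open_orbit \<Sigma> \<subseteq> xpt \<Sigma> {0} ` affine_pts {0}"
    using torus_pt_affine[OF zbasis_axis] by (auto simp: open_orbit_def orbit_pt_def orbit_hom_eq)
  show "xpt \<Sigma> {0} ` affine_pts {0} \<subseteq> open_orbit \<Sigma>"
  proof
    fix x :: "'n toric_pt" assume "x \<in> xpt \<Sigma> {0} ` affine_pts {0}"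
    then obtain \<gamma> where \<gamma>: "\<gamma> \<in> affine_pts {0}" "x = xpt \<Sigma> {0} \<gamma>" by blast
    then show "x \<in> open_orbit \<Sigma>"
      using affine_torus_pt[OF zbasis_axis \<gamma>(1)] unfolding open_orbit_def orbit_pt_def orbit_hom_eq
      by (intro CollectI exI[of _ "\<chi> j. \<gamma> (dualb (\<lambda>i. axis i 1) j)"]) auto
  qed
qed

lemma xpt_chart:
  assumes "b \<in> frames \<Sigma>" "\<forall>j. z $ j \<noteq> 0"
  shows "xpt \<Sigma> (fcone b) (chart b z) = xpt \<Sigma> {0} (torus_pt b z)"
  using xpt_zero[OF torus_pt_affine[OF frame_zbasis[OF assms(1)]] frame_cone[OF assms(1)]] assms(2)
  by (simp add: restrict_torus_pt)

lemma rot_chart: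
  assumes "zbasis b"
  shows "rot \<theta> (fcone b) (chart b z) = chart b (\<chi> j. cis (dualb b j \<bullet> \<theta>) * z $ j)"
proof -
  have "{0} \<subseteq> fcone b" by (simp add: fcone_iff[OF assms])
  from rot_restrict[OF this, of \<theta> "torus_pt b z"] show ?thesis
    by (simp only: restrict_torus_pt rot_torus_pt[OF assms])
qed

text \<open>The rational function 1, whose divisor as a section is \<open>\<Sum> a_v D_v\<close>.
  Toric points are classes, so the representative over the zero cone is recovered by
  \<open>SOME\<close>; it is unique.\<close>

definition unit_section :: "(real^'n \<Rightarrow> int) \<Rightarrow> 'n toric_pt \<Rightarrow> 'n lvect" where
  "unit_section a x = lvec \<Sigma> a {0} 0 (SOME \<gamma>. \<gamma> \<in> affine_pts {0} \<and> x = xpt \<Sigma> {0} \<gamma>) 1"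

lemma unit_section_eq:
  assumes "\<gamma> \<in> affine_pts {0}"
  shows "unit_section a (xpt \<Sigma> {0} \<gamma>) = lvec \<Sigma> a {0} 0 \<gamma> 1"
proof -
  have "(SOME \<gamma>'. \<gamma>' \<in> affine_pts {0} \<and> xpt \<Sigma> {0} \<gamma> = xpt \<Sigma> {0} \<gamma>') = \<gamma>"
    using assms xpt_zero_inject[OF assms] by (intro some_equality) auto
  then show ?thesis by (simp add: unit_section_def)
qed

lemma equivariant_unit_section: "equivariant_section \<Sigma> a (unit_section a)"
  unfolding equivariant_section_def
proof (intro conjI ballI)
  fix x assume "x \<in> open_orbit \<Sigma>"
  then obtain \<gamma> where \<gamma>: "\<gamma> \<in> affine_pts {0}" "x = xpt \<Sigma> {0} \<gamma>" by (auto simp: open_orbit_eq)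
  show "unit_section a x \<in> lfibre \<Sigma> a x"
    unfolding \<gamma>(2) unit_section_eq[OF \<gamma>(1)] lfibre_def using zero_cone zero_local_data \<gamma>(1) by blast
next
  have "lvec \<Sigma> a {0} 0 (real_pt 0) 1 \<noteq> lvec \<Sigma> a {0} 0 (real_pt 0) 0"
    using lvec_inject[OF zero_cone zero_local_data real_pt_affine] zero_neq_one by metis
  then show "\<exists>x\<in>open_orbit \<Sigma>. unit_section a x \<noteq> lscale 0 (unit_section a x)"
    using real_pt_affine unfolding open_orbit_eq
    by (intro bexI[of _ "xpt \<Sigma> {0} (real_pt 0)"]) (auto simp: unit_section_eq lscale_lvec)
next
  fix b m assume b: "b \<in> frames \<Sigma>" and m: "m \<in> local_data \<Sigma> a (fcone b)"
  note zb = frame_zbasis[OF b]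
  define n where "n j = \<lfloor>m \<bullet> b j\<rfloor>" for j
  \<comment> \<open>This power of the product of the coordinates clears all poles of
    \<open>\<chi>^m\<close>, whose exponents \<open>n j\<close> may be negative.\<close>
  define k where "k = (\<Sum>j\<in>UNIV. nat \<bar>n j\<bar>)"
  have nk: "0 \<le> n j + int k" for j
  proof -
    have "nat \<bar>n j\<bar> \<le> k" unfolding k_def by (rule member_le_sum) auto
    then show ?thesis by linarith
  qed
  have ml: "m \<in> int_lattice" using m by (simp add: local_data_def)
  define F :: "complex^'n \<Rightarrow> complex" where "F z = (\<Prod>j\<in>UNIV. (z $ j) ^ nat (n j + int k))" for z
  have "holo_fun F UNIV" unfolding F_def[abs_def] by (intro holo_fun_prod holo_fun_power holo_fun_nth)
  moreover have "unit_section a (xpt \<Sigma> (fcone b) (chart b z))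
             = lvec \<Sigma> a (fcone b) m (chart b z) (F z / (\<Prod>j\<in>UNIV. z $ j) ^ k)"
    if z: "\<forall>j. z $ j \<noteq> 0" for z
  proof -
    have t: "torus_pt b z \<in> affine_pts {0}" using z by (intro torus_pt_affine[OF zb]) auto
    have "(z $ j) powi n j = (z $ j) ^ nat (n j + int k) / (z $ j) ^ k" for j
    proof -
      have "(z $ j) powi n j = (z $ j) powi ((n j + int k) - int k)" by simp
      also have "\<dots> = (z $ j) powi (n j + int k) / (z $ j) powi int k"
        using z by (intro power_int_diff) auto
      finally show ?thesis using nk[of j] by (simp add: power_int_nonneg_exp)
    qed
    then have "torus_pt b z m = F z / (\<Prod>j\<in>UNIV. z $ j) ^ k"
      by (simp add: torus_pt_def dual_monoid_zero_cone ml F_def n_def[symmetric] prod_dividef prod_power_distrib)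
    then show ?thesis
      using lvec_zero[OF t frame_cone[OF b] m, of 1]
      by (simp add: xpt_chart[OF b z] unit_section_eq[OF t] restrict_torus_pt)
  qed
  ultimately show "\<exists>k F. holo_fun F UNIV \<and> (\<forall>z. (\<forall>j. z $ j \<noteq> 0) \<longrightarrow>
      unit_section a (xpt \<Sigma> (fcone b) (chart b z))
             = lvec \<Sigma> a (fcone b) m (chart b z) (F z / (\<Prod>j\<in>UNIV. z $ j) ^ k))"
    by blast
next
  show "\<exists>u\<in>int_lattice. \<forall>\<theta>. \<forall>x\<in>open_orbit \<Sigma>.
      unit_section a (xact \<theta> x) = lscale (cis (u \<bullet> \<theta>)) (lact \<theta> (unit_section a x))"
    by (intro bexI[OF _ int_lattice_0])
       (auto simp: open_orbit_eq unit_section_eq xact_xpt affine_pts_ext rot_affine lact_lvec lscale_lvec)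
qed

text \<open>One chart contains the whole open orbit. There the section is a holomorphic numerator
  over a power of the coordinates, and equivariance makes the numerator homogeneous.\<close>

lemma equivariant_section_real:
  assumes s: "equivariant_section \<Sigma> a s"
  shows "\<exists>C. C \<noteq> 0 \<and> (\<exists>u\<in>int_lattice. \<forall>\<xi>. s (xpt \<Sigma> {0} (real_pt \<xi>))
    = lvec \<Sigma> a {0} 0 (real_pt \<xi>) (C * of_real (exp (u \<bullet> \<xi>))))"
proof -
  obtain b where b: "b \<in> frames \<Sigma>" using cone_in_frame[OF zero_cone] by blast
  note zb = frame_zbasis[OF b] and fc = frame_cone[OF b]
  obtain m where m: "m \<in> local_data \<Sigma> a (fcone b)" using local_data_frame_ex[OF b] by blast
  then have ml: "m \<in> int_lattice" by (simp add: local_data_def)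
  obtain k F where F: "holo_fun F UNIV" and sF: "\<And>z. (\<forall>j. z $ j \<noteq> 0) \<Longrightarrow>
     s (xpt \<Sigma> (fcone b) (chart b z)) = lvec \<Sigma> a (fcone b) m (chart b z) (F z / (\<Prod>j\<in>UNIV. z $ j) ^ k)"
    using s b m unfolding equivariant_section_def by meson
  obtain u where u: "u \<in> int_lattice" and equi: "\<And>\<theta> x. x \<in> open_orbit \<Sigma> \<Longrightarrow>
     s (xact \<theta> x) = lscale (cis (u \<bullet> \<theta>)) (lact \<theta> (s x))"
    using s unfolding equivariant_section_def by meson
  \<comment> \<open>The weight collects the character \<open>u\<close> of the section, the rotation
    \<open>m\<close> of the frame \<open>e_m\<close> and the power \<open>k\<close> in the
    denominator.\<close>
  define q :: "real^'n" where "q = (\<chi> j. (u + m) \<bullet> b j + real k)"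
  have hom: "F (\<chi> j. cis (\<theta> $ j) * z $ j) = cis (\<theta> \<bullet> q) * F z" if z: "\<forall>j. z $ j \<noteq> 0" for z \<theta>
  proof -
    define \<Theta> where "\<Theta> = frame_pt b \<theta>"
    define z' where "z' = (\<chi> j. cis (\<theta> $ j) * z $ j)"
    have d\<Theta>: "dualb b j \<bullet> \<Theta> = \<theta> $ j" for j unfolding \<Theta>_def by (rule frame_coords[OF zb])
    have z': "\<forall>j. z' $ j \<noteq> 0" using z by (simp add: z'_def)
    have rc: "rot \<Theta> (fcone b) (chart b z) = chart b z'"
      by (simp add: rot_chart[OF zb] d\<Theta> z'_def)
    have ext: "chart b z \<in> extensional (dual_monoid (fcone b))"
      using chart_affine[OF zb] by (rule affine_pts_ext)
    have "xpt \<Sigma> (fcone b) (chart b z) \<in> open_orbit \<Sigma>"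
      using z by (auto simp: xpt_chart[OF b z] open_orbit_eq intro!: torus_pt_affine[OF zb])
    from equi[OF this, of \<Theta>]
    have "lvec \<Sigma> a (fcone b) m (chart b z') (F z' / (\<Prod>j\<in>UNIV. z' $ j) ^ k)
       = lvec \<Sigma> a (fcone b) m (chart b z') (cis (u \<bullet> \<Theta>) * (cis (m \<bullet> \<Theta>) * (F z / (\<Prod>j\<in>UNIV. z $ j) ^ k)))"
      unfolding sF[OF z] xact_xpt[OF ext] lact_lvec[OF ext] lscale_lvec rc sF[OF z'] .
    then have eq: "F z' / (\<Prod>j\<in>UNIV. z' $ j) ^ k = cis (u \<bullet> \<Theta>) * (cis (m \<bullet> \<Theta>) * (F z / (\<Prod>j\<in>UNIV. z $ j) ^ k))"
      by (rule lvec_inject[OF fc m chart_affine[OF zb]])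
    have nz: "(\<Prod>j\<in>UNIV. z $ j) \<noteq> 0" "(\<Prod>j\<in>UNIV. z' $ j) \<noteq> 0" using z z' by auto
    have pz': "(\<Prod>j\<in>UNIV. z' $ j) = cis (\<Sum>j\<in>UNIV. \<theta> $ j) * (\<Prod>j\<in>UNIV. z $ j)"
      by (simp add: z'_def prod.distrib cis_sum)
    have "F z' = (F z' / (\<Prod>j\<in>UNIV. z' $ j) ^ k) * (\<Prod>j\<in>UNIV. z' $ j) ^ k" using nz by simp
    also have "\<dots> = cis (u \<bullet> \<Theta>) * cis (m \<bullet> \<Theta>) * cis (\<Sum>j\<in>UNIV. \<theta> $ j) ^ k * F z"
      unfolding eq unfolding pz' using nz by (simp add: power_mult_distrib field_simps)
    also have "cis (u \<bullet> \<Theta>) * cis (m \<bullet> \<Theta>) * cis (\<Sum>j\<in>UNIV. \<theta> $ j) ^ k = cis (\<theta> \<bullet> q)"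
    proof -
      have "\<theta> \<bullet> q = (\<Sum>j\<in>UNIV. \<theta> $ j * (u \<bullet> b j) + \<theta> $ j * (m \<bullet> b j) + real k * \<theta> $ j)"
        by (simp add: q_def inner_vec_def[of \<theta>] inner_add_left algebra_simps)
      also have "\<dots> = u \<bullet> \<Theta> + m \<bullet> \<Theta> + real k * (\<Sum>j\<in>UNIV. \<theta> $ j)"
        by (simp add: \<Theta>_def frame_pt_def inner_sum_right sum.distrib sum_distrib_left)
      finally show ?thesis by (simp add: Complex.DeMoivre cis_mult)
    qed
    finally show ?thesis by (simp add: z'_def)
  qed
  obtain C where C: "\<And>t. F (\<chi> j. of_real (exp (t $ j))) = C * of_real (exp (t \<bullet> q))"
    using homogeneous_holomorphic[OF F hom] by blast
  \<comment> \<open>Otherwise homogeneity and polar decomposition make \<open>F\<close>, and with it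
    \<open>s\<close>, vanish on the whole open orbit.\<close>
  have "C \<noteq> 0"
  proof
    assume "C = 0"
    have F0: "F z = 0" if z: "\<forall>j. z $ j \<noteq> 0" for z
    proof -
      define z0 :: "complex^'n" where "z0 = (\<chi> j. of_real (exp ((\<chi> j. ln (norm (z $ j))) $ j)))"
      have "z = (\<chi> j. cis ((\<chi> j. Arg (z $ j)) $ j) * z0 $ j)"
        using z by (simp add: vec_eq_iff z0_def) (metis rcis_cmod_Arg rcis_def mult.commute)
      moreover have "F (\<chi> j. cis ((\<chi> j. Arg (z $ j)) $ j) * z0 $ j) = cis ((\<chi> j. Arg (z $ j)) \<bullet> q) * F z0"
        by (rule hom) (simp add: z0_def)
      moreover have "F z0 = 0" unfolding z0_def C by (simp add: \<open>C = 0\<close>)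
      ultimately show ?thesis by simp
    qed
    have "s x = lscale 0 (s x)" if x: "x \<in> open_orbit \<Sigma>" for x
    proof -
      obtain \<gamma> where \<gamma>: "\<gamma> \<in> affine_pts {0}" "x = xpt \<Sigma> {0} \<gamma>" using x by (auto simp: open_orbit_eq)
      define z where "z = (\<chi> j. \<gamma> (dualb b j))"
      have z: "\<forall>j. z $ j \<noteq> 0" "\<gamma> = torus_pt b z" using affine_torus_pt[OF zb \<gamma>(1)] by (auto simp: z_def)
      show ?thesis unfolding \<gamma>(2) z(2) xpt_chart[OF b z(1), symmetric] sF[OF z(1)] lscale_lvec
        by (simp add: F0[OF z(1)])
    qed
    with s show False unfolding equivariant_section_def by blast
  qed
  moreover have "s (xpt \<Sigma> {0} (real_pt \<xi>)) = lvec \<Sigma> a {0} 0 (real_pt \<xi>) (C * of_real (exp (u \<bullet> \<xi>)))" for \<xi>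
  proof -
    define t where "t = (\<chi> j. dualb b j \<bullet> \<xi>)"
    define z :: "complex^'n" where "z = (\<chi> j. of_real (exp (t $ j)))"
    have z: "\<forall>j. z $ j \<noteq> 0" by (simp add: z_def)
    have rp: "torus_pt b z = real_pt \<xi>" using torus_pt_real[OF zb, of \<xi>] by (simp add: z_def t_def)
    have "(\<Prod>j\<in>UNIV. z $ j) ^ k = of_real (exp (real k * (\<Sum>j\<in>UNIV. t $ j)))"
      by (simp add: z_def exp_sum exp_of_nat_mult of_real_prod[symmetric] of_real_power[symmetric] del: of_real_prod of_real_power)
    moreover have "t \<bullet> q = (u + m) \<bullet> \<xi> + real k * (\<Sum>j\<in>UNIV. t $ j)"
    proof -
      have "t \<bullet> q = (\<Sum>j\<in>UNIV. (dualb b j \<bullet> \<xi>) * ((u + m) \<bullet> b j) + real k * t $ j)"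
        unfolding inner_vec_def[of t] by (simp add: q_def t_def algebra_simps)
      then show ?thesis unfolding zbasis_inner_expand[OF zb, of "u + m" \<xi>]
        by (simp add: sum.distrib sum_distrib_left)
    qed
    ultimately have "F z / (\<Prod>j\<in>UNIV. z $ j) ^ k = C * of_real (exp ((u + m) \<bullet> \<xi>))"
      unfolding C[of t, folded z_def] by (simp add: exp_add of_real_mult)
    also have "\<dots> = real_pt \<xi> m * (C * of_real (exp (u \<bullet> \<xi>)))"
      by (simp add: real_pt_def dual_monoid_zero_cone ml inner_add_left exp_add)
    finally have e: "F z / (\<Prod>j\<in>UNIV. z $ j) ^ k = real_pt \<xi> m * (C * of_real (exp (u \<bullet> \<xi>)))" .
    show ?thesis
      unfolding rp[symmetric] xpt_chart[OF b z, symmetric] sF[OF z] e[unfolded rp[symmetric]]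
      using lvec_zero[OF torus_pt_affine[OF zb] fc m, of z "C * of_real (exp (u \<bullet> \<xi>))"] z
      by (simp add: restrict_torus_pt)
  qed
  ultimately show ?thesis using u by blast
qed

text \<open>The potential for the section 1, free of the choice made in
  \<open>syz_mirror\<close>.\<close>

definition unit_potential :: "(real^'n \<Rightarrow> int) \<Rightarrow> ('n lvect \<Rightarrow> 'n lvect \<Rightarrow> complex) \<Rightarrow> real^'n \<Rightarrow> real" where
  "unit_potential a h \<xi> =
     - (1/2) * ln (Re (h (lvec \<Sigma> a {0} 0 (real_pt \<xi>) 1) (lvec \<Sigma> a {0} 0 (real_pt \<xi>) 1)))"

lemma syz_mirror_eq:
  assumes h: "hermitian_metric \<Sigma> a h" and C2: "C2_fun (unit_potential a h)"
  shows "syz_mirror \<Sigma> a h = section_of_potential (unit_potential a h)"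
proof -
  let ?s = "SOME s. equivariant_section \<Sigma> a s" and ?g = "unit_potential a h"
  have "equivariant_section \<Sigma> a ?s"
    by (rule someI[of "equivariant_section \<Sigma> a", OF equivariant_unit_section])
  then obtain C u where C: "C \<noteq> 0" and u: "u \<in> int_lattice"
    and s: "\<And>\<xi>. ?s (xpt \<Sigma> {0} (real_pt \<xi>)) = lvec \<Sigma> a {0} 0 (real_pt \<xi>) (C * of_real (exp (u \<bullet> \<xi>)))"
    using equivariant_section_real by metis
  \<comment> \<open>On real points the section picked by \<open>SOME\<close> is
    \<open>C \<chi>^u\<close> times the section 1, which changes the potential by an affine
    function.\<close>
  have pot: "metric_potential \<Sigma> h ?s \<xi> = ?g \<xi> - (ln (norm C) + u \<bullet> \<xi>)" for \<xi>
  proof -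
    obtain H where H: "H > (0::real)" and hH: "\<And>c d. h (lvec \<Sigma> a {0} 0 (real_pt \<xi>) c) (lvec \<Sigma> a {0} 0 (real_pt \<xi>) d) = c * cnj d * of_real H"
      using h zero_cone zero_local_data real_pt_affine unfolding hermitian_metric_def by meson
    have "Re (C * of_real (exp (u \<bullet> \<xi>)) * cnj (C * of_real (exp (u \<bullet> \<xi>))) * of_real H) = (norm C * exp (u \<bullet> \<xi>))\<^sup>2 * H"
      by (simp add: complex_norm_square[symmetric] del: complex_cnj_mult) (simp add: norm_mult)
    moreover have "ln ((norm C * exp (u \<bullet> \<xi>))\<^sup>2 * H) = 2 * (ln (norm C) + u \<bullet> \<xi>) + ln H"
      using C H by (simp add: ln_mult ln_realpow)
    ultimately show ?thesis
      by (simp add: metric_potential_def Let_def orbit_pt_def orbit_hom_real s hH unit_potential_def algebra_simps)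
  qed
  have "grad (metric_potential \<Sigma> h ?s) \<xi> = grad ?g \<xi> - u" for \<xi>
  proof -
    have "((\<lambda>\<xi>. ?g \<xi> - (ln (norm C) + u \<bullet> \<xi>)) has_derivative (\<lambda>v. dir_deriv ?g \<xi> v - u \<bullet> v)) (at \<xi>)"
      by (auto intro!: derivative_eq_intros C2_fun_dir_deriv(1)[OF C2])
    then have "(metric_potential \<Sigma> h ?s has_derivative (\<lambda>v. dir_deriv ?g \<xi> v - u \<bullet> v)) (at \<xi>)"
      unfolding pot[abs_def] .
    from dir_derivI[OF this] show ?thesis by (simp add: grad_def vec_eq_iff inner_axis)
  qed
  then show ?thesis unfolding syz_mirror_def section_of_potential_def by (simp add: mcoset_diff[OF u])
qed

end

section \<open>From metrics to sections satisfying the growth condition\<close>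

text \<open>For \<open>m\<close> in the local data of the cone, the summand \<open>a (b j)\<close>
  is \<open>m \<bullet> b j\<close>, the derivative of the linear term relating the section 1 to the
  frame \<open>e_m\<close>.\<close>

definition frame_deriv ::
  "(real^'n \<Rightarrow> real) \<Rightarrow> (real^'n \<Rightarrow> int) \<Rightarrow> ('n::finite \<Rightarrow> real^'n) \<Rightarrow> 'n \<Rightarrow> real^'n \<Rightarrow> real" where
  "frame_deriv g a b j t = dir_deriv g (frame_pt b t) (b j) + of_int (a (b j))"

definition frame_hess :: "(real^'n \<Rightarrow> real) \<Rightarrow> ('n::finite \<Rightarrow> real^'n) \<Rightarrow> 'n \<Rightarrow> 'n \<Rightarrow> real^'n \<Rightarrow> real" where
  "frame_hess g b k j t = hess g (frame_pt b t) (b k) (b j)"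

lemma growth_iff:
  "growth \<Sigma> a y \<longleftrightarrow> (\<exists>g. C2_fun g \<and> y = grad g \<and> (\<forall>b\<in>frames \<Sigma>. frame_growth (frame_deriv g a b) (frame_hess g b)))"
  unfolding growth_def frame_growth_def frame_deriv_def frame_hess_def[abs_def] frame_pt_def Let_def ..

lemma
  fixes b :: "'n::finite \<Rightarrow> real^'n"
  assumes "C2_fun g"
  shows frame_has_derivative: "(\<And>j. m \<bullet> b j = of_int (a (b j))) \<Longrightarrow>
      ((\<lambda>t. g (frame_pt b t) + m \<bullet> frame_pt b t) has_derivative (\<lambda>v. \<Sum>j\<in>UNIV. frame_deriv g a b j t * v $ j)) (at t)"
    and frame_deriv_has_derivative:
      "(frame_deriv g a b j has_derivative (\<lambda>v. \<Sum>k\<in>UNIV. frame_hess g b k j t * v $ k)) (at t)"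
    and frame_hess_continuous: "continuous_on UNIV (frame_hess g b k j)"
proof -
  note D = C2_fun_dir_deriv[OF assms(1)]
  have L: "bounded_linear (frame_pt b)" unfolding frame_pt_def[abs_def]
    by (intro bounded_linear_sum bounded_linear_scaleR_const bounded_linear_vec_nth)
  have expand: "f (frame_pt b v) = (\<Sum>j\<in>UNIV. f (b j) * v $ j)" if "linear f" for f :: "real^'n \<Rightarrow> real" and v
    unfolding frame_pt_def linear_sum[OF that] linear_cmul[OF that] by (simp add: mult.commute)
  have inner: "linear (\<lambda>x. m \<bullet> x)" by (intro bounded_linear.linear bounded_linear_inner_right)
  note dL = bounded_linear_imp_has_derivative[OF L]
  show "((\<lambda>t. g (frame_pt b t) + m \<bullet> frame_pt b t) has_derivative (\<lambda>v. \<Sum>j\<in>UNIV. frame_deriv g a b j t * v $ j)) (at t)"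
    if "\<And>j. m \<bullet> b j = of_int (a (b j))"
    by (rule has_derivative_eq_rhs[OF has_derivative_add[OF has_derivative_compose[OF dL D(1)] has_derivative_inner_right[OF dL]]])
       (simp only: expand[OF has_derivative_linear[OF D(1)]] expand[OF inner] that frame_deriv_def distrib_right sum.distrib)
  show "(frame_deriv g a b j has_derivative (\<lambda>v. \<Sum>k\<in>UNIV. frame_hess g b k j t * v $ k)) (at t)"
    unfolding frame_deriv_def[abs_def]
    by (rule has_derivative_eq_rhs[OF has_derivative_add[OF has_derivative_compose[OF dL D(3)] has_derivative_const]])
       (simp only: expand[OF has_derivative_linear[OF D(3)]] frame_hess_def add_0_right)
  show "continuous_on UNIV (frame_hess g b k j)" unfolding frame_hess_def[abs_def]
    by (rule continuous_on_compose2[OF D(4) linear_continuous_on[OF L]]) simp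
qed

text \<open>The derivative of \<open>grad g\<close> is the Hessian, and \<open>omega_Y\<close> on
  two tangent vectors of the graph measures its failure to be symmetric.\<close>

lemma lagrangian_section_of_potential:
  assumes "C2_fun g"
  shows "is_lift (grad g) (section_of_potential g)" "lagrangian_section (section_of_potential g)"
proof -
  show lift: "is_lift (grad g) (section_of_potential g)"
    unfolding is_lift_def section_of_potential_def using C1_fun_grad[OF assms] by simp
  have "omega_Y (p, frechet_derivative (grad g) (at \<xi>) p) (q, frechet_derivative (grad g) (at \<xi>) q) = 0" for \<xi> p q
  proof -
    obtain D where D: "(grad g has_derivative D) (at \<xi>)"
      using C1_fun_grad[OF assms] unfolding C1_fun_iff by blast
    have "D p \<bullet> q = hess g \<xi> p q" for p q
    proof -
      have "((\<lambda>x. grad g x \<bullet> q) has_derivative (\<lambda>p. D p \<bullet> q)) (at \<xi>)"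
        by (rule has_derivative_inner_left[OF D])
      then have "((\<lambda>x. dir_deriv g x q) has_derivative (\<lambda>p. D p \<bullet> q)) (at \<xi>)"
        by (simp only: grad_inner[OF assms])
      from has_derivative_unique[OF this C2_fun_dir_deriv(3)[OF assms]] show ?thesis by metis
    qed
    then show ?thesis
      by (simp add: omega_Y_def frechet_derivative_at[OF D, symmetric] inner_commute[of p] hess_commute[OF assms, of _ p q])
  qed
  with lift show "lagrangian_section (section_of_potential g)" unfolding lagrangian_section_def by blast
qed

lemma AW_mem:
  "a \<in> Zd \<Sigma> \<Longrightarrow> \<exists>A\<in>AW \<Sigma>. a \<in> A"
  "A \<in> AW \<Sigma> \<Longrightarrow> a \<in> A \<Longrightarrow> a \<in> Zd \<Sigma>"
proof -
  assume a: "a \<in> Zd \<Sigma>"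
  then have "iota_rel \<Sigma> `` {a} \<in> AW \<Sigma>" unfolding AW_def by (rule quotientI)
  moreover have "a \<in> iota_rel \<Sigma> `` {a}"
    using a int_lattice_0 by (auto simp: iota_rel_def intro!: bexI[of _ 0])
  ultimately show "\<exists>A\<in>AW \<Sigma>. a \<in> A" by blast
qed (auto simp: AW_def iota_rel_def quotient_def)

context smooth_complete_fan
begin

lemma chart_lfibre:
  assumes "b \<in> frames \<Sigma>" "m \<in> local_data \<Sigma> a (fcone b)"
  shows "xpt \<Sigma> (fcone b) (chart b z) \<in> toric_variety \<Sigma>"
    and "lvec \<Sigma> a (fcone b) m (chart b z) c \<in> lfibre \<Sigma> a (xpt \<Sigma> (fcone b) (chart b z))"
proof -
  note f = frame_cone[OF assms(1)] and c = chart_affine[OF frame_zbasis[OF assms(1)], of z]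
  show "xpt \<Sigma> (fcone b) (chart b z) \<in> toric_variety \<Sigma>"
    unfolding toric_variety_def xpt_def by (intro quotientI SigmaI f c)
  show "lvec \<Sigma> a (fcone b) m (chart b z) c \<in> lfibre \<Sigma> a (xpt \<Sigma> (fcone b) (chart b z))"
    unfolding lfibre_def using f c assms(2) by blast
qed

text \<open>The moduli are replaced by real coordinates of either sign: the metric at the real
  points of the chart gives \<open>\<psi>\<close> on the whole space, and invariance under rotating
  one coordinate by \<open>pi\<close> gives evenness.\<close>

lemma unit_potential_frame:
  assumes h: "h \<in> metrics \<Sigma> a" and b: "b \<in> frames \<Sigma>" and m: "m \<in> local_data \<Sigma> a (fcone b)"
  shows "\<exists>\<psi>::real^'n \<Rightarrow> real. C2_fun \<psi> \<and> (\<forall>l x. \<psi> (upd x l (- x $ l)) = \<psi> x) \<and>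
     (\<forall>\<xi>. unit_potential a h \<xi> = \<psi> (expv (\<chi> j. dualb b j \<bullet> \<xi>)) - m \<bullet> \<xi>)"
proof -
  note zb = frame_zbasis[OF b] and fc = frame_cone[OF b]
  let ?v = "\<lambda>z. lvec \<Sigma> a (fcone b) m (chart b z)"
  define H where "H z = Re (h (?v z 1) (?v z 1))" for z
  have ml: "m \<in> int_lattice" using m by (simp add: local_data_def)
  have hH: "h (?v z c) (?v z d) = c * cnj d * of_real (H z)" and Hpos: "H z > 0" for z c d
  proof -
    have "hermitian_metric \<Sigma> a h" using h by (simp add: metrics_def)
    then obtain H' where "H' > 0" "\<And>c d. h (?v z c) (?v z d) = c * cnj d * of_real H'"
      using fc m chart_affine[OF zb, of z] unfolding hermitian_metric_def by meson
    then show "h (?v z c) (?v z d) = c * cnj d * of_real (H z)" "H z > 0" by (simp_all add: H_def)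
  qed
  have "C2_fun (\<lambda>z. h (?v z 1) (?v z 1))"
    using h b m by (simp add: metrics_def C2_metric_def)
  then have C2H: "C2_fun H" unfolding H_def[abs_def] by (rule C2_fun_bounded_linear[OF bounded_linear_Re])
  have inv: "H (\<chi> j. cis (\<theta> $ j) * z $ j) = H z" for z \<theta>
  proof -
    let ?\<Theta> = "frame_pt b \<theta>"
    have ext: "chart b z \<in> extensional (dual_monoid (fcone b))" using chart_affine[OF zb] by (rule affine_pts_ext)
    have "h (lact ?\<Theta> (?v z 1)) (lact ?\<Theta> (?v z 1)) = h (?v z 1) (?v z 1)"
      using h chart_lfibre[OF b m, of z] by (simp add: metrics_def TN_invariant_def)
    then show ?thesis
      unfolding lact_lvec[OF ext] rot_chart[OF zb] hH frame_coords[OF zb] by (simp add: cis_cnj cis_mult)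
  qed
  define \<psi> where "\<psi> x = - (1/2) * ln (H (\<chi> j. of_real (x $ j)))" for x :: "real^'n"
  have "C2_fun (\<lambda>x::real^'n. \<chi> j. complex_of_real (x $ j))"
    by (intro C2_fun_componentwise C2_fun_linear bounded_linear_compose[OF bounded_linear_of_real bounded_linear_vec_nth])
  from C2_fun_compose[OF C2H this] have "C2_fun (\<lambda>x::real^'n. H (\<chi> j. of_real (x $ j)))" .
  then have "C2_fun \<psi>" unfolding \<psi>_def[abs_def]
    by (intro C2_fun_bounded_linear[OF bounded_linear_mult_right] C2_fun_ln Hpos)
  moreover have "\<psi> (upd x l (- x $ l)) = \<psi> x" for l x
  proof -
    have "(\<chi> j. complex_of_real (upd x l (- x $ l) $ j)) = (\<chi> j. cis ((pi *\<^sub>R axis l 1 :: real^'n) $ j) * (\<chi> j. of_real (x $ j)) $ j)"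
      by (simp add: vec_eq_iff axis_def)
    then show ?thesis unfolding \<psi>_def by (simp only: inv)
  qed
  moreover have "unit_potential a h \<xi> = \<psi> (expv (\<chi> j. dualb b j \<bullet> \<xi>)) - m \<bullet> \<xi>" for \<xi>
  proof -
    define z :: "complex^'n" where "z = (\<chi> j. of_real (exp (dualb b j \<bullet> \<xi>)))"
    have "restrict (real_pt \<xi>) (dual_monoid (fcone b)) = chart b z"
      unfolding torus_pt_real[OF zb, symmetric] restrict_torus_pt z_def ..
    \<comment> \<open>The section 1 is \<open>\<chi>^m e_m\<close>; after taking half of the
      logarithm this contributes \<open>- m \<bullet> \<xi>\<close>.\<close>
    then have "lvec \<Sigma> a {0} 0 (real_pt \<xi>) 1 = ?v z (of_real (exp (m \<bullet> \<xi>)))"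
      using lvec_zero[OF real_pt_affine fc m, of \<xi> 1]
      by (simp add: real_pt_def dual_monoid_zero_cone ml)
    then have "unit_potential a h \<xi> = - (1/2) * ln (exp (m \<bullet> \<xi>) * exp (m \<bullet> \<xi>) * H z)"
      by (simp add: unit_potential_def hH)
    also have "\<dots> = - (1/2) * ln (H z) - m \<bullet> \<xi>" using Hpos[of z] by (simp add: ln_mult field_simps)
    also have "- (1/2) * ln (H z) = \<psi> (expv (\<chi> j. dualb b j \<bullet> \<xi>))" by (simp add: \<psi>_def z_def)
    finally show ?thesis .
  qed
  ultimately show ?thesis by blast
qed

lemma unit_potential_C2:
  assumes "h \<in> metrics \<Sigma> a"
  shows "C2_fun (unit_potential a h)"
proof -
  obtain b where b: "b \<in> frames \<Sigma>" using cone_in_frame[OF zero_cone] by blast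
  then obtain m where m: "m \<in> local_data \<Sigma> a (fcone b)" using local_data_frame_ex by blast
  obtain \<psi> :: "real^'n \<Rightarrow> real" where \<psi>: "C2_fun \<psi>"
    "unit_potential a h = (\<lambda>\<xi>. \<psi> (expv (\<chi> j. dualb b j \<bullet> \<xi>)) + - (m \<bullet> \<xi>))"
    using unit_potential_frame[OF assms b m] by (auto simp: fun_eq_iff)
  have "C2_fun (\<lambda>\<xi>::real^'n. expv (\<chi> j. dualb b j \<bullet> \<xi>))" unfolding expv_def
    by (intro C2_fun_componentwise C2_fun_compose[OF C2_fun_exp])
      (simp add: C2_fun_linear bounded_linear_inner_right)
  then show ?thesis unfolding \<psi>(2)
    by (rule C2_fun_add[OF C2_fun_compose[OF \<psi>(1)] C2_fun_linear[OF bounded_linear_minus[OF bounded_linear_inner_right]]])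
qed

lemma unit_potential_growth:
  assumes "h \<in> metrics \<Sigma> a"
  shows "growth \<Sigma> a (grad (unit_potential a h))"
proof -
  let ?g = "unit_potential a h"
  note C2 = unit_potential_C2[OF assms]
  show ?thesis
    unfolding growth_iff
  proof (intro exI[of _ ?g] conjI C2 refl ballI)
    fix b assume b: "b \<in> frames \<Sigma>"
    note zb = frame_zbasis[OF b]
    obtain m where m: "m \<in> local_data \<Sigma> a (fcone b)" using local_data_frame_ex[OF b] by blast
    then have mb: "m \<bullet> b j = of_int (a (b j))" for j by (simp add: local_data_frame[OF b])
    obtain \<psi> :: "real^'n \<Rightarrow> real" where \<psi>: "C2_fun \<psi>" "\<And>l x. \<psi> (upd x l (- x $ l)) = \<psi> x"
      "\<And>\<xi>. ?g \<xi> = \<psi> (expv (\<chi> j. dualb b j \<bullet> \<xi>)) - m \<bullet> \<xi>"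
      using unit_potential_frame[OF assms b m] by auto
    have "\<psi> (expv t) = ?g (frame_pt b t) + m \<bullet> frame_pt b t" for t
      by (simp add: \<psi>(3) frame_coords[OF zb] vec_lambda_eta)
    then have "((\<lambda>t. \<psi> (expv t)) has_derivative (\<lambda>v. \<Sum>j\<in>UNIV. frame_deriv ?g a b j t * v $ j)) (at t)" for t
      using frame_has_derivative[where a = a and b = b, OF C2 mb] by simp
    then show "frame_growth (frame_deriv ?g a b) (frame_hess ?g b)"
      by (rule growth_of_invariant_C2[OF \<psi>(1,2)]) (rule frame_deriv_has_derivative[OF C2])
  qed
qed

lemma syz_mirror_growth:
  assumes "a \<in> Zd \<Sigma>" "h \<in> metrics \<Sigma> a"
  shows "lagrangian_section (syz_mirror \<Sigma> a h)" "\<exists>A\<in>AW \<Sigma>. growth_class \<Sigma> A (syz_mirror \<Sigma> a h)"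
proof -
  note C2 = unit_potential_C2[OF assms(2)]
  have eq: "syz_mirror \<Sigma> a h = section_of_potential (unit_potential a h)"
    using assms(2) by (intro syz_mirror_eq C2) (simp add: metrics_def)
  note lag = lagrangian_section_of_potential[OF C2]
  show "lagrangian_section (syz_mirror \<Sigma> a h)" unfolding eq by (rule lag)
  obtain A where "A \<in> AW \<Sigma>" "a \<in> A" using AW_mem(1)[OF assms(1)] by blast
  then show "\<exists>A\<in>AW \<Sigma>. growth_class \<Sigma> A (syz_mirror \<Sigma> a h)"
    unfolding eq growth_class_def using lag(1) unit_potential_growth[OF assms(2)] by blast
qed

end

section \<open>The metric of a potential\<close>

text \<open>\<open>H = h(e\<^sub>m, e\<^sub>m)\<close> at the point \<open>\<gamma>\<close> of \<open>U\<^sub>\<sigma>\<close>, as the limit of its values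
  \<open>exp (-2 g(\<xi>) - 2 \<langle>m,\<xi>\<rangle>)\<close> on the open orbit; this is visibly independent of the chart.\<close>

definition is_norm_sq :: "(real^'n \<Rightarrow> real) \<Rightarrow> (real^'n) set \<Rightarrow> real^'n \<Rightarrow> (real^'n \<Rightarrow> complex) \<Rightarrow> real \<Rightarrow> bool" where
  "is_norm_sq g \<sigma> m \<gamma> H \<longleftrightarrow> H > 0 \<and>
     (\<forall>X. tends_to_pt \<sigma> \<gamma> X \<longrightarrow> (\<lambda>k. exp (- 2 * (g (X k) + m \<bullet> X k))) \<longlonglongrightarrow> H)"

lemma exp_norm_sq_shift:
  fixes m m' x :: "real^'n"
  shows "exp (- 2 * (r + m \<bullet> x)) = (exp ((m' - m) \<bullet> x))\<^sup>2 * exp (- 2 * (r + m' \<bullet> x))"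
  by (simp add: exp_double[symmetric] exp_add[symmetric] inner_diff_left algebra_simps)

context smooth_complete_fan
begin

text \<open>A sequence approaching the chart point in moduli lifts to one in \<open>C^n\<close>
  converging to \<open>z\<close>, and continuity of the extended potential identifies the limit,
  also on the hyperplanes.\<close>

lemma norm_sq_chart:
  assumes g: "C2_fun g" and gr: "growth \<Sigma> a (grad g)" and b: "b \<in> frames \<Sigma>" and m: "m \<in> local_data \<Sigma> a (fcone b)"
  shows "\<exists>\<phi>. C2_fun \<phi> \<and> (\<forall>z. is_norm_sq g (fcone b) m (chart b z) (exp (- 2 * \<phi> z)))"
proof -
  note zb = frame_zbasis[OF b]
  have mb: "m \<bullet> b j = of_int (a (b j))" for j using m by (simp add: local_data_frame[OF b])
  \<comment> \<open>\<open>growth\<close> only provides some potential with the same gradient; its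
    first and second derivatives agree with those of \<open>g\<close>.\<close>
  obtain g0 where g0: "C2_fun g0" "grad g = grad g0" "frame_growth (frame_deriv g0 a b) (frame_hess g0 b)"
    using gr b unfolding growth_iff by blast
  have dd: "dir_deriv g0 = dir_deriv g"
    unfolding fun_eq_iff using grad_inner[OF g] grad_inner[OF g0(1)] g0(2) by metis
  then have "hess g0 = hess g" unfolding hess_def fun_eq_iff by simp
  with g0(3) dd have fg: "frame_growth (frame_deriv g a b) (frame_hess g b)"
    unfolding frame_deriv_def[abs_def] frame_hess_def[abs_def] by simp
  obtain \<phi> :: "complex^'n \<Rightarrow> real" where \<phi>: "C2_fun \<phi>" "\<And>z. (\<forall>j. z $ j \<noteq> 0) \<Longrightarrow>
      \<phi> z = g (frame_pt b (\<chi> j. ln (norm (z $ j)))) + m \<bullet> frame_pt b (\<chi> j. ln (norm (z $ j)))"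
    using potential_extends[OF frame_has_derivative[where a = a and b = b, OF g mb] frame_deriv_has_derivative[OF g] frame_hess_continuous[OF g] fg]
    by blast
  have "is_norm_sq g (fcone b) m (chart b z) (exp (- 2 * \<phi> z))" for z
    unfolding is_norm_sq_def
  proof (intro conjI allI impI exp_gt_zero)
    fix X assume X: "tends_to_pt (fcone b) (chart b z) X"
    \<comment> \<open>Moduli come from \<open>X k\<close> and arguments from \<open>z\<close>. At a
      vanishing coordinate the phase is set to 1, since \<open>sgn 0 = 0\<close> would destroy the
      modulus.\<close>
    define Z :: "nat \<Rightarrow> complex^'n" where
      "Z k = (\<chi> j. of_real (exp (dualb b j \<bullet> X k)) * (if z $ j = 0 then 1 else sgn (z $ j)))" for k
    have "Z \<longlonglongrightarrow> z"
    proof (rule vec_tendstoI)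
      fix j
      have "dualb b j \<in> dual_monoid (fcone b)"
        by (rule dualb_in_dual(1)[OF b frame_cone[OF b] order_refl])
      then have "(\<lambda>k. exp (dualb b j \<bullet> X k)) \<longlonglongrightarrow> norm (z $ j)"
        using X unfolding tends_to_pt_def by (metis chart_dualb[OF zb])
      then have "(\<lambda>k. Z k $ j) \<longlonglongrightarrow> of_real (norm (z $ j)) * (if z $ j = 0 then 1 else sgn (z $ j))"
        unfolding Z_def vec_lambda_beta by (intro tendsto_intros)
      also have "of_real (norm (z $ j)) * (if z $ j = 0 then 1 else sgn (z $ j)) = z $ j"
        by (simp add: sgn_eq)
      finally show "(\<lambda>k. Z k $ j) \<longlonglongrightarrow> z $ j" .
    qed
    moreover have "isCont \<phi> z"
      using C1_fun_continuous[OF C2_fun_imp_C1[OF \<phi>(1)]] by (simp add: continuous_on_eq_continuous_at)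
    ultimately have "(\<lambda>k. \<phi> (Z k)) \<longlonglongrightarrow> \<phi> z" by (rule isCont_tendsto_compose[rotated])
    moreover have "\<phi> (Z k) = g (X k) + m \<bullet> X k" for k
    proof -
      have "norm (Z k $ j) = exp (dualb b j \<bullet> X k)" for j by (simp add: Z_def norm_mult norm_sgn)
      moreover from this have "\<forall>j. Z k $ j \<noteq> 0" by (metis exp_not_eq_zero norm_zero)
      ultimately show ?thesis by (simp add: \<phi>(2) frame_pt_def dualb_expand[OF zb])
    qed
    ultimately show "(\<lambda>k. exp (- 2 * (g (X k) + m \<bullet> X k))) \<longlonglongrightarrow> exp (- 2 * \<phi> z)"
      by (simp only:) (intro tendsto_intros)
  qed
  with \<phi>(1) show ?thesis by blast
qed

text \<open>For a smaller cone the value is taken in a full cone containing it and corrected by the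
  character \<open>m' - m\<close>, which is nonzero at \<open>\<gamma>\<close>.\<close>

lemma norm_sq_exists:
  assumes g: "C2_fun g" and gr: "growth \<Sigma> a (grad g)"
    and \<sigma>: "\<sigma> \<in> \<Sigma>" and m: "m \<in> local_data \<Sigma> a \<sigma>" and \<gamma>: "\<gamma> \<in> affine_pts \<sigma>"
  shows "\<exists>H. is_norm_sq g \<sigma> m \<gamma> H"
proof -
  obtain b where b: "b \<in> frames \<Sigma>" "\<sigma> \<subseteq> fcone b" using cone_in_frame[OF \<sigma>] by blast
  obtain m' where m': "m' \<in> local_data \<Sigma> a (fcone b)" using local_data_frame_ex[OF b(1)] by blast
  let ?\<gamma>' = "restrict \<gamma> (dual_monoid (fcone b))"
  have "?\<gamma>' \<in> affine_pts (fcone b)" by (rule affine_pts_restrict[OF \<gamma> b(2)])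
  then obtain H where H: "is_norm_sq g (fcone b) m' ?\<gamma>' H"
    using norm_sq_chart[OF g gr b(1) m'] affine_chart[OF b(1)] by metis
  have d: "m' - m \<in> dual_monoid \<sigma>" by (rule local_data_diff[OF \<sigma> order_refl b(2) m m'])
  have "- (m' - m) \<in> dual_monoid \<sigma>" using local_data_diff[OF \<sigma> b(2) order_refl m' m] by simp
  then have nz: "\<gamma> (m' - m) \<noteq> 0" by (rule affine_pts_nonzero[OF \<gamma> d])
  have "is_norm_sq g \<sigma> m \<gamma> ((norm (\<gamma> (m' - m)))\<^sup>2 * H)"
    unfolding is_norm_sq_def
  proof (intro conjI allI impI)
    show "(norm (\<gamma> (m' - m)))\<^sup>2 * H > 0" using nz H by (simp add: is_norm_sq_def)
    fix X assume X: "tends_to_pt \<sigma> \<gamma> X"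
    then have 1: "(\<lambda>k. exp ((m' - m) \<bullet> X k)) \<longlonglongrightarrow> norm (\<gamma> (m' - m))" using d by (simp add: tends_to_pt_def)
    have 2: "(\<lambda>k. exp (- 2 * (g (X k) + m' \<bullet> X k))) \<longlonglongrightarrow> H"
      using H tends_to_pt_restrict[OF X b(2)] by (simp add: is_norm_sq_def)
    show "(\<lambda>k. exp (- 2 * (g (X k) + m \<bullet> X k))) \<longlonglongrightarrow> (norm (\<gamma> (m' - m)))\<^sup>2 * H"
      unfolding exp_norm_sq_shift[of _ m _ m'] by (intro tendsto_intros 1 2)
  qed
  then show ?thesis by blast
qed

text \<open>One sequence approaching \<open>\<delta>\<close> computes both values. Its existence is
  essential: without such a sequence \<open>is_norm_sq\<close> would hold for every positive
  number.\<close>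

lemma norm_sq_transition:
  assumes "\<sigma> \<in> \<Sigma>" "\<sigma>' \<in> \<Sigma>" "m \<in> local_data \<Sigma> a \<sigma>" "m' \<in> local_data \<Sigma> a \<sigma>'" "\<delta> \<in> affine_pts (\<sigma> \<inter> \<sigma>')"
    and H: "is_norm_sq g \<sigma> m (restrict \<delta> (dual_monoid \<sigma>)) H"
    and H': "is_norm_sq g \<sigma>' m' (restrict \<delta> (dual_monoid \<sigma>')) H'"
  shows "H = (norm (\<delta> (m' - m)))\<^sup>2 * H'"
proof -
  have \<tau>: "\<sigma> \<inter> \<sigma>' \<in> \<Sigma>" using cone_Int assms(1,2) by blast
  obtain X where X: "tends_to_pt (\<sigma> \<inter> \<sigma>') \<delta> X" using tends_to_pt_exists[OF \<tau> assms(5)] by blast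
  have "m' - m \<in> dual_monoid (\<sigma> \<inter> \<sigma>')"
    by (rule local_data_diff[OF \<tau> Int_lower1 Int_lower2 assms(3,4)])
  then have 1: "(\<lambda>k. exp ((m' - m) \<bullet> X k)) \<longlonglongrightarrow> norm (\<delta> (m' - m))" using X by (simp add: tends_to_pt_def)
  have 2: "(\<lambda>k. exp (- 2 * (g (X k) + m' \<bullet> X k))) \<longlonglongrightarrow> H'"
    using H' tends_to_pt_restrict[OF X Int_lower2] by (simp add: is_norm_sq_def)
  have "(\<lambda>k. exp (- 2 * (g (X k) + m \<bullet> X k))) \<longlonglongrightarrow> (norm (\<delta> (m' - m)))\<^sup>2 * H'"
    unfolding exp_norm_sq_shift[of _ m _ m'] by (intro tendsto_intros 1 2)
  moreover have "(\<lambda>k. exp (- 2 * (g (X k) + m \<bullet> X k))) \<longlonglongrightarrow> H"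
    using H tends_to_pt_restrict[OF X Int_lower1] by (simp add: is_norm_sq_def)
  ultimately show ?thesis by (rule LIMSEQ_unique[rotated])
qed

section \<open>The hermitian metric glued from the local norms\<close>

definition pairing :: "(real^'n \<Rightarrow> real) \<Rightarrow> (real^'n \<Rightarrow> int) \<Rightarrow> 'n lvect \<Rightarrow> 'n lvect \<Rightarrow> complex \<Rightarrow> bool" where
  "pairing g a p q v \<longleftrightarrow> (\<exists>\<sigma>\<in>\<Sigma>. \<exists>m\<in>local_data \<Sigma> a \<sigma>. \<exists>\<gamma>\<in>affine_pts \<sigma>. \<exists>c d H.
     p = lvec \<Sigma> a \<sigma> m \<gamma> c \<and> q = lvec \<Sigma> a \<sigma> m \<gamma> d \<and> is_norm_sq g \<sigma> m \<gamma> H \<and> v = c * cnj d * of_real H)"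

text \<open>Vectors in different fibres, which have no common frame, get the junk value 0.\<close>

definition potential_metric :: "(real^'n \<Rightarrow> real) \<Rightarrow> (real^'n \<Rightarrow> int) \<Rightarrow> 'n lvect \<Rightarrow> 'n lvect \<Rightarrow> complex" where
  "potential_metric g a p q = (if \<exists>v. pairing g a p q v then SOME v. pairing g a p q v else 0)"

text \<open>The transition points of \<open>p\<close> and \<open>q\<close> restrict to the same
  point over \<open>\<sigma>\<close>, hence coincide; the transition factor and its conjugate then
  match the change from \<open>H'\<close> to \<open>H\<close>.\<close>

lemma pairing_unique:
  assumes "pairing g a p q v" "pairing g a p q v'"
  shows "v = v'"
proof -
  obtain \<sigma> m \<gamma> c d H where 1: "\<sigma> \<in> \<Sigma>" "m \<in> local_data \<Sigma> a \<sigma>" "\<gamma> \<in> affine_pts \<sigma>"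
    "p = lvec \<Sigma> a \<sigma> m \<gamma> c" "q = lvec \<Sigma> a \<sigma> m \<gamma> d" "is_norm_sq g \<sigma> m \<gamma> H" "v = c * cnj d * of_real H"
    using assms(1) unfolding pairing_def by blast
  obtain \<sigma>' m' \<gamma>' c' d' H' where 2: "\<sigma>' \<in> \<Sigma>" "m' \<in> local_data \<Sigma> a \<sigma>'" "\<gamma>' \<in> affine_pts \<sigma>'"
    "p = lvec \<Sigma> a \<sigma>' m' \<gamma>' c'" "q = lvec \<Sigma> a \<sigma>' m' \<gamma>' d'" "is_norm_sq g \<sigma>' m' \<gamma>' H'" "v' = c' * cnj d' * of_real H'"
    using assms(2) unfolding pairing_def by blast
  obtain \<delta> where \<delta>: "\<delta> \<in> affine_pts (\<sigma> \<inter> \<sigma>')" "\<gamma> = restrict \<delta> (dual_monoid \<sigma>)"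
    "\<gamma>' = restrict \<delta> (dual_monoid \<sigma>')" "c' = \<delta> (m' - m) * c"
    using lvec_eqD[OF 2(1-3) 2(4)[symmetric, unfolded 1(4)]] by blast
  obtain \<epsilon> where \<epsilon>: "\<epsilon> \<in> affine_pts (\<sigma> \<inter> \<sigma>')" "\<gamma> = restrict \<epsilon> (dual_monoid \<sigma>)" "d' = \<epsilon> (m' - m) * d"
    using lvec_eqD[OF 2(1-3) 2(5)[symmetric, unfolded 1(5)]] by blast
  have "\<delta> = \<epsilon>"
    by (rule affine_determined[OF cone_Int[OF 1(1) 2(1)] 1(1) Int_lower1 \<delta>(1) \<epsilon>(1)]) (use \<delta>(2) \<epsilon>(2) in simp)
  have "H = (norm (\<delta> (m' - m)))\<^sup>2 * H'"
    by (rule norm_sq_transition[OF 1(1) 2(1) 1(2) 2(2) \<delta>(1) 1(6)[unfolded \<delta>(2)] 2(6)[unfolded \<delta>(3)]])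
  then have "of_real H = \<delta> (m' - m) * cnj (\<delta> (m' - m)) * of_real H'"
    by (simp only: of_real_mult complex_norm_square)
  then show ?thesis
    unfolding 1(7) 2(7) \<delta>(4) \<epsilon>(3) \<open>\<delta> = \<epsilon>\<close>[symmetric] by (simp only: complex_cnj_mult mult_ac)
qed

lemma potential_metric_eq: "pairing g a p q v \<Longrightarrow> potential_metric g a p q = v"
  unfolding potential_metric_def using pairing_unique by (auto intro!: some_equality)

lemma pairing_lact:
  assumes "pairing g a p q v"
  shows "pairing g a (lact \<theta> p) (lact \<theta> q) v"
proof -
  obtain \<sigma> m \<gamma> c d H where 1: "\<sigma> \<in> \<Sigma>" "m \<in> local_data \<Sigma> a \<sigma>" "\<gamma> \<in> affine_pts \<sigma>"
    "p = lvec \<Sigma> a \<sigma> m \<gamma> c" "q = lvec \<Sigma> a \<sigma> m \<gamma> d" "is_norm_sq g \<sigma> m \<gamma> H" "v = c * cnj d * of_real H"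
    using assms(1) unfolding pairing_def by blast
  have "tends_to_pt \<sigma> (rot \<theta> \<sigma> \<gamma>) X \<longleftrightarrow> tends_to_pt \<sigma> \<gamma> X" for X
    by (simp add: tends_to_pt_def rot_apply norm_mult)
  then have "is_norm_sq g \<sigma> m (rot \<theta> \<sigma> \<gamma>) H" using 1(6) by (simp add: is_norm_sq_def)
  moreover have "v = (cis (m \<bullet> \<theta>) * c) * cnj (cis (m \<bullet> \<theta>) * d) * of_real H"
  proof -
    have "cis (m \<bullet> \<theta>) * cnj (cis (m \<bullet> \<theta>)) = 1" by (simp add: cis_cnj cis_mult)
    then show ?thesis unfolding 1(7) by (simp add: mult_ac)
  qed
  ultimately show ?thesis
    unfolding pairing_def 1(4,5) lact_lvec[OF affine_pts_ext[OF 1(3)]] using 1(1,2) rot_affine[OF 1(3)] by blast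
qed

lemma lact_inverse:
  assumes "p \<in> lfibre \<Sigma> a x"
  shows "lact (- \<theta>) (lact \<theta> p) = p"
proof -
  obtain \<sigma> m \<gamma> c where p: "p = lvec \<Sigma> a \<sigma> m \<gamma> c" "\<gamma> \<in> affine_pts \<sigma>" using assms unfolding lfibre_def by blast
  show ?thesis
    unfolding p(1) lact_lvec[OF affine_pts_ext[OF p(2)]] lact_lvec[OF affine_pts_ext[OF rot_affine[OF p(2)]]]
    using rot_inverse[OF affine_pts_ext[OF p(2)], of "- \<theta>"] by (simp add: mult.assoc[symmetric] cis_mult)
qed

lemma potential_metric_in_metrics:
  assumes g: "C2_fun g" and gr: "growth \<Sigma> a (grad g)"
  shows "potential_metric g a \<in> metrics \<Sigma> a"
  unfolding metrics_def
proof (intro CollectI conjI)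
  let ?h = "potential_metric g a"
  have val: "?h (lvec \<Sigma> a \<sigma> m \<gamma> c) (lvec \<Sigma> a \<sigma> m \<gamma> d) = c * cnj d * of_real H"
    if "\<sigma> \<in> \<Sigma>" "m \<in> local_data \<Sigma> a \<sigma>" "\<gamma> \<in> affine_pts \<sigma>" "is_norm_sq g \<sigma> m \<gamma> H" for \<sigma> m \<gamma> c d H
    by (rule potential_metric_eq) (use that in \<open>unfold pairing_def, blast\<close>)
  show "hermitian_metric \<Sigma> a ?h"
    unfolding hermitian_metric_def
  proof (intro ballI)
    fix \<sigma> m \<gamma> assume *: "\<sigma> \<in> \<Sigma>" "m \<in> local_data \<Sigma> a \<sigma>" "\<gamma> \<in> affine_pts \<sigma>"
    obtain H where "is_norm_sq g \<sigma> m \<gamma> H" using norm_sq_exists[OF g gr *] by blast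
    then show "\<exists>H::real. H > 0 \<and> (\<forall>c d. ?h (lvec \<Sigma> a \<sigma> m \<gamma> c) (lvec \<Sigma> a \<sigma> m \<gamma> d) = c * cnj d * of_real H)"
      using val[OF *] by (auto simp: is_norm_sq_def)
  qed
  show "C2_metric \<Sigma> a ?h"
    unfolding C2_metric_def
  proof (intro ballI)
    fix b m assume b: "b \<in> frames \<Sigma>" and m: "m \<in> local_data \<Sigma> a (fcone b)"
    obtain \<phi> where \<phi>: "C2_fun \<phi>" "\<And>z. is_norm_sq g (fcone b) m (chart b z) (exp (- 2 * \<phi> z))"
      using norm_sq_chart[OF g gr b m] by blast
    have "?h (lvec \<Sigma> a (fcone b) m (chart b z) 1) (lvec \<Sigma> a (fcone b) m (chart b z) 1) = of_real (exp (- 2 * \<phi> z))" for z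
      using val[OF frame_cone[OF b] m chart_affine[OF frame_zbasis[OF b]] \<phi>(2), of z 1 1] by simp
    moreover have "C2_fun (\<lambda>z. complex_of_real (exp (- 2 * \<phi> z)))"
      by (intro C2_fun_bounded_linear[OF bounded_linear_of_real] C2_fun_compose[OF C2_fun_exp]
          C2_fun_bounded_linear[OF bounded_linear_mult_right] \<phi>(1))
    ultimately show "C2_fun (\<lambda>z. ?h (lvec \<Sigma> a (fcone b) m (chart b z) 1) (lvec \<Sigma> a (fcone b) m (chart b z) 1))"
      by simp
  qed
  show "TN_invariant \<Sigma> a ?h"
    unfolding TN_invariant_def
  proof (intro allI ballI)
    fix \<theta> x p q assume p: "p \<in> lfibre \<Sigma> a x" and q: "q \<in> lfibre \<Sigma> a x"
    \<comment> \<open>Rotating back by \<open>- \<theta>\<close> makes the two relations equal, so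
      the choice or the default in \<open>potential_metric\<close> is the same on both
      sides.\<close>
    have "pairing g a (lact \<theta> p) (lact \<theta> q) = pairing g a p q"
      using pairing_lact[of g a p q _ \<theta>] pairing_lact[of g a "lact \<theta> p" "lact \<theta> q" _ "- \<theta>"]
      by (auto simp: fun_eq_iff lact_inverse[OF p] lact_inverse[OF q])
    then show "?h (lact \<theta> p) (lact \<theta> q) = ?h p q" by (simp only: potential_metric_def)
  qed
qed

lemma unit_potential_potential_metric:
  assumes g: "C2_fun g" and gr: "growth \<Sigma> a (grad g)"
  shows "unit_potential a (potential_metric g a) = g"
proof
  fix \<xi>
  obtain H where H: "is_norm_sq g {0} 0 (real_pt \<xi>) H"
    using norm_sq_exists[OF g gr zero_cone zero_local_data real_pt_affine] by blast
  \<comment> \<open>On the open orbit the constant sequence is admissible and evaluates the limit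
    exactly.\<close>
  have "tends_to_pt {0} (real_pt \<xi>) (\<lambda>_. \<xi>)" by (simp add: tends_to_pt_def real_pt_def)
  then have "(\<lambda>k::nat. exp (- 2 * (g \<xi> + 0 \<bullet> \<xi>))) \<longlonglongrightarrow> H" using H unfolding is_norm_sq_def by blast
  then have "H = exp (- 2 * g \<xi>)" using LIMSEQ_unique[OF tendsto_const] by fastforce
  moreover have "pairing g a (lvec \<Sigma> a {0} 0 (real_pt \<xi>) 1) (lvec \<Sigma> a {0} 0 (real_pt \<xi>) 1) (1 * cnj 1 * of_real H)"
    unfolding pairing_def using zero_cone zero_local_data real_pt_affine H by blast
  ultimately show "unit_potential a (potential_metric g a) \<xi> = g \<xi>"
    by (simp add: unit_potential_def potential_metric_eq)
qed

lemma growth_class_syz_mirror: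
  assumes "A \<in> AW \<Sigma>" "growth_class \<Sigma> A L"
  shows "\<exists>a\<in>Zd \<Sigma>. \<exists>h\<in>metrics \<Sigma> a. L = syz_mirror \<Sigma> a h"
proof -
  obtain y a where y: "is_lift y L" "a \<in> A" "growth \<Sigma> a y" using assms(2) unfolding growth_class_def by blast
  have a: "a \<in> Zd \<Sigma>" by (rule AW_mem(2)[OF assms(1) y(2)])
  obtain g where g: "C2_fun g" "y = grad g" using y(3) unfolding growth_def by blast
  have gr: "growth \<Sigma> a (grad g)" using y(3) g(2) by simp
  let ?h = "potential_metric g a"
  have h: "?h \<in> metrics \<Sigma> a" by (rule potential_metric_in_metrics[OF g(1) gr])
  have "syz_mirror \<Sigma> a ?h = section_of_potential (unit_potential a ?h)"
    using h g(1) by (intro syz_mirror_eq) (auto simp: metrics_def unit_potential_potential_metric[OF g(1) gr])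
  also have "\<dots> = L"
    using y(1) unfolding unit_potential_potential_metric[OF g(1) gr] section_of_potential_def is_lift_def g(2)
    by (simp add: fun_eq_iff)
  finally show ?thesis using a h by blast
qed

end

theorem theorem4p1:
  fixes \<Sigma> :: "(real^'n) set set"
  assumes "smooth_fan \<Sigma>" and "complete_fan \<Sigma>" and "projective_toric \<Sigma>"
  shows "syz_image \<Sigma> = LYW \<Sigma> \<and>
    (\<forall>L. lagrangian_section L \<longrightarrow>
       ((\<exists>a\<in>Zd \<Sigma>. \<exists>h\<in>metrics \<Sigma> a. L = syz_mirror \<Sigma> a h) \<longleftrightarrow>
        (\<exists>A\<in>AW \<Sigma>. growth_class \<Sigma> A L)))"
proof -
  interpret smooth_complete_fan \<Sigma> using assms(1,2) by unfold_locales
  have "(\<exists>a\<in>Zd \<Sigma>. \<exists>h\<in>metrics \<Sigma> a. L = syz_mirror \<Sigma> a h) \<longleftrightarrow>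
      lagrangian_section L \<and> (\<exists>A\<in>AW \<Sigma>. growth_class \<Sigma> A L)" for L
    using syz_mirror_growth growth_class_syz_mirror by blast
  then show ?thesis unfolding syz_image_def LYW_def by blast
qed

end
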